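(* Consider the centralized selection model described in the context, with latent utilities drawn i.i.d. from the uniform distribution on $[0,1]$ and preference lists drawn i.i.d. from an arbitrary distribution $\mathcal L$. Assume there are constants $\eta_1,\eta_2>0$ such that $n_j\ge\eta_1 n$ for each $j\in\{1,2\}$ and $K\ge\eta_2 n$. Let $f(x,y):=x-\frac{x(x+1)}{2(y+1)}$, $\alpha_1:=K-\frac{n_2}{\beta n_1+n_2}\max\{K-(1-\beta)n_1,0\}$, and $\alpha_2:=K-\alpha_1$. Then for any algorithm $\mathcal A$ that, given $\hat u$ and $\sigma$, outputs an assignment maximizing the total estimated utility of assigned candidates, $$\mathscr R(\mathcal A)=\max\left\{\frac{K-n_1(1-\beta)}{K\beta+n_2(1-\beta)},0\right\}\pm O\!\left(\frac{\sqrt{\log n}}{\eta_1\eta_2\sqrt n}\right),\qquad \mathscr U(\mathcal A)=\frac{\sum_{j=1}^2 f(\alpha_j,n_j)}{f(K,n)}\pm O\!\left(\frac{\sqrt{\log n}}{\eta_2\sqrt n}\right).$$ Moreover, if $\mathcal A$ is the algorithm $\mathcal A_{\rm st}$, then $$\mathscr P(\mathcal A)\le \max\left\{\frac{K-n_1(1-\beta)}{K\beta+n_2(1-\beta)},0\right\}+O\!\left(\frac{p\sqrt{\log n}}{\eta_1\eta_2\sqrt n}\right).$$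
   Context: Model: there are $n$ candidates and $p$ institutions; institution $\ell\in[p]$ has capacity $k_\ell\in\mathbb{Z}_{\ge0}$ and $K=\sum_{\ell} k_\ell\le n$. The candidates are partitioned into groups $G_1$ and $G_2$, $n_j=|G_j|$, $n=n_1+n_2$. Each candidate $i$ has a latent utility $u_i$ and a preference list $\sigma_i$ (a ranking of $[p]$), all independent. For a bias parameter $\beta\in(0,1]$, estimated utilities are $\hat u_i=u_i$ for $i\in G_1$ and $\hat u_i=\beta u_i$ for $i\in G_2$. An assignment is a partial function $M:[n]\to[p]$ with $|M^{-1}(\ell)|\le k_\ell$. Algorithm $\mathcal A_{\rm st}$: consider candidates in decreasing order of $\hat u_i$ and assign each to its most preferred institution that still has a vacant slot, until all slots are full. Metrics for an algorithm $\mathcal A$ outputting $M$ (expectations over utilities and preferences): $\mathscr U(\mathcal A)=\mathbb E\big[\sum_{i\in M^{-1}([p])}u_i/\mathsf U^\star(u)\big]$ with $\mathsf U^\star(u)$ the sum of the $K$ largest latent utilities; $\mathscr R(\mathcal A)=\mathbb E[\min_j\rho_j/\max_j\rho_j]$, $\rho_j$ the fraction of $G_j$ assigned to some institution; $\mathscr P(\mathcal A)=\mathbb E[\min_j\pi_j/\max_j\pi_j]$, $\pi_j$ the fraction of $G_j$ assigned to their first-ranked institution.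
   Formalization: The bound on P has an absolute constant in O(.) only when every capacity k_l is at least 1; if some capacity is 0 the constant may depend on p and L, since a uniform one fails (p=2, k=(0,n/2), L ranking institution 2 first with probability c/n). A ratio 0/0 is read as 0. *)

theory Defs
  imports "HOL-Probability.Probability" "HOL-Combinatorics.Combinatorics"
begin

text \<open>
  Candidates are \<open>{..<n}\<close>, institutions are \<open>{..<p}\<close>, and \<open>k l\<close> is the capacity of
  institution \<open>l\<close>.  A preference list is a permutation of \<open>{..<p}\<close>, most preferred institution
  first.  An assignment is a partial function from candidates to institutions.  An algorithm
  receives the estimated utilities and the preference lists of all candidates.
\<close>

type_synonym assignment = "nat \<rightharpoonup> nat"
type_synonym algorithm = "(nat \<Rightarrow> real) \<Rightarrow> (nat \<Rightarrow> nat list) \<Rightarrow> assignment"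

definition rankings :: "nat \<Rightarrow> nat list set" where
  "rankings p = permutations_of_set {..<p}"

definition total_capacity :: "nat \<Rightarrow> (nat \<Rightarrow> nat) \<Rightarrow> nat" where
  "total_capacity p k = (\<Sum>l<p. k l)"

definition assignments :: "nat \<Rightarrow> nat \<Rightarrow> (nat \<Rightarrow> nat) \<Rightarrow> assignment set" where
  "assignments n p k =
     {M. dom M \<subseteq> {..<n} \<and> ran M \<subseteq> {..<p} \<and> (\<forall>l<p. card {i. M i = Some l} \<le> k l)}"

definition est_utility :: "nat set \<Rightarrow> real \<Rightarrow> (nat \<Rightarrow> real) \<Rightarrow> nat \<Rightarrow> real" where
  "est_utility G2 \<beta> u i = (if i \<in> G2 then \<beta> * u i else u i)"

definition total_utility :: "(nat \<Rightarrow> real) \<Rightarrow> assignment \<Rightarrow> real" where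
  "total_utility w M = (\<Sum>i\<in>dom M. w i)"

definition maximizes_est_utility ::
    "nat \<Rightarrow> nat \<Rightarrow> (nat \<Rightarrow> nat) \<Rightarrow> nat set \<Rightarrow> real \<Rightarrow> algorithm \<Rightarrow> bool" where
  "maximizes_est_utility n p k G2 \<beta> \<A> \<longleftrightarrow>
     (\<forall>u \<in> {..<n} \<rightarrow>\<^sub>E {0..1}. \<forall>\<sigma> \<in> {..<n} \<rightarrow>\<^sub>E rankings p.
        let w = est_utility G2 \<beta> u in
          \<A> w \<sigma> \<in> assignments n p k \<and>
          (\<forall>M \<in> assignments n p k. total_utility w M \<le> total_utility w (\<A> w \<sigma>)))"

definition greedy_step ::
    "(nat \<Rightarrow> nat) \<Rightarrow> (nat \<Rightarrow> nat list) \<Rightarrow> nat \<Rightarrow> assignment \<Rightarrow> assignment" where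
  "greedy_step k \<sigma> i M =
     (case find (\<lambda>l. card {i'. M i' = Some l} < k l) (\<sigma> i) of
        None \<Rightarrow> M
      | Some l \<Rightarrow> M(i \<mapsto> l))"

text \<open>
  The candidates are processed by decreasing estimated utility; equal estimated utilities (an event
  of probability zero below) are processed by increasing index.  Once all slots are full,
  \<open>greedy_step\<close> leaves the assignment unchanged.
\<close>

definition alg_st :: "nat \<Rightarrow> (nat \<Rightarrow> nat) \<Rightarrow> algorithm" where
  "alg_st n k w \<sigma> = fold (greedy_step k \<sigma>) (sort_key (\<lambda>i. - w i) [0..<n]) Map.empty"

text \<open>
  Joint law of utilities and preference lists.  It is completed because an algorithm may break ties
  in a non-measurable way: the metrics of a utility maximizing algorithm are then still measurable,
  since they agree almost everywhere with Borel functions.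
\<close>

definition input_law ::
    "nat \<Rightarrow> nat list pmf \<Rightarrow> ((nat \<Rightarrow> real) \<times> (nat \<Rightarrow> nat list)) measure" where
  "input_law n L = completion
     (PiM {..<n} (\<lambda>_. uniform_measure lborel {0..1}) \<Otimes>\<^sub>M PiM {..<n} (\<lambda>_. measure_pmf L))"

definition optimal_utility :: "nat \<Rightarrow> nat \<Rightarrow> (nat \<Rightarrow> real) \<Rightarrow> real" where
  "optimal_utility n K u = sum_list (take K (rev (sort (map u [0..<n]))))"

definition assigned_fraction :: "nat set \<Rightarrow> assignment \<Rightarrow> real" where
  "assigned_fraction G M = real (card {i \<in> G. M i \<noteq> None}) / real (card G)"

definition first_choice_fraction :: "nat set \<Rightarrow> (nat \<Rightarrow> nat list) \<Rightarrow> assignment \<Rightarrow> real" where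
  "first_choice_fraction G \<sigma> M = real (card {i \<in> G. M i = Some (hd (\<sigma> i))}) / real (card G)"

text \<open>The value is 0 if both arguments are 0.\<close>

definition min_max_ratio :: "real \<Rightarrow> real \<Rightarrow> real" where
  "min_max_ratio x y = min x y / max x y"

definition utility_metric ::
    "nat \<Rightarrow> nat \<Rightarrow> nat set \<Rightarrow> real \<Rightarrow> nat list pmf \<Rightarrow> algorithm \<Rightarrow> real" where
  "utility_metric n K G2 \<beta> L \<A> =
     (LINT (u, \<sigma>) | input_law n L.
        total_utility u (\<A> (est_utility G2 \<beta> u) \<sigma>) / optimal_utility n K u)"

definition representation_metric ::
    "nat \<Rightarrow> nat set \<Rightarrow> nat set \<Rightarrow> real \<Rightarrow> nat list pmf \<Rightarrow> algorithm \<Rightarrow> real" where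
  "representation_metric n G1 G2 \<beta> L \<A> =
     (LINT (u, \<sigma>) | input_law n L.
        (let M = \<A> (est_utility G2 \<beta> u) \<sigma> in
          min_max_ratio (assigned_fraction G1 M) (assigned_fraction G2 M)))"

definition preference_metric ::
    "nat \<Rightarrow> nat set \<Rightarrow> nat set \<Rightarrow> real \<Rightarrow> nat list pmf \<Rightarrow> algorithm \<Rightarrow> real" where
  "preference_metric n G1 G2 \<beta> L \<A> =
     (LINT (u, \<sigma>) | input_law n L.
        (let M = \<A> (est_utility G2 \<beta> u) \<sigma> in
          min_max_ratio (first_choice_fraction G1 \<sigma> M) (first_choice_fraction G2 \<sigma> M)))"

definition selection_model ::
    "nat \<Rightarrow> nat \<Rightarrow> (nat \<Rightarrow> nat) \<Rightarrow> nat set \<Rightarrow> nat set \<Rightarrow> real \<Rightarrow> nat list pmf \<Rightarrow> real \<Rightarrow> real \<Rightarrow> bool"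
  where
  "selection_model n p k G1 G2 \<beta> L \<eta>1 \<eta>2 \<longleftrightarrow>
     0 < n \<and> total_capacity p k \<le> n \<and>
     G1 \<union> G2 = {..<n} \<and> G1 \<inter> G2 = {} \<and>
     0 < \<beta> \<and> \<beta> \<le> 1 \<and>
     set_pmf L \<subseteq> rankings p \<and>
     0 < \<eta>1 \<and> 0 < \<eta>2 \<and>
     real (card G1) \<ge> \<eta>1 * real n \<and> real (card G2) \<ge> \<eta>1 * real n \<and>
     real (total_capacity p k) \<ge> \<eta>2 * real n"

definition f_sel :: "real \<Rightarrow> real \<Rightarrow> real" where
  "f_sel x y = x - x * (x + 1) / (2 * (y + 1))"

definition \<alpha>1 :: "real \<Rightarrow> real \<Rightarrow> real \<Rightarrow> real \<Rightarrow> real" where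
  "\<alpha>1 \<beta> K n1 n2 = K - n2 / (\<beta> * n1 + n2) * max (K - (1 - \<beta>) * n1) 0"

definition \<alpha>2 :: "real \<Rightarrow> real \<Rightarrow> real \<Rightarrow> real \<Rightarrow> real" where
  "\<alpha>2 \<beta> K n1 n2 = K - \<alpha>1 \<beta> K n1 n2"

definition limit_ratio :: "real \<Rightarrow> real \<Rightarrow> real \<Rightarrow> real \<Rightarrow> real" where
  "limit_ratio \<beta> K n1 n2 = max ((K - n1 * (1 - \<beta>)) / (K * \<beta> + n2 * (1 - \<beta>))) 0"

end

theory Submission
  imports Defs
begin

text \<open>
  By Hoeffding's inequality and a union bound over a grid, with probability \<open>1 - O(1/n)\<close> the number
  of candidates of each group above any threshold is within \<open>\<epsilon> = O(sqrt (n log n))\<close> of its mean.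
  On this event monotonicity of the two mean counts in the threshold puts the numbers of selected
  candidates within \<open>3\<epsilon>\<close> of \<open>\<alpha>1\<close> and \<open>\<alpha>2\<close>, uniformly in \<open>\<beta>\<close>, and the utility of the \<open>x\<close> best of
  \<open>m\<close> candidates is the integral of \<open>min x (m(1 - t))\<close>, up to \<open>\<epsilon>\<close>.

  First choices need a different argument, because their number may stay bounded, so that it does
  not concentrate.  If \<open>\<beta>\<close> is close to 1 the limit is close to 1.  Otherwise many
  candidates of the first group precede everybody else.  Processing the queue, a candidate obtains
  the first choice with a conditional probability that never increases, and comparison with a
  constant probability shows that among the successes after the first one the expected share of the
  late candidates is at most their share of the queue.  The remaining candidates are exchangeable
  across the groups, and exchanging a late member of the second group with late members of the
  first one turns this into a bound on the expected ratio.  The first success pays for the exchange: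
  the exchanged candidate itself counts in one denominator and not in the other.
\<close>

subsection \<open>Counting and summing the best candidates\<close>

text \<open>The exchange rests on one identity of laws: conditioned on being at most \<beta>, a
  utility in the first group is uniform on [0, \<beta>], which is also the law of an estimated
  utility in the second group. Hence the queue of selected candidates is cut at \<beta>; above the
  cut only the first group occurs. The quotient min/max is at most the second group's rate of first
  choices divided by that of the first group. This is linear in the successes of the second group,
  so its members can be exchanged one at a time; it also explains why only an upper bound results.
  The early part is required to have at least 2 n \<delta> members, where \<delta> = sqrt (ln n /
  n): the estimates for the process lose a relative error \<kappa> / length, and n \<delta>^2 = ln n
  makes this at most \<kappa> \<delta>. The size of \<kappa> is governed by the wait for the first
  early success. If every institution has a slot, the first candidate succeeds surely. Otherwise the
  wait depends on the least positive success probability, which is bounded below because it is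
  determined by the set of vacant institutions.\<close>

definition upper_in :: "(nat \<Rightarrow> real) \<Rightarrow> nat set \<Rightarrow> nat set \<Rightarrow> bool" where
  "upper_in w A S \<longleftrightarrow> S \<subseteq> A \<and> (\<forall>i\<in>S. \<forall>j\<in>A - S. w j \<le> w i)"

text \<open>Strict and weak counts both occur because a top set with smallest value t lies between
  the candidates strictly above t and those at or above t.\<close>

definition uniform_counts :: "real \<Rightarrow> nat set \<Rightarrow> (nat \<Rightarrow> real) \<Rightarrow> bool" where
  "uniform_counts \<epsilon> G u \<longleftrightarrow>
     (\<forall>t\<in>{0..1}. \<bar>real (card {i\<in>G. t < u i}) - real (card G) * (1 - t)\<bar> \<le> \<epsilon> \<and>
                \<bar>real (card {i\<in>G. t \<le> u i}) - real (card G) * (1 - t)\<bar> \<le> \<epsilon>)"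

lemma uniform_countsD:
  assumes "uniform_counts \<epsilon> G u" "0 \<le> t" "t \<le> 1"
  shows "\<bar>real (card {i\<in>G. t < u i}) - real (card G) * (1 - t)\<bar> \<le> \<epsilon>"
    and "\<bar>real (card {i\<in>G. t \<le> u i}) - real (card G) * (1 - t)\<bar> \<le> \<epsilon>"
  using assms by (auto simp: uniform_counts_def)

lemma has_integral_of_bool_less:
  fixes c :: real
  assumes "0 \<le> c" "c \<le> 1"
  shows "((\<lambda>t. of_bool (t < c)) has_integral c) {0..1}"
proof -
  have "((\<lambda>t. 1::real) has_integral c) {0..c}"
    using has_integral_const_real[of "1::real" 0 c] assms by simp
  hence "((\<lambda>t. of_bool (t < c)) has_integral c) {0..c}"
    by (rule has_integral_spike_finite[rotated 2, of _ _ _ "{c}"]) auto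
  moreover have "((\<lambda>t. of_bool (t < c)) has_integral 0) {c..1}"
    by (rule has_integral_is_0) auto
  ultimately show ?thesis
    using has_integral_combine[of 0 c 1 "\<lambda>t. of_bool (t < c)" c 0] assms by simp
qed

text \<open>Layer-cake formula: each value in [0,1] is the integral of the indicator of t lying
  below it.\<close>

lemma sum_has_integral_card:
  assumes "finite S" "\<And>i. i \<in> S \<Longrightarrow> 0 \<le> u i \<and> u i \<le> (1::real)"
  shows "((\<lambda>t. real (card {i\<in>S. t < u i})) has_integral (\<Sum>i\<in>S. u i)) {0..1}"
proof -
  have "((\<lambda>t. \<Sum>i\<in>S. of_bool (t < u i)) has_integral (\<Sum>i\<in>S. u i)) {0..1}"
    using assms by (intro has_integral_sum has_integral_of_bool_less) auto
  moreover have "real (card {i\<in>S. t < u i}) = (\<Sum>i\<in>S. of_bool (t < u i))" for t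
    using assms(1) by (simp add: Int_def)
  ultimately show ?thesis by simp
qed

text \<open>Either all of \<open>S\<close> lies above t, or some member does not, and then
  everything above t must already be in \<open>S\<close>.\<close>

lemma card_upper_in:
  assumes "upper_in u G S" "finite G"
  shows "card {i\<in>S. t < u i} = min (card S) (card {i\<in>G. t < u i})"
proof -
  have S: "S \<subseteq> G" "finite S" using assms by (auto simp: upper_in_def intro: finite_subset)
  show ?thesis
  proof (cases "\<forall>i\<in>S. t < u i")
    case True
    hence "{i\<in>S. t < u i} = S" by auto
    moreover have "card S \<le> card {i\<in>G. t < u i}"
      using True S assms(2) by (intro card_mono) auto
    ultimately show ?thesis by simp
  next
    case False
    then obtain i where i: "i \<in> S" "u i \<le> t" by force
    have "j \<in> S" if "j \<in> G" "t < u j" for j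
      using assms(1) i that by (force simp: upper_in_def)
    hence "{i\<in>G. t < u i} = {i\<in>S. t < u i}" using S by auto
    moreover have "card {i\<in>S. t < u i} \<le> card S" using S by (intro card_mono) auto
    ultimately show ?thesis by simp
  qed
qed

lemma has_integral_min_linear:
  fixes x m :: real
  assumes "0 \<le> x" "x \<le> m" "0 < m"
  shows "((\<lambda>t. min x (m * (1 - t))) has_integral (x - x\<^sup>2 / (2 * m))) {0..1}"
proof -
  \<comment> \<open>The crossing point, where the decreasing line m(1 - t) falls to x.\<close>
  define c where "c = 1 - x / m"
  have c: "0 \<le> c" "c \<le> 1" using assms by (auto simp: c_def)
  have m: "m * (1 - c) = x" using assms by (simp add: c_def)
  have "((\<lambda>t. x) has_integral (c * x)) {0..c}"
    using has_integral_const_real[of x 0 c] c by simp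
  hence 1: "((\<lambda>t. min x (m * (1 - t))) has_integral (c * x)) {0..c}"
  proof (rule has_integral_eq[rotated])
    fix t assume "t \<in> {0..c}"
    hence "m * (1 - c) \<le> m * (1 - t)" using assms by (intro mult_left_mono) auto
    thus "x = min x (m * (1 - t))" using m by simp
  qed
  have "((\<lambda>t. m * (1 - t)) has_integral (m * (1 - 1/2) - m * (c - c\<^sup>2 / 2))) {c..1}"
  proof -
    have "((\<lambda>t. m * (t - t\<^sup>2 / 2)) has_vector_derivative m * (1 - t)) (at t within {c..1})" for t
      unfolding has_real_derivative_iff_has_vector_derivative[symmetric]
      by (auto intro!: derivative_eq_intros)
    thus ?thesis
      using c fundamental_theorem_of_calculus[of c 1 "\<lambda>t. m * (t - t\<^sup>2/2)" "\<lambda>t. m * (1 - t)"]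
      by simp
  qed
  hence 2: "((\<lambda>t. min x (m * (1 - t))) has_integral (m * (1 - 1/2) - m * (c - c\<^sup>2 / 2))) {c..1}"
  proof (rule has_integral_eq[rotated])
    fix t assume "t \<in> {c..1}"
    hence "m * (1 - t) \<le> m * (1 - c)" using assms by (intro mult_left_mono) auto
    thus "m * (1 - t) = min x (m * (1 - t))" using m by simp
  qed
  have "c * x + (m * (1 - 1/2) - m * (c - c\<^sup>2 / 2)) = x - x\<^sup>2 / (2 * m)"
    using assms by (simp add: c_def field_simps power2_eq_square)
  thus ?thesis using has_integral_combine[OF c 1 2] by simp
qed

text \<open>Taking the minimum with a constant is 1-Lipschitz, so the two layer-cake integrands
  differ by at most \<epsilon> at every threshold. Integration over [0,1] adds no factor.\<close>

lemma sum_upper_in_approx: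
  assumes "upper_in u G S" "finite G" "\<And>i. i \<in> G \<Longrightarrow> 0 \<le> u i \<and> u i \<le> 1"
    and "uniform_counts \<epsilon> G u" "0 < card G"
  shows "\<bar>(\<Sum>i\<in>S. u i) - (real (card S) - (real (card S))\<^sup>2 / (2 * real (card G)))\<bar> \<le> \<epsilon>"
proof -
  have S: "S \<subseteq> G" "finite S" using assms by (auto simp: upper_in_def intro: finite_subset)
  let ?f = "\<lambda>t. real (card {i\<in>S. t < u i})"
  let ?g = "\<lambda>t. min (real (card S)) (real (card G) * (1 - t))"
  have f: "(?f has_integral (\<Sum>i\<in>S. u i)) {0..1}"
    using S assms(3) by (intro sum_has_integral_card) auto
  have g: "(?g has_integral (real (card S) - (real (card S))\<^sup>2 / (2 * real (card G)))) {0..1}"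
    using assms(5) S assms(2) card_mono by (intro has_integral_min_linear) auto
  have *: "\<bar>?f t - ?g t\<bar> \<le> \<epsilon>" if "t \<in> {0..1}" for t
  proof -
    have "?f t = min (real (card S)) (real (card {i\<in>G. t < u i}))"
      using card_upper_in[OF assms(1,2), of t] by simp
    moreover have "\<bar>real (card {i\<in>G. t < u i}) - real (card G) * (1 - t)\<bar> \<le> \<epsilon>"
      using uniform_countsD(1)[OF assms(4)] that by auto
    ultimately show ?thesis by linarith
  qed
  have "\<epsilon> \<ge> 0" using *[of 0] by (auto intro: order_trans[OF abs_ge_zero])
  have "norm ((\<Sum>i\<in>S. u i) - (real (card S) - (real (card S))\<^sup>2 / (2 * real (card G))))
      \<le> \<epsilon> * measure lborel (cbox (0::real) 1)"
    by (rule has_integral_bound[OF \<open>\<epsilon> \<ge> 0\<close>, where f = "\<lambda>t. ?f t - ?g t"])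
      (use has_integral_diff[OF f g] * in auto)
  thus ?thesis by simp
qed

lemma sum_le_upper_in:
  fixes u :: "nat \<Rightarrow> real"
  assumes "upper_in u A T" "finite A" "S \<subseteq> A" "card S \<le> card T"
    and u: "\<And>i. i \<in> A \<Longrightarrow> 0 \<le> u i \<and> u i \<le> 1"
  shows "sum u S \<le> sum u T"
proof -
  have T: "T \<subseteq> A" "finite T" "finite S"
    using assms by (auto simp: upper_in_def intro: finite_subset)
  have "((\<lambda>t. real (card {i\<in>S. t < u i})) has_integral (\<Sum>i\<in>S. u i)) {0..1}"
    "((\<lambda>t. real (card {i\<in>T. t < u i})) has_integral (\<Sum>i\<in>T. u i)) {0..1}"
    using T assms by (auto intro!: sum_has_integral_card)
  moreover have "card {i\<in>S. t < u i} \<le> card {i\<in>T. t < u i}" for t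
  proof -
    have "card {i\<in>S. t < u i} \<le> card {i\<in>A. t < u i}" "card {i\<in>S. t < u i} \<le> card S"
      using assms T by (auto intro!: card_mono)
    thus ?thesis unfolding card_upper_in[OF assms(1,2)] using assms(4) by simp
  qed
  ultimately show ?thesis by (meson has_integral_le of_nat_mono)
qed

section \<open>Perturbation of quotients\<close>

lemma min_max_ratio_bounds:
  assumes "0 \<le> x" "0 \<le> y"
  shows "0 \<le> min_max_ratio x y" "min_max_ratio x y \<le> 1"
  using assms by (auto simp: min_max_ratio_def min_def max_def divide_le_eq_1)

text \<open>Writing the numerator as r y with r bounded avoids any lower bound on the random
  denominator y: only the limit b has to be positive.\<close>

lemma ratio_approx:
  fixes r :: real
  assumes "x = r * y" "\<bar>r\<bar> \<le> 1" "\<bar>x - a\<bar> \<le> d1" "\<bar>y - b\<bar> \<le> d2" "0 < b"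
  shows "\<bar>r - a / b\<bar> \<le> (d1 + d2) / b"
proof -
  have "r * b - a = (x - a) - r * (y - b)" using assms(1) by (simp add: algebra_simps)
  also have "\<bar>\<dots>\<bar> \<le> \<bar>x - a\<bar> + \<bar>r\<bar> * \<bar>y - b\<bar>" by (metis abs_mult abs_triangle_ineq4)
  also have "\<dots> \<le> d1 + 1 * d2" using assms by (intro add_mono mult_mono) auto
  finally have "\<bar>r * b - a\<bar> \<le> d1 + d2" by simp
  moreover have "r - a / b = (r * b - a) / b" using assms(5) by (simp add: field_simps)
  ultimately show ?thesis using assms(5) by (simp add: divide_right_mono)
qed

lemma min_max_ratio_approx:
  assumes "0 \<le> x" "0 \<le> y" "\<bar>x - a\<bar> \<le> d" "\<bar>y - b\<bar> \<le> d" "b \<le> a" "0 < a"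
  shows "\<bar>min_max_ratio x y - b / a\<bar> \<le> 2 * d / a"
proof -
  have "\<bar>min_max_ratio x y - b / a\<bar> \<le> (d + d) / a"
  proof (rule ratio_approx)
    show "min x y = min_max_ratio x y * max x y"
      using assms(1,2) by (auto simp: min_max_ratio_def min_def max_def)
    show "\<bar>min_max_ratio x y\<bar> \<le> 1" using min_max_ratio_bounds[OF assms(1,2)] by simp
  qed (use assms in \<open>auto simp: min_def max_def abs_if split: if_splits\<close>)
  thus ?thesis by simp
qed

section \<open>The limiting group counts\<close>

text \<open>The two limits are the mean counts of the groups above one common threshold \<tau> for
  estimated utilities. If K is at most (1 - \<beta>) n1, this threshold is at least \<beta> and the
  second group gets nothing; otherwise both groups contribute.\<close>

lemma alpha_threshold:
  assumes "0 < n1" "0 < n2" "0 < K" "K \<le> n1 + n2" "0 < \<beta>" "\<beta> \<le> 1"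
  obtains \<tau> where "0 \<le> \<tau>" "\<tau> \<le> 1" "\<alpha>1 \<beta> K n1 n2 = n1 * (1 - \<tau>)"
    "\<alpha>2 \<beta> K n1 n2 = n2 * max (1 - \<tau> / \<beta>) 0"
proof (cases "K \<le> (1 - \<beta>) * n1")
  case True
  have "(1 - \<beta>) * n1 \<le> n1" using assms by (simp add: algebra_simps)
  hence *: "K \<le> n1" using True by simp
  show thesis
  proof (rule that[of "1 - K / n1"])
    have "K / n1 \<le> 1 - \<beta>" using True assms(1) by (simp add: divide_le_eq)
    thus "\<alpha>2 \<beta> K n1 n2 = n2 * max (1 - (1 - K / n1) / \<beta>) 0"
      using True assms by (simp add: \<alpha>2_def \<alpha>1_def field_simps max_def)
  qed (use True * assms in \<open>auto simp: \<alpha>1_def max_def\<close>)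
next
  case False
  define D where "D = \<beta> * n1 + n2"
  have D: "0 < D" unfolding D_def using assms by (intro add_pos_pos mult_pos_pos) auto
  \<comment> \<open>The solution of n1 (1 - \<tau>) + n2 (1 - \<tau> / \<beta>) = K.\<close>
  define \<tau> where "\<tau> = (n1 + n2 - K) * \<beta> / D"
  have n: "n1 + n2 = D + (1 - \<beta>) * n1" by (simp add: D_def algebra_simps)
  have b: "1 - \<tau> / \<beta> = (K - (1 - \<beta>) * n1) / D"
    using assms D by (simp add: \<tau>_def n field_simps)
  have a2: "\<alpha>2 \<beta> K n1 n2 = n2 * (1 - \<tau> / \<beta>)"
    using False unfolding b by (simp add: \<alpha>2_def \<alpha>1_def D_def)
  have pos: "0 < 1 - \<tau> / \<beta>" unfolding b using False D by simp
  show thesis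
  proof (rule that[of \<tau>])
    show "0 \<le> \<tau>" unfolding \<tau>_def using assms D by (intro divide_nonneg_pos mult_nonneg_nonneg) auto
    have "\<tau> < \<beta>" using pos assms by (simp add: divide_less_eq)
    thus "\<tau> \<le> 1" using assms by simp
    show "\<alpha>2 \<beta> K n1 n2 = n2 * max (1 - \<tau> / \<beta>) 0" using a2 pos by simp
    have "n1 * (1 - \<tau>) + n2 * (1 - \<tau> / \<beta>) = n1 + n2 - \<tau> / \<beta> * D"
      using assms by (simp add: D_def field_simps)
    also have "\<tau> / \<beta> * D = n1 + n2 - K" using assms D by (simp add: \<tau>_def)
    finally show "\<alpha>1 \<beta> K n1 n2 = n1 * (1 - \<tau>)" using a2 by (simp add: \<alpha>2_def)
  qed
qed

text \<open>Since \<tau> is at most \<tau> / \<beta>, the first group is selected at no smaller rate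
  than the second, hence at least at the average rate K / (n1 + n2). This keeps the denominator of
  the limiting ratio away from 0.\<close>

lemma alpha_properties:
  assumes "0 < n1" "0 < n2" "0 < K" "K \<le> n1 + n2" "0 < \<beta>" "\<beta> \<le> 1"
  shows "\<alpha>1 \<beta> K n1 n2 + \<alpha>2 \<beta> K n1 n2 = K"
    and "0 \<le> \<alpha>2 \<beta> K n1 n2" "\<alpha>2 \<beta> K n1 n2 \<le> n2"
    and "0 \<le> \<alpha>1 \<beta> K n1 n2" "\<alpha>1 \<beta> K n1 n2 \<le> n1"
    and "\<alpha>2 \<beta> K n1 n2 / n2 \<le> \<alpha>1 \<beta> K n1 n2 / n1"
    and "K / (n1 + n2) \<le> \<alpha>1 \<beta> K n1 n2 / n1"
    and "limit_ratio \<beta> K n1 n2 = (\<alpha>2 \<beta> K n1 n2 / n2) / (\<alpha>1 \<beta> K n1 n2 / n1)"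
    and "0 \<le> limit_ratio \<beta> K n1 n2" "limit_ratio \<beta> K n1 n2 \<le> 1"
proof -
  obtain \<tau> where \<tau>: "0 \<le> \<tau>" "\<tau> \<le> 1" "\<alpha>1 \<beta> K n1 n2 = n1 * (1 - \<tau>)"
    "\<alpha>2 \<beta> K n1 n2 = n2 * max (1 - \<tau> / \<beta>) 0"
    using alpha_threshold[OF assms] by blast
  show sum: "\<alpha>1 \<beta> K n1 n2 + \<alpha>2 \<beta> K n1 n2 = K" by (simp add: \<alpha>2_def)
  show a2: "0 \<le> \<alpha>2 \<beta> K n1 n2" "\<alpha>2 \<beta> K n1 n2 \<le> n2"
    using \<tau> assms by (auto intro!: mult_left_le)
  show a1: "0 \<le> \<alpha>1 \<beta> K n1 n2" "\<alpha>1 \<beta> K n1 n2 \<le> n1"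
    using \<tau> assms by (auto intro!: mult_left_le)
  have "\<tau> \<le> \<tau> / \<beta>" using assms \<tau> by (simp add: le_divide_eq mult_left_le)
  thus r: "\<alpha>2 \<beta> K n1 n2 / n2 \<le> \<alpha>1 \<beta> K n1 n2 / n1"
    using \<tau> assms by simp
  hence "\<alpha>2 \<beta> K n1 n2 \<le> n2 * (\<alpha>1 \<beta> K n1 n2 / n1)"
    using assms by (simp add: field_simps)
  hence "K \<le> (n1 + n2) * (\<alpha>1 \<beta> K n1 n2 / n1)"
  proof -
    have "n1 * (\<alpha>1 \<beta> K n1 n2 / n1) = \<alpha>1 \<beta> K n1 n2" using assms by simp
    thus ?thesis using sum \<open>\<alpha>2 \<beta> K n1 n2 \<le> n2 * (\<alpha>1 \<beta> K n1 n2 / n1)\<close>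
      unfolding distrib_right by linarith
  qed
  thus k: "K / (n1 + n2) \<le> \<alpha>1 \<beta> K n1 n2 / n1"
    using assms by (simp add: divide_le_eq mult.commute)
  have pos: "0 < \<alpha>1 \<beta> K n1 n2 / n1"
    using k assms by (meson add_pos_pos divide_pos_pos less_le_trans)
  show l: "limit_ratio \<beta> K n1 n2 = (\<alpha>2 \<beta> K n1 n2 / n2) / (\<alpha>1 \<beta> K n1 n2 / n1)"
  proof (cases "K \<le> (1 - \<beta>) * n1")
    case True
    have "0 \<le> K * \<beta> + n2 * (1 - \<beta>)" using assms by (intro add_nonneg_nonneg) auto
    hence "(K - n1 * (1 - \<beta>)) / (K * \<beta> + n2 * (1 - \<beta>)) \<le> 0"
      using True by (intro divide_nonpos_nonneg) (auto simp: mult.commute)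
    thus ?thesis using True by (simp add: limit_ratio_def \<alpha>2_def \<alpha>1_def)
  next
    case False
    define D where "D = \<beta> * n1 + n2"
    have D: "0 < D" unfolding D_def using assms by (intro add_pos_pos mult_pos_pos) auto
    have D': "0 < K * \<beta> + n2 * (1 - \<beta>)" using assms by (intro add_pos_nonneg) auto
    have x2: "\<alpha>2 \<beta> K n1 n2 / n2 = (K - (1 - \<beta>) * n1) / D"
      using False assms by (simp add: \<alpha>2_def \<alpha>1_def D_def)
    have "\<alpha>1 \<beta> K n1 n2 = (K * D - n2 * (K - (1 - \<beta>) * n1)) / D"
      using False D by (simp add: \<alpha>1_def D_def[symmetric] diff_divide_distrib)
    also have "K * D - n2 * (K - (1 - \<beta>) * n1) = n1 * (K * \<beta> + n2 * (1 - \<beta>))"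
      by (simp add: D_def algebra_simps)
    finally have x1: "\<alpha>1 \<beta> K n1 n2 / n1 = (K * \<beta> + n2 * (1 - \<beta>)) / D"
      using assms by simp
    show ?thesis unfolding x1 x2 using False D D'
      by (simp add: limit_ratio_def mult.commute)
  qed
  show "0 \<le> limit_ratio \<beta> K n1 n2" by (simp add: limit_ratio_def)
  show "limit_ratio \<beta> K n1 n2 \<le> 1" unfolding l using r pos by (metis divide_le_eq_1_pos)
qed

text \<open>For \<beta> near 1 the limit is so close to 1 that the trivial bound 1 on the preference
  metric suffices.\<close>

lemma limit_ratio_ge:
  assumes "0 < n1" "0 < n2" "0 < K" "K \<le> n1 + n2" "1/2 \<le> \<beta>" "\<beta> \<le> 1"
  shows "1 - 2 * (1 - \<beta>) * (n1 + n2) / K \<le> limit_ratio \<beta> K n1 n2"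
proof -
  define D where "D = K * \<beta> + n2 * (1 - \<beta>)"
  have D: "K / 2 \<le> D"
    unfolding D_def using assms mult_left_mono[of "1/2" \<beta> K] by (intro add_increasing2) auto
  have "(1 - \<beta>) * (n1 + n2 - K) / D \<le> (1 - \<beta>) * (n1 + n2) / (K / 2)"
    using assms D by (intro frac_le mult_left_mono) auto
  moreover have "(K - n1 * (1 - \<beta>)) / D = 1 - (1 - \<beta>) * (n1 + n2 - K) / D"
    using D assms by (simp add: D_def field_simps)
  ultimately have "1 - 2 * (1 - \<beta>) * (n1 + n2) / K \<le> (K - n1 * (1 - \<beta>)) / D"
    by (simp add: algebra_simps)
  thus ?thesis by (simp add: limit_ratio_def D_def[symmetric])
qed

lemma selected_counts:
  fixes u :: "nat \<Rightarrow> real"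
  assumes G: "G1 \<union> G2 = {..<n}" "G1 \<inter> G2 = {}" "0 < card G1" "0 < card G2"
    and \<beta>: "0 < \<beta>" "\<beta> \<le> 1"
    and u: "\<And>i. i < n \<Longrightarrow> 0 \<le> u i \<and> u i \<le> 1"
    and S: "upper_in (est_utility G2 \<beta> u) {..<n} S" "card S = K" "0 < K"
    and c: "uniform_counts \<epsilon> G1 u" "uniform_counts \<epsilon> G2 u"
  shows "\<bar>real (card (S \<inter> G1)) - \<alpha>1 \<beta> (real K) (real (card G1)) (real (card G2))\<bar> \<le> 3 * \<epsilon>"
    and "\<bar>real (card (S \<inter> G2)) - \<alpha>2 \<beta> (real K) (real (card G1)) (real (card G2))\<bar> \<le> 3 * \<epsilon>"
proof -
  define w where "w = est_utility G2 \<beta> u"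
  define n1 n2 where "n1 = real (card G1)" and "n2 = real (card G2)"
  have Sn: "S \<subseteq> {..<n}" using S by (auto simp: upper_in_def)
  have fin: "finite S" "finite G1" "finite G2"
    using Sn G finite_subset[of _ "{..<n}"] by auto
  have Kn: "K = card (S \<inter> G1) + card (S \<inter> G2)"
  proof -
    have "S = (S \<inter> G1) \<union> (S \<inter> G2)" using Sn G by auto
    thus ?thesis using card_Un_disjoint[of "S \<inter> G1" "S \<inter> G2"] fin G S(2) by auto
  qed
  have n12: "real K \<le> n1 + n2"
    unfolding Kn n1_def n2_def of_nat_add using fin by (intro add_mono) (auto intro: card_mono)
  have lt: "i < n" if "i \<in> G1 \<or> i \<in> G2" for i using that G by auto
  have w1: "w i = u i" if "i \<in> G1" for i using that G by (auto simp: w_def est_utility_def)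
  have w2: "w i = \<beta> * u i" if "i \<in> G2" for i using that by (auto simp: w_def est_utility_def)
  have wb: "0 \<le> w i \<and> w i \<le> 1" if "i < n" for i
    using u[OF that] \<beta> by (auto simp: w_def est_utility_def intro: mult_le_one)
  \<comment> \<open>The empirical threshold. It is compared below with the deterministic threshold
    \<tau>, without estimating their distance.\<close>
  define t where "t = Min (w ` S)"
  have ne: "S \<noteq> {}" using S by auto
  have tS: "t \<le> w i" if "i \<in> S" for i using that fin by (auto simp: t_def)
  have "t \<in> w ` S" unfolding t_def using fin ne by (intro Min_in) auto
  then obtain i0 where i0: "i0 \<in> S" "w i0 = t" by auto
  have t01: "0 \<le> t" "t \<le> 1" using wb[of i0] i0 Sn by auto
  have up: "i \<in> S" if "i < n" "t < w i" for i
  proof (rule ccontr)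
    assume "i \<notin> S"
    hence "w i \<le> w i0" using S(1) i0(1) that(1) unfolding upper_in_def w_def[symmetric] by blast
    thus False using i0(2) that(2) by simp
  qed
  define e2 where "e2 = n2 * max (1 - t / \<beta>) 0"
  have N1: "\<bar>real (card (S \<inter> G1)) - n1 * (1 - t)\<bar> \<le> \<epsilon>"
  proof -
    have "{i\<in>G1. t < u i} \<subseteq> S \<inter> G1" using up w1 lt by auto
    hence "card {i\<in>G1. t < u i} \<le> card (S \<inter> G1)" using fin by (intro card_mono) auto
    moreover have "S \<inter> G1 \<subseteq> {i\<in>G1. t \<le> u i}" using tS w1 by (auto simp flip: w1)
    hence "card (S \<inter> G1) \<le> card {i\<in>G1. t \<le> u i}" using fin by (intro card_mono) auto
    ultimately show ?thesis using uniform_countsD[OF c(1) t01] unfolding n1_def by linarith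
  qed
  have N2: "\<bar>real (card (S \<inter> G2)) - e2\<bar> \<le> \<epsilon>"
  proof -
    have "{i\<in>G2. t / \<beta> < u i} \<subseteq> S \<inter> G2"
      using up w2 lt \<beta> by (auto simp: divide_less_eq mult.commute)
    hence "card {i\<in>G2. t / \<beta> < u i} \<le> card (S \<inter> G2)" using fin by (intro card_mono) auto
    moreover have "S \<inter> G2 \<subseteq> {i\<in>G2. t / \<beta> \<le> u i}"
      using tS \<beta> by (auto simp: divide_le_eq mult.commute simp flip: w2)
    hence le: "card (S \<inter> G2) \<le> card {i\<in>G2. t / \<beta> \<le> u i}" using fin by (intro card_mono) auto
    moreover have "0 \<le> t / \<beta>" using t01 \<beta> by simp
    moreover have "\<epsilon> \<ge> 0" using N1 by linarith
    ultimately show ?thesis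
    \<comment> \<open>The counts are controlled for thresholds in [0,1] only. Above 1 no member of
      the second group can be selected and the mean is 0 as well.\<close>
    proof (cases "t / \<beta> \<le> 1")
      case False
      hence "{i\<in>G2. t / \<beta> \<le> u i} = {}" using u[OF lt] by fastforce
      hence "card (S \<inter> G2) = 0" using le by (metis card.empty le_zero_eq)
      thus ?thesis using False \<open>\<epsilon> \<ge> 0\<close> by (simp add: e2_def)
    next
      case True
      have "e2 = n2 * (1 - t / \<beta>)" using True by (simp add: e2_def)
      thus ?thesis
        using uniform_countsD[OF c(2) \<open>0 \<le> t / \<beta>\<close> True]
          \<open>card {i\<in>G2. t / \<beta> < u i} \<le> card (S \<inter> G2)\<close> le
        unfolding n2_def by linarith
    qed
  qed
  have pos: "0 < n1" "0 < n2" "0 < real K" using G S by (auto simp: n1_def n2_def)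
  obtain \<tau> where \<tau>: "0 \<le> \<tau>" "\<tau> \<le> 1" "\<alpha>1 \<beta> K n1 n2 = n1 * (1 - \<tau>)"
    "\<alpha>2 \<beta> K n1 n2 = n2 * max (1 - \<tau> / \<beta>) 0"
    using alpha_threshold[OF pos n12 \<beta>] by blast
  define a1 a2 where "a1 = \<alpha>1 \<beta> K n1 n2" and "a2 = \<alpha>2 \<beta> K n1 n2"
  have a: "a1 + a2 = K" by (simp add: a1_def a2_def \<alpha>2_def)
  have mono: "n1 * (1 - x) \<le> n1 * (1 - y) \<and> n2 * max (1 - x / \<beta>) 0 \<le> n2 * max (1 - y / \<beta>) 0"
    if "y \<le> x" for x y
    using that pos \<beta> divide_right_mono[of y x \<beta>] by (auto intro!: mult_left_mono max.mono)
  \<comment> \<open>Both mean counts decrease in the threshold, so their deviations from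
    \<open>a1\<close> and \<open>a2\<close> have the same sign. Each is therefore bounded by the
    deviation of the sum, which is at most 2 \<epsilon>; the counting error adds one more
    \<epsilon>. No slope enters, hence no dependence on \<beta>.\<close>
  have "(n1 * (1 - t) \<le> a1 \<and> e2 \<le> a2) \<or> (a1 \<le> n1 * (1 - t) \<and> a2 \<le> e2)"
    using mono[of t \<tau>] mono[of \<tau> t] unfolding a1_def a2_def \<tau> e2_def by linarith
  moreover have "\<bar>n1 * (1 - t) + e2 - K\<bar> \<le> 2 * \<epsilon>" using N1 N2 unfolding Kn by simp
  ultimately have "\<bar>real (card (S \<inter> G1)) - a1\<bar> \<le> 3 * \<epsilon> \<and> \<bar>real (card (S \<inter> G2)) - a2\<bar> \<le> 3 * \<epsilon>"
    using N1 N2 a by linarith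
  thus "\<bar>real (card (S \<inter> G1)) - \<alpha>1 \<beta> (real K) (real (card G1)) (real (card G2))\<bar> \<le> 3 * \<epsilon>"
    and "\<bar>real (card (S \<inter> G2)) - \<alpha>2 \<beta> (real K) (real (card G1)) (real (card G2))\<bar> \<le> 3 * \<epsilon>"
    unfolding a1_def a2_def n1_def n2_def by auto
qed

subsection \<open>Concentration of the utilities\<close>

abbreviation unif :: "real measure" where "unif \<equiv> uniform_measure lborel {0..1}"

abbreviation utility_law :: "nat \<Rightarrow> (nat \<Rightarrow> real) measure" where
  "utility_law n \<equiv> PiM {..<n} (\<lambda>_. unif)"

lemma prob_space_unif: "prob_space unif"
  by (rule prob_space_uniform_measure) auto

interpretation unif: prob_space unif by (rule prob_space_unif)

interpretation utilities: product_prob_space "\<lambda>_::nat. unif" UNIV ..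

lemma prob_space_utility_law: "prob_space (utility_law n)"
  by (intro prob_space_PiM prob_space_unif)

lemma measure_unif_greater:
  assumes "0 \<le> t" "t \<le> 1"
  shows "measure unif {x. t < x} = 1 - t"
proof -
  have "{0..1} \<inter> {x. t < x} = {t<..1}" using assms by auto
  thus ?thesis using assms by (simp add: measure_uniform_measure)
qed

lemma AE_unif: "AE x in unif. 0 < x \<and> x \<le> 1"
  by (rule AE_uniform_measureI) (use AE_lborel_singleton[of 0] in \<open>auto elim!: eventually_mono\<close>)

lemma AE_unif_neq: "AE x in unif. x \<noteq> c"
  by (rule AE_uniform_measureI) (use AE_lborel_singleton[of c] in \<open>auto elim!: eventually_mono\<close>)

lemma AE_utilities_range: "AE u in utility_law n. \<forall>i<n. 0 < u i \<and> u i \<le> 1"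
proof -
  have "AE u in utility_law n. 0 < u i \<and> u i \<le> 1" if "i \<in> {..<n}" for i
    by (rule AE_PiM_component[OF prob_space_unif that AE_unif])
  hence "AE u in utility_law n. \<forall>i\<in>{..<n}. 0 < u i \<and> u i \<le> 1"
    by (intro AE_finite_allI) auto
  thus ?thesis by eventually_elim auto
qed

text \<open>By Fubini: with the other coordinates fixed, the event confines coordinate i to a single
  point.\<close>

lemma AE_utilities_neq:
  assumes "i < n" "j < n" "i \<noteq> j"
  shows "AE u in utility_law n. u i \<noteq> c * u j"
proof -
  let ?I = "{..<n} - {i}"
  have ins: "insert i ?I = {..<n}" using assms by auto
  have [measurable]: "(\<lambda>u. u i) \<in> borel_measurable (utility_law n)"
    "(\<lambda>u. u j) \<in> borel_measurable (utility_law n)"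
    using assms by (auto intro!: measurable_PiM_component_rev)
  have meas: "{u \<in> space (utility_law n). u i = c * u j} \<in> sets (utility_law n)" by measurable
  define f :: "(nat \<Rightarrow> real) \<Rightarrow> ennreal" where "f = (\<lambda>u. if u i = c * u j then 1 else 0)"
  have [measurable]: "f \<in> borel_measurable (utility_law n)" unfolding f_def by measurable
  have "emeasure (utility_law n) {u \<in> space (utility_law n). u i = c * u j} = (\<integral>\<^sup>+u. f u \<partial>utility_law n)"
    unfolding nn_integral_indicator[OF meas, symmetric]
    by (intro nn_integral_cong) (auto simp: f_def indicator_def)
  also have "\<dots> = (\<integral>\<^sup>+x. (\<integral>\<^sup>+y. f (x(i := y)) \<partial>unif) \<partial>PiM ?I (\<lambda>_. unif))"
    using utilities.product_nn_integral_insert[of ?I i f] unfolding ins by simp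
  also have "\<dots> = (\<integral>\<^sup>+x. 0 \<partial>PiM ?I (\<lambda>_. unif))"
  proof (rule nn_integral_cong)
    fix x :: "nat \<Rightarrow> real"
    have "AE y in unif. f (x(i := y)) = 0"
      using AE_unif_neq[of "c * x j"] by eventually_elim (use assms(3) in \<open>simp add: f_def\<close>)
    thus "(\<integral>\<^sup>+y. f (x(i := y)) \<partial>unif) = 0" by (subst nn_integral_cong_AE) auto
  qed
  finally have "emeasure (utility_law n) {u \<in> space (utility_law n). u i = c * u j} = 0" by simp
  thus ?thesis using meas by (intro AE_I[where N = "{u \<in> space (utility_law n). u i = c * u j}"]) auto
qed

lemma AE_est_utility_inj:
  assumes "0 < \<beta>"
  shows "AE u in utility_law n. inj_on (est_utility G2 \<beta> u) {..<n}"
proof -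
  have "AE u in utility_law n. est_utility G2 \<beta> u i \<noteq> est_utility G2 \<beta> u j"
    if "i < n" "j < n" "i \<noteq> j" for i j
  proof -
    define a where "a = (\<lambda>i. if i \<in> G2 then \<beta> else 1)"
    have w: "est_utility G2 \<beta> u i = a i * u i" "a i > 0" for u i
      using assms by (auto simp: est_utility_def a_def)
    show ?thesis
      using AE_utilities_neq[OF that, of "a j / a i"] by eventually_elim (use w(2)[of i] in \<open>auto simp: w(1) field_simps\<close>)
  qed
  hence "AE u in utility_law n. \<forall>i\<in>{..<n}. \<forall>j\<in>{..<n}. i \<noteq> j \<longrightarrow>
      est_utility G2 \<beta> u i \<noteq> est_utility G2 \<beta> u j"
    by (intro AE_finite_allI) auto
  thus ?thesis by eventually_elim (auto simp: inj_on_def)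
qed

lemma indep_vars_utilities:
  assumes "0 < n"
  shows "prob_space.indep_vars (utility_law n) (\<lambda>_. unif) (\<lambda>i u. u i) {..<n}"
proof -
  interpret prob_space "utility_law n" by (rule prob_space_utility_law)
  have "distr (utility_law n) (utility_law n) (\<lambda>x. \<lambda>i\<in>{..<n}. x i) = distr (utility_law n) (utility_law n) (\<lambda>x. x)"
    by (rule distr_cong) (auto simp: space_PiM)
  also have "\<dots> = utility_law n" by simp
  also have "\<dots> = PiM {..<n} (\<lambda>i. distr (utility_law n) unif (\<lambda>x. x i))"
    by (intro PiM_cong refl distr_PiM_component[symmetric] prob_space_unif)
  finally show ?thesis
    using assms by (subst indep_vars_iff_distr_eq_PiM') auto
qed

lemma count_concentration:
  assumes "G \<subseteq> {..<n}" "G \<noteq> {}" "0 \<le> t" "t \<le> 1" "0 \<le> \<epsilon>"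
  shows "measure (utility_law n) {u \<in> space (utility_law n).
      \<epsilon> \<le> \<bar>real (card {i\<in>G. t < u i}) - real (card G) * (1 - t)\<bar>}
    \<le> 2 * exp (- 2 * \<epsilon>\<^sup>2 / real (card G))"
proof -
  interpret prob_space "utility_law n" by (rule prob_space_utility_law)
  define X where "X = (\<lambda>(i::nat) (u::nat\<Rightarrow>real). of_bool (t < u i) :: real)"
  have fin: "finite G" using assms(1) finite_subset by blast
  have n: "0 < n" using assms by auto
  have cG: "0 < card G" using fin assms by (simp add: card_gt_0_iff)
  have [measurable]: "(\<lambda>x. of_bool (t < x) :: real) \<in> unif \<rightarrow>\<^sub>M borel" by simp
  have ind: "indep_vars (\<lambda>_. borel) X G"
    using indep_vars_compose2[OF indep_vars_subset[OF indep_vars_utilities[OF n] assms(1)],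
        of "\<lambda>_ x. of_bool (t < x) :: real" "\<lambda>_. borel"] by (simp add: X_def)
  have E: "expectation (X i) = 1 - t" if "i \<in> G" for i
  proof -
    have "expectation (X i) = (\<integral>x. of_bool (t < x) \<partial>distr (utility_law n) unif (\<lambda>u. u i))"
      unfolding X_def using that assms(1) by (subst integral_distr) auto
    also have "distr (utility_law n) unif (\<lambda>u. u i) = unif"
      using that assms(1) by (intro distr_PiM_component prob_space_unif) auto
    also have "(\<integral>x. of_bool (t < x) \<partial>unif) = (\<integral>x. indicator {x. t < x} x \<partial>unif)"
      by (rule Bochner_Integration.integral_cong) (auto simp: indicator_def)
    also have "\<dots> = 1 - t" using measure_unif_greater[OF assms(3,4)] by simp
    finally show ?thesis .
  qed
  interpret Hoeffding_ineq "utility_law n" G X "\<lambda>_. 0" "\<lambda>_. 1" "real (card G) * (1 - t)"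
  proof unfold_locales
    show "finite G" by fact
    show "indep_vars (\<lambda>_. borel) X G" by fact
    show "AE x in utility_law n. X i x \<in> {0..1}" for i by (auto simp: X_def)
    show "real (card G) * (1 - t) \<equiv> \<Sum>i\<in>G. expectation (X i)" by (rule eq_reflection) (simp add: E)
  qed
  have "(\<Sum>i\<in>G. X i u) = real (card {i\<in>G. t < u i})" for u
    using fin by (simp add: X_def Int_def)
  thus ?thesis using Hoeffding_ineq_abs_ge[OF assms(5)] cG by simp
qed

text \<open>Finitely many thresholds, so that a union bound applies.\<close>

definition grid_counts :: "nat \<Rightarrow> nat set \<Rightarrow> (nat \<Rightarrow> real) \<Rightarrow> bool" where
  "grid_counts n G u \<longleftrightarrow> (\<forall>m\<in>{..n}.
     \<bar>real (card {i\<in>G. real m / real n < u i}) - real (card G) * (1 - real m / real n)\<bar>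
       < sqrt (real n * ln (real n)))"

lemma measurable_card_greater [measurable]:
  assumes "G \<subseteq> {..<n}"
  shows "(\<lambda>u. real (card {i\<in>G. t < u i})) \<in> borel_measurable (utility_law n)"
proof -
  have fin: "finite G" using assms finite_subset by blast
  have *: "real (card {i\<in>G. t < u i}) = (\<Sum>i\<in>G. of_bool (t < u i))" for u
    using fin by (simp add: Int_def)
  have "(\<lambda>u. of_bool (t < u i) :: real) \<in> borel_measurable (utility_law n)" if "i \<in> G" for i
    using that assms by (intro measurable_PiM_component_rev) auto
  thus ?thesis unfolding * by (intro borel_measurable_sum) auto
qed

lemma sets_grid_counts:
  assumes "G \<subseteq> {..<n}"
  shows "{u \<in> space (utility_law n). grid_counts n G u} \<in> sets (utility_law n)"
proof -
  note [measurable] = measurable_card_greater[OF assms]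
  show ?thesis unfolding grid_counts_def by measurable
qed

lemma prob_not_grid_counts:
  assumes "G \<subseteq> {..<n}" "G \<noteq> {}" "2 \<le> n"
  shows "measure (utility_law n) {u \<in> space (utility_law n). \<not> grid_counts n G u} \<le> 4 / real n"
proof -
  interpret prob_space "utility_law n" by (rule prob_space_utility_law)
  note [measurable] = measurable_card_greater[OF assms(1)]
  \<comment> \<open>With this deviation the exponent in Hoeffding's inequality is at most -2 ln n,
    so each grid point fails with probability at most 2 / n^2 and all n + 1 of them together with
    probability O(1/n).\<close>
  define e where "e = sqrt (real n * ln (real n))"
  define B where "B = (\<lambda>m. {u \<in> space (utility_law n).
      e \<le> \<bar>real (card {i\<in>G. real m / real n < u i}) - real (card G) * (1 - real m / real n)\<bar>})"
  have fin: "finite G" using assms finite_subset by blast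
  have cG: "0 < card G" "card G \<le> n"
    using fin assms card_mono[of "{..<n}" G] by (auto simp: card_gt_0_iff)
  have e2: "e\<^sup>2 = real n * ln (real n)" "0 \<le> e" using assms by (auto simp: e_def)
  have "prob (B m) \<le> 2 / (real n)\<^sup>2" if "m \<in> {..n}" for m
  proof -
    have "prob (B m) \<le> 2 * exp (- 2 * e\<^sup>2 / real (card G))"
      unfolding B_def using that assms e2(2) by (intro count_concentration) auto
    also have "- 2 * e\<^sup>2 / real (card G) \<le> - 2 * e\<^sup>2 / real n"
      using cG assms by (simp add: frac_le)
    hence "2 * exp (- 2 * e\<^sup>2 / real (card G)) \<le> 2 * exp (- 2 * e\<^sup>2 / real n)" by simp
    also have "- 2 * e\<^sup>2 / real n = - (2 * ln (real n))" using assms by (simp add: e2)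
    also have "exp \<dots> = 1 / (real n)\<^sup>2"
      using assms by (simp add: exp_minus inverse_eq_divide exp_of_nat_mult[of 2, simplified])
    finally show ?thesis by simp
  qed
  hence "(\<Sum>m\<in>{..n}. prob (B m)) \<le> (\<Sum>m\<in>{..n}. 2 / (real n)\<^sup>2)" by (rule sum_mono)
  also have "\<dots> = (real n + 1) * 2 / (real n)\<^sup>2" by simp
  also have "\<dots> \<le> (2 * real n) * 2 / (real n)\<^sup>2"
    using assms by (intro divide_right_mono mult_right_mono) auto
  also have "\<dots> = 4 / real n" using assms by (simp add: power2_eq_square)
  finally have "(\<Sum>m\<in>{..n}. prob (B m)) \<le> 4 / real n" .
  moreover have "{u \<in> space (utility_law n). \<not> grid_counts n G u} = (\<Union>m\<in>{..n}. B m)"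
    unfolding grid_counts_def B_def e_def by (auto simp: not_less)
  moreover have "prob (\<Union>m\<in>{..n}. B m) \<le> (\<Sum>m\<in>{..n}. prob (B m))"
    unfolding B_def by (rule finite_measure_subadditive_finite) auto
  ultimately show ?thesis by simp
qed

text \<open>Counts are monotone in the threshold, and between neighbouring grid points the mean
  changes by card G / n, which is at most 1; this is the additional 1.\<close>

lemma grid_counts_imp_uniform_counts:
  assumes "grid_counts n G u" "finite G" "card G \<le> n" "0 < n"
  shows "uniform_counts (sqrt (real n * ln (real n)) + 1) G u"
proof -
  define e where "e = sqrt (real n * ln (real n))"
  have grid: "\<bar>real (card {i\<in>G. real m / real n < u i}) - real (card G) * (1 - real m / real n)\<bar> < e"
    if "m \<le> n" for m using assms(1) that by (auto simp: grid_counts_def e_def)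
  have "\<bar>real (card {i\<in>G. t < u i}) - real (card G) * (1 - t)\<bar> \<le> e + 1 \<and>
        \<bar>real (card {i\<in>G. t \<le> u i}) - real (card G) * (1 - t)\<bar> \<le> e + 1"
    if t: "0 \<le> t" "t \<le> 1" for t
  proof -
    let ?g = "real (card G)"
    have le: "card {i\<in>G. t < u i} \<le> card {i\<in>G. t \<le> u i}" using assms by (intro card_mono) auto
    have e: "0 < e" using grid[of 0] by linarith
    show ?thesis
    proof (cases "t = 0")
      case True
      have "real (card {i\<in>G. t \<le> u i}) \<le> ?g" using assms by (simp add: card_mono)
      thus ?thesis using grid[of 0] le True e by simp
    next
      case False
      define m where "m = nat (\<lceil>t * n\<rceil> - 1)"
      have "0 < t * n" using t False assms by simp
      hence c: "1 \<le> \<lceil>t * n\<rceil>" by linarith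
      hence m: "real m < t * n" "t * n \<le> real m + 1" unfolding m_def by linarith+
      have mn: "Suc m \<le> n"
      proof -
        have "t * n \<le> n" using t by (simp add: mult_left_le_one_le)
        thus ?thesis using m by linarith
      qed
      have t1: "real m / n < t" "t \<le> real (Suc m) / n"
        using m assms by (auto simp: field_simps)
      have "card {i\<in>G. t \<le> u i} \<le> card {i\<in>G. real m / n < u i}"
        "card {i\<in>G. real (Suc m) / n < u i} \<le> card {i\<in>G. t < u i}"
        using t1 assms by (auto intro!: card_mono)
      moreover have "real (Suc m) / n = real m / n + 1 / n" by (simp add: add_divide_distrib)
      moreover have "?g * (1 - real (Suc m) / n) \<ge> ?g * (1 - real m / n) - 1"
      proof -
        have "?g * (1 / n) \<le> 1" using assms by simp
        thus ?thesis unfolding \<open>real (Suc m) / n = real m / n + 1 / n\<close> by (simp add: algebra_simps)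
      qed
      moreover have "?g * (1 - t) \<le> ?g * (1 - real m / n)" "?g * (1 - real (Suc m) / n) \<le> ?g * (1 - t)"
        using t1 by (auto intro!: mult_left_mono)
      ultimately show ?thesis
        using grid[of m] grid[OF mn] mn le by linarith
    qed
  qed
  thus ?thesis unfolding uniform_counts_def e_def by auto
qed

subsection \<open>The queue of candidates\<close>

definition queue :: "(nat \<Rightarrow> real) \<Rightarrow> nat \<Rightarrow> nat list" where
  "queue w n = sort_key (\<lambda>i. - w i) [0..<n]"

lemma queue_simps [simp]: "set (queue w n) = {..<n}" "distinct (queue w n)" "length (queue w n) = n"
  by (auto simp: queue_def)

lemma upper_in_take_queue: "upper_in w {..<n} (set (take K (queue w n)))"
proof -
  have "sorted (map (\<lambda>i. - w i) (take K (queue w n) @ drop K (queue w n)))"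
    by (simp add: queue_def)
  hence le: "w j \<le> w i" if "i \<in> set (take K (queue w n))" "j \<in> set (drop K (queue w n))" for i j
    using that by (simp only: map_append sorted_append) auto
  have sub: "set (take K (queue w n)) \<subseteq> {..<n}" using set_take_subset[of K "queue w n"] by simp
  have "j \<in> set (drop K (queue w n))" if "j < n" "j \<notin> set (take K (queue w n))" for j
  proof -
    have "j \<in> set (take K (queue w n) @ drop K (queue w n))" using that by simp
    thus ?thesis using that by (simp only: set_append) auto
  qed
  thus ?thesis using sub le by (auto simp: upper_in_def)
qed

lemma card_take_queue: "K \<le> n \<Longrightarrow> card (set (take K (queue w n))) = K"
  by (simp add: distinct_card)

text \<open>An element of one set only and an element of the other only would have equal weight.
  Without ties the selected set is thus a prefix of the queue, whatever the algorithm.\<close>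

lemma upper_in_unique:
  assumes "upper_in w A S" "upper_in w A T" "card S = card T" "finite A" "inj_on w A"
  shows "S = T"
proof (rule ccontr)
  assume ne: "S \<noteq> T"
  have fin: "finite S" "finite T" and sub: "S \<subseteq> A" "T \<subseteq> A"
    using assms by (auto simp: upper_in_def intro: finite_subset)
  obtain i where i: "i \<in> S - T" using ne assms(3) fin card_subset_eq[of T S] by auto
  obtain j where j: "j \<in> T - S" using ne assms(3) fin card_subset_eq[of S T] by auto
  have "w i = w j" using assms(1,2) i j sub by (fastforce simp: upper_in_def intro: antisym)
  thus False using assms(5) i j sub by (auto dest: inj_onD)
qed

lemma optimal_utility_queue: 
  assumes "K \<le> n"
  shows "optimal_utility n K u = (\<Sum>i\<in>set (take K (queue u n)). u i)"
proof -
  have "sort (map u [0..<n]) = rev (map u (queue u n))"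
  proof (rule properties_for_sort)
    show "mset (rev (map u (queue u n))) = mset (map u [0..<n])"
      by (simp add: queue_def)
    have "sorted_wrt (\<lambda>x y. - u x \<le> - u y) (queue u n)"
      using sorted_sort_key[of "\<lambda>i. - u i" "[0..<n]"] by (simp add: queue_def sorted_map)
    thus "sorted (rev (map u (queue u n)))"
      by (simp add: sorted_wrt_rev sorted_wrt_map)
  qed
  hence "optimal_utility n K u = sum_list (map u (take K (queue u n)))"
    by (simp add: optimal_utility_def take_map)
  also have "\<dots> = (\<Sum>i\<in>set (take K (queue u n)). u i)"
    by (simp add: sum_list_distinct_conv_sum_set)
  finally show ?thesis .
qed

text \<open>Lists of naturals are countable, so it suffices to treat each insertion for a fixed
  intermediate list.\<close>

lemma measurable_sort_key:
  fixes k :: "'a \<Rightarrow> nat \<Rightarrow> real"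
  assumes [measurable]: "\<And>i. (\<lambda>u. k u i) \<in> borel_measurable M"
  shows "(\<lambda>u. sort_key (k u) xs) \<in> M \<rightarrow>\<^sub>M count_space UNIV"
proof (induction xs)
  case (Cons x xs)
  have [measurable]: "(\<lambda>u. insort_key (k u) x ys) \<in> M \<rightarrow>\<^sub>M count_space UNIV" for ys
  proof (induction ys)
    case (Cons y ys)
    have [measurable]: "(\<lambda>u. y # insort_key (k u) x ys) \<in> M \<rightarrow>\<^sub>M count_space UNIV"
      by (rule measurable_compose[OF Cons]) simp
    show ?case unfolding insort_key.simps by measurable
  qed simp
  show ?case unfolding sort_key_simps
    by (rule measurable_compose_countable[OF _ Cons]) measurable
qed simp

lemma measurable_utility:
  "(\<lambda>u. u i) \<in> borel_measurable (utility_law n)"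
proof (cases "i < n")
  case True thus ?thesis by (intro measurable_PiM_component_rev) auto
next
  case False
  have "(\<lambda>u. u i) \<in> borel_measurable (utility_law n) \<longleftrightarrow>
      (\<lambda>u. undefined :: real) \<in> borel_measurable (utility_law n)"
    using False by (intro measurable_cong) (auto simp: space_PiM PiE_def extensional_def)
  thus ?thesis by simp
qed

lemma measurable_est_utility:
  "(\<lambda>u. est_utility G2 \<beta> u i) \<in> borel_measurable (utility_law n)"
proof -
  note [measurable] = measurable_utility
  show ?thesis unfolding est_utility_def by measurable
qed

lemma measurable_queue:
  "(\<lambda>u. queue (est_utility G2 \<beta> u) n) \<in> utility_law n \<rightarrow>\<^sub>M count_space UNIV"
proof -
  note [measurable] = measurable_est_utility
  show ?thesis unfolding queue_def by (rule measurable_sort_key) measurable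
qed

lemma measurable_queue': "(\<lambda>u. queue u n) \<in> utility_law n \<rightarrow>\<^sub>M count_space UNIV"
  using measurable_queue[of "{}" 1 n] by (simp add: est_utility_def[abs_def])

subsection \<open>Assignments of maximal estimated utility\<close>

text \<open>Two local improvements would contradict maximality: filling a vacant slot with an
  unassigned candidate, whose weight is positive, and passing the slot of an assigned candidate to a
  better unassigned one.\<close>

lemma maximizer_dom:
  assumes M: "M \<in> assignments n p k"
    and max: "\<And>M'. M' \<in> assignments n p k \<Longrightarrow> total_utility w M' \<le> total_utility w M"
    and pos: "\<And>i. i < n \<Longrightarrow> 0 < w i" and K: "total_capacity p k \<le> n"
  shows "upper_in w {..<n} (dom M)" "card (dom M) = total_capacity p k"
proof -
  have dom: "dom M \<subseteq> {..<n}" and ran: "ran M \<subseteq> {..<p}"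
    and cap: "\<And>l. l < p \<Longrightarrow> card {i. M i = Some l} \<le> k l"
    using M by (auto simp: assignments_def)
  have fin: "finite (dom M)" using dom finite_subset by blast
  have finl: "finite {i. M i = Some l}" for l by (rule finite_subset[OF _ fin]) auto
  have dom_eq: "dom M = (\<Union>l<p. {i. M i = Some l})" using ran by (auto simp: ran_def)
  have card_dom: "card (dom M) = (\<Sum>l<p. card {i. M i = Some l})"
    unfolding dom_eq using finl by (subst card_UN_disjoint) auto
  show "card (dom M) = total_capacity p k"
  proof (rule ccontr)
    assume ne: "card (dom M) \<noteq> total_capacity p k"
    have "card (dom M) \<le> total_capacity p k"
      unfolding card_dom total_capacity_def using cap by (intro sum_mono) auto
    with ne have less: "card (dom M) < total_capacity p k" by simp
    then obtain l where l: "l < p" "card {i. M i = Some l} < k l"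
      unfolding card_dom total_capacity_def by (metis lessThan_iff not_le sum_mono)
    have "card (dom M) < card {..<n}" using less K by simp
    hence "\<not> {..<n} \<subseteq> dom M" using fin card_mono by (metis not_le)
    then obtain i where i: "i < n" "M i = None" by auto
    have "{i'. (M(i \<mapsto> l)) i' = Some l'} = (if l' = l then insert i {i. M i = Some l} else {i. M i = Some l'})" for l'
      using i by auto
    hence "card {i'. (M(i \<mapsto> l)) i' = Some l'} = (if l' = l then Suc (card {i. M i = Some l}) else card {i. M i = Some l'})" for l'
      using finl i by simp
    hence "card {i'. (M(i \<mapsto> l)) i' = Some l'} \<le> k l'" if "l' < p" for l'
      using cap[OF that] l(2) by (metis Suc_leI le_trans)
    hence "M(i \<mapsto> l) \<in> assignments n p k"
      using dom ran i l by (auto simp: assignments_def ran_def split: if_splits)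
    hence "total_utility w (M(i \<mapsto> l)) \<le> total_utility w M" by (rule max)
    moreover have "total_utility w (M(i \<mapsto> l)) = w i + total_utility w M"
      using fin i by (simp add: total_utility_def domIff)
    ultimately show False using pos[OF i(1)] by simp
  qed
  show "upper_in w {..<n} (dom M)"
    unfolding upper_in_def
  proof (intro conjI ballI dom)
    fix i j assume i: "i \<in> dom M" and j: "j \<in> {..<n} - dom M"
    then obtain l where l: "M i = Some l" by auto
    define M' where "M' = (M(i := None))(j \<mapsto> l)"
    have ij: "i \<noteq> j" "M j = None" using i j by auto
    have eq: "{i'. M' i' = Some l'} = (if l' = l then insert j ({i. M i = Some l} - {i}) else {i. M i = Some l'})" for l'
      using l ij by (auto simp: M'_def)
    have "card {i'. M' i' = Some l'} = card {i. M i = Some l'}" for l'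
    proof (cases "l' = l")
      case True
      have "card {i'. M' i' = Some l'} = Suc (card ({i. M i = Some l} - {i}))"
        unfolding eq using True ij finl[of l] by (simp add: card_insert_if)
      also have "\<dots> = card {i. M i = Some l}" using l finl by (intro card_Suc_Diff1) auto
      finally show ?thesis using True by simp
    qed (simp add: eq)
    moreover have domM': "dom M' = insert j (dom M - {i})" by (auto simp: M'_def)
    moreover have "ran M' \<subseteq> ran M" using l by (auto simp: M'_def ran_def)
    ultimately have "M' \<in> assignments n p k"
      using cap dom ran j by (auto simp: assignments_def)
    hence "total_utility w M' \<le> total_utility w M" by (rule max)
    moreover have "total_utility w M' = w j + (\<Sum>i\<in>dom M - {i}. w i)"
      unfolding total_utility_def domM' using fin j by (subst sum.insert) auto
    moreover have "total_utility w M = w i + (\<Sum>i\<in>dom M - {i}. w i)"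
      unfolding total_utility_def using fin i by (subst sum.remove[of _ i]) auto
    ultimately show "w j \<le> w i" by simp
  qed
qed

subsection \<open>The joint law\<close>

abbreviation preference_law :: "nat \<Rightarrow> nat list pmf \<Rightarrow> (nat \<Rightarrow> nat list) measure" where
  "preference_law n L \<equiv> PiM {..<n} (\<lambda>_. measure_pmf L)"

abbreviation joint_law :: "nat \<Rightarrow> nat list pmf \<Rightarrow> ((nat \<Rightarrow> real) \<times> (nat \<Rightarrow> nat list)) measure" where
  "joint_law n L \<equiv> utility_law n \<Otimes>\<^sub>M preference_law n L"

lemma prob_space_preference_law: "prob_space (preference_law n L)"
  by (intro prob_space_PiM measure_pmf.prob_space_axioms)

lemma prob_space_joint_law: "prob_space (joint_law n L)"
proof -
  interpret U: prob_space "utility_law n" by (rule prob_space_utility_law)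
  interpret S: prob_space "preference_law n L" by (rule prob_space_preference_law)
  interpret pair_prob_space "utility_law n" "preference_law n L" ..
  show ?thesis by unfold_locales
qed

lemma distr_joint_law_fst: "distr (joint_law n L) (utility_law n) fst = utility_law n"
proof -
  interpret prob_space "preference_law n L" by (rule prob_space_preference_law)
  show ?thesis by (rule distr_pair_fst)
qed

lemma AE_joint_law_utility:
  assumes "AE u in utility_law n. P u"
  shows "AE x in joint_law n L. P (fst x)"
  by (rule AE_distrD[of fst "joint_law n L" "utility_law n" P])
    (simp, simp only: distr_joint_law_fst assms)

lemma AE_joint_law_preference:
  assumes "AE \<sigma> in preference_law n L. P \<sigma>"
  shows "AE x in joint_law n L. P (snd x)"
proof -
  interpret U: prob_space "utility_law n" by (rule prob_space_utility_law)
  interpret S: prob_space "preference_law n L" by (rule prob_space_preference_law)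
  interpret pair_sigma_finite "utility_law n" "preference_law n L" ..
  have distr_snd: "distr (joint_law n L) (preference_law n L) snd = preference_law n L"
    by (subst distr_pair_swap) (simp add: distr_distr comp_def U.distr_pair_fst split_beta)
  show ?thesis
    by (rule AE_distrD[of snd "joint_law n L" "preference_law n L" P])
      (simp, simp only: distr_snd assms)
qed

lemma AE_preferences_rankings:
  assumes "set_pmf L \<subseteq> rankings p"
  shows "AE \<sigma> in preference_law n L. \<sigma> \<in> {..<n} \<rightarrow>\<^sub>E rankings p"
proof -
  have "AE \<sigma> in preference_law n L. \<sigma> i \<in> rankings p" if "i \<in> {..<n}" for i
    by (rule AE_PiM_component[OF measure_pmf.prob_space_axioms that])
      (use assms in \<open>auto simp: AE_measure_pmf_iff\<close>)
  hence "AE \<sigma> in preference_law n L. \<forall>i\<in>{..<n}. \<sigma> i \<in> rankings p"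
    by (intro AE_finite_allI) auto
  moreover have "AE \<sigma> in preference_law n L. \<sigma> \<in> space (preference_law n L)" by simp
  ultimately show ?thesis by eventually_elim (auto simp: space_PiM PiE_def)
qed

lemma AE_utilities_PiE: "AE u in utility_law n. u \<in> {..<n} \<rightarrow>\<^sub>E {0..1}"
proof -
  have "AE u in utility_law n. u \<in> space (utility_law n)" by simp
  with AE_utilities_range[of n] show ?thesis
    by eventually_elim (auto simp: space_PiM PiE_def less_imp_le)
qed

text \<open>Applied to algorithms that break ties arbitrarily: they agree almost everywhere with a
  function of the queue.\<close>

lemma borel_measurable_completion_AE_eq:
  assumes "AE x in M. f x = g x" "g \<in> borel_measurable M"
  shows "f \<in> borel_measurable (completion M)"
proof (rule measurableI)
  fix A :: "'b set" assume A: "A \<in> sets borel"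
  have g: "g -` A \<inter> space M \<in> sets (completion M)"
    using measurable_sets[OF measurable_completion[OF assms(2)] A] by simp
  have "AE x in completion M. x \<in> g -` A \<inter> space M \<longleftrightarrow> x \<in> f -` A \<inter> space M"
    using AE_completion[OF assms(1)] by eventually_elim auto
  from completion.in_sets_AE[OF this g]
  show "f -` A \<inter> space (completion M) \<in> sets (completion M)" by auto
qed auto

lemma expectation_approx:
  fixes f :: "'a \<Rightarrow> real"
  assumes "prob_space M" "f \<in> borel_measurable M" "B \<in> sets M"
    and "AE x in M. \<bar>f x - r\<bar> \<le> b" "AE x in M. x \<notin> B \<longrightarrow> \<bar>f x - r\<bar> \<le> d"
    and "0 \<le> b" "0 \<le> d"
  shows "\<bar>integral\<^sup>L M f - r\<bar> \<le> d + b * measure M B"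
proof -
  interpret prob_space M by fact
  have fr: "integrable M (\<lambda>x. f x - r)"
    by (rule integrable_const_bound[where B = b]) (use assms in auto)
  hence f: "integrable M f" using Bochner_Integration.integrable_add[OF fr, of "\<lambda>_. r"] by simp
  have "integral\<^sup>L M f - r = (\<integral>x. f x - r \<partial>M)" using f by (simp add: prob_space)
  also have "\<bar>\<dots>\<bar> \<le> (\<integral>x. \<bar>f x - r\<bar> \<partial>M)" by (rule integral_abs_bound)
  also have "\<dots> \<le> (\<integral>x. d + b * indicator B x \<partial>M)"
  proof (rule integral_mono_AE)
    show "integrable M (\<lambda>x. d + b * indicator B x)"
      using assms(3) by (intro Bochner_Integration.integrable_add) (auto simp: less_top[symmetric])
    show "AE x in M. \<bar>f x - r\<bar> \<le> d + b * indicator B x"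
      using assms(4,5) by eventually_elim (use assms(6,7) in \<open>auto simp: indicator_def\<close>)
  qed (use fr in auto)
  also have "\<dots> = d + b * measure M B"
    using assms(3) by (subst Bochner_Integration.integral_add) (auto simp: prob_space less_top[symmetric])
  finally show ?thesis .
qed

text \<open>For integers, \<open>f_sel x y\<close> is the mean of the sum of the x largest of y
  independent uniform variables, because the i-th largest has mean 1 - i / (y + 1). The integral
  computed above is its continuum version; they differ by half of a product of two numbers in
  [0,1].\<close>

lemma f_sel_approx:
  assumes "0 \<le> x" "x \<le> y" "0 < y"
  shows "\<bar>f_sel x y - (x - x\<^sup>2 / (2 * y))\<bar> \<le> 1"
proof -
  define z where "z = (x / y) * ((y - x) / (y + 1))"
  have "x / y \<le> 1" "(y - x) / (y + 1) \<le> 1" "0 \<le> (y - x) / (y + 1)" "0 \<le> x / y" using assms by auto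
  hence "0 \<le> z" "z \<le> 1" unfolding z_def by (auto intro: mult_le_one simp del: times_divide_eq_left times_divide_eq_right)
  moreover have "f_sel x y - (x - x\<^sup>2 / (2 * y)) = - (z / 2)"
    unfolding z_def using assms
    by (simp add: f_sel_def divide_simps) (simp add: algebra_simps power2_eq_square)
  ultimately show ?thesis by simp
qed

lemma quadratic_lipschitz:
  fixes x a m :: real
  assumes "0 \<le> x" "x \<le> m" "0 \<le> a" "a \<le> m" "0 < m"
  shows "\<bar>(x - x\<^sup>2 / (2 * m)) - (a - a\<^sup>2 / (2 * m))\<bar> \<le> \<bar>x - a\<bar>"
proof -
  have "(x - x\<^sup>2 / (2 * m)) - (a - a\<^sup>2 / (2 * m)) = (x - a) * (1 - (x + a) / (2 * m))"
    using assms by (simp add: field_simps power2_eq_square)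
  also have "\<bar>\<dots>\<bar> \<le> \<bar>x - a\<bar> * 1"
    unfolding abs_mult using assms by (intro mult_left_mono) (auto simp: abs_le_iff divide_le_eq)
  finally show ?thesis by simp
qed

lemma f_sel_bounds:
  assumes "0 \<le> x" "x \<le> y" "0 < y"
  shows "x / 2 \<le> f_sel x y" "f_sel x y \<le> x"
proof -
  have "f_sel x y - x / 2 = x / 2 * (1 - (x + 1) / (y + 1))"
    using assms by (simp add: f_sel_def field_simps)
  moreover have "0 \<le> \<dots>" using assms by (intro mult_nonneg_nonneg) auto
  ultimately show "x / 2 \<le> f_sel x y" by linarith
  have "0 \<le> x * (x + 1) / (2 * (y + 1))" using assms by auto
  thus "f_sel x y \<le> x" unfolding f_sel_def by linarith
qed

subsection \<open>Representation and utility\<close>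

locale selection =
  fixes n p :: nat and k :: "nat \<Rightarrow> nat" and G1 G2 :: "nat set" and \<beta> :: real
    and L :: "nat list pmf" and \<eta>1 \<eta>2 :: real
  assumes model: "selection_model n p k G1 G2 \<beta> L \<eta>1 \<eta>2"
begin

abbreviation "K \<equiv> total_capacity p k"
abbreviation "n1 \<equiv> card G1"
abbreviation "n2 \<equiv> card G2"
abbreviation "a1 \<equiv> \<alpha>1 \<beta> (real K) (real n1) (real n2)"
abbreviation "a2 \<equiv> \<alpha>2 \<beta> (real K) (real n1) (real n2)"
abbreviation "\<rho> \<equiv> limit_ratio \<beta> (real K) (real n1) (real n2)"

text \<open>\<delta> is the error rate of the theorem. The deviation \<epsilon> of the counts is n
  \<delta> plus the rounding to the grid, and is at most 2 n \<delta>.\<close>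

definition "\<delta> = sqrt (ln (real n)) / sqrt (real n)"
definition "\<epsilon> = sqrt (real n * ln (real n)) + 1"

lemma G: "G1 \<union> G2 = {..<n}" "G1 \<inter> G2 = {}" and \<beta>: "0 < \<beta>" "\<beta> \<le> 1"
  and L: "set_pmf L \<subseteq> rankings p" and \<eta>: "0 < \<eta>1" "0 < \<eta>2" and n_pos: "0 < n"
  and n1_ge: "\<eta>1 * real n \<le> real n1" and n2_ge: "\<eta>1 * real n \<le> real n2"
  and K_ge: "\<eta>2 * real n \<le> real K" and K_le: "K \<le> n"
  using model by (auto simp: selection_model_def)

lemma finite_G: "finite G1" "finite G2"
  using G(1) by (metis finite_Un finite_lessThan)+

lemma n_eq: "n = n1 + n2"
  using card_Un_disjoint[OF finite_G G(2)] G(1) by simp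

lemma pos: "0 < n1" "0 < n2" "0 < K"
proof -
  have "0 < \<eta>1 * real n" "0 < \<eta>2 * real n" using \<eta> n_pos by auto
  thus "0 < n1" "0 < n2" "0 < K" using n1_ge n2_ge K_ge by linarith+
qed

lemma n_ge_2: "2 \<le> n" using pos n_eq by simp

lemma \<eta>1_le: "\<eta>1 \<le> 1"
proof -
  have "\<eta>1 * real n \<le> 1 * real n" using n1_ge n_eq by linarith
  thus ?thesis using n_pos by simp
qed

lemma \<eta>2_le: "\<eta>2 \<le> 1"
proof -
  have "\<eta>2 * real n \<le> 1 * real n" using K_ge K_le by linarith
  thus ?thesis using n_pos by simp
qed

lemma alpha_premises: "0 < real n1" "0 < real n2" "0 < real K" "real K \<le> real n1 + real n2" "0 < \<beta>" "\<beta> \<le> 1"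
  using pos K_le n_eq \<beta> by auto

lemmas alpha = alpha_properties[OF alpha_premises]

lemma \<delta>_eq: "\<delta> = sqrt (real n * ln (real n)) / real n"
proof -
  have "real n = sqrt (real n) * sqrt (real n)" by simp
  hence "sqrt (real n * ln (real n)) / real n
      = (sqrt (real n) * sqrt (ln (real n))) / (sqrt (real n) * sqrt (real n))"
    by (simp only: real_sqrt_mult)
  also have "\<dots> = \<delta>" unfolding \<delta>_def by (rule mult_divide_mult_cancel_left) (use n_pos in simp)
  finally show ?thesis by simp
qed

lemma inverse_n_le: "1 / real n \<le> \<delta>"
proof -
  have "1/2 \<le> ln (2::real)" using ln2_ge_two_thirds by simp
  also have "ln 2 \<le> ln (real n)" using n_ge_2 by simp
  finally have l: "1/2 \<le> ln (real n)" .
  have "2 * (1/2) \<le> real n * ln (real n)" using n_ge_2 l by (intro mult_mono) auto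
  hence "1 \<le> sqrt (real n * ln (real n))" by simp
  thus ?thesis using n_pos unfolding \<delta>_eq by (simp add: divide_right_mono)
qed

lemma \<delta>_pos: "0 < \<delta>" using inverse_n_le n_pos by (meson less_le_trans of_nat_0_less_iff zero_less_divide_1_iff)

lemma \<epsilon>_le: "\<epsilon> / real n \<le> 2 * \<delta>"
  using inverse_n_le by (simp add: \<epsilon>_def \<delta>_eq add_divide_distrib)

lemma \<epsilon>_pos: "1 \<le> \<epsilon>" using n_ge_2 by (auto simp: \<epsilon>_def)

lemma \<epsilon>_div_le: 
  assumes "c * real n \<le> x" "0 < c"
  shows "\<epsilon> / x \<le> 2 * \<delta> / c"
proof -
  have "\<epsilon> / x \<le> \<epsilon> / (c * real n)" using assms n_pos \<epsilon>_pos by (intro frac_le) auto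
  also have "\<dots> = (\<epsilon> / real n) / c" by simp
  also have "\<dots> \<le> 2 * \<delta> / c" using \<epsilon>_le assms by (intro divide_right_mono) auto
  finally show ?thesis .
qed

definition good :: "(nat \<Rightarrow> real) \<Rightarrow> bool" where
  "good u \<longleftrightarrow> grid_counts n G1 u \<and> grid_counts n G2 u"

lemma good_uniform_counts:
  assumes "good u" shows "uniform_counts \<epsilon> G1 u" "uniform_counts \<epsilon> G2 u"
proof -
  have "n1 \<le> n" "n2 \<le> n" using n_eq by auto
  thus "uniform_counts \<epsilon> G1 u" "uniform_counts \<epsilon> G2 u"
    using assms finite_G n_pos unfolding good_def \<epsilon>_def
    by (blast intro: grid_counts_imp_uniform_counts)+
qed

lemma sets_bad: "{u \<in> space (utility_law n). \<not> good u} \<in> sets (utility_law n)"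
proof -
  have "G1 \<subseteq> {..<n}" "G2 \<subseteq> {..<n}" using G by auto
  note [measurable] = sets_grid_counts[OF this(1)] sets_grid_counts[OF this(2)]
  show ?thesis unfolding good_def by measurable
qed

lemma prob_bad: "measure (utility_law n) {u \<in> space (utility_law n). \<not> good u} \<le> 8 * \<delta>"
proof -
  interpret prob_space "utility_law n" by (rule prob_space_utility_law)
  have sub: "G1 \<subseteq> {..<n}" "G2 \<subseteq> {..<n}" using G by auto
  note [measurable] = sets_grid_counts[OF sub(1)] sets_grid_counts[OF sub(2)]
  have eq: "{u \<in> space (utility_law n). \<not> good u} = {u \<in> space (utility_law n). \<not> grid_counts n G1 u}
      \<union> {u \<in> space (utility_law n). \<not> grid_counts n G2 u}"
    by (auto simp: good_def)
  have "prob {u \<in> space (utility_law n). \<not> good u} \<le> prob {u \<in> space (utility_law n). \<not> grid_counts n G1 u}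
      + prob {u \<in> space (utility_law n). \<not> grid_counts n G2 u}"
    unfolding eq by (rule measure_Un_le) measurable
  also have "\<dots> \<le> 4 / real n + 4 / real n"
    using sub pos n_ge_2 by (intro add_mono prob_not_grid_counts) auto
  also have "\<dots> \<le> 8 * \<delta>" using inverse_n_le by simp
  finally show ?thesis .
qed

lemma bad_joint:
  shows "{x \<in> space (joint_law n L). \<not> good (fst x)} \<in> sets (joint_law n L)"
    and "measure (joint_law n L) {x \<in> space (joint_law n L). \<not> good (fst x)} \<le> 8 * \<delta>"
proof -
  have eq: "{x \<in> space (joint_law n L). \<not> good (fst x)}
      = fst -` {u \<in> space (utility_law n). \<not> good u} \<inter> space (joint_law n L)"
    by (auto simp: space_pair_measure)
  show "{x \<in> space (joint_law n L). \<not> good (fst x)} \<in> sets (joint_law n L)"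
    unfolding eq by (rule measurable_sets[OF measurable_fst sets_bad])
  have "measure (joint_law n L) {x \<in> space (joint_law n L). \<not> good (fst x)}
      = measure (distr (joint_law n L) (utility_law n) fst) {u \<in> space (utility_law n). \<not> good u}"
    unfolding eq by (subst measure_distr) (auto simp: sets_bad)
  thus "measure (joint_law n L) {x \<in> space (joint_law n L). \<not> good (fst x)} \<le> 8 * \<delta>"
    unfolding distr_joint_law_fst using prob_bad by simp
qed

lemma input_law_eq: "input_law n L = completion (joint_law n L)"
  by (simp add: input_law_def)

text \<open>The function f depends on an arbitrary algorithm and need not be Borel; g supplies its
  measurability. The crude bound b is paid only on the bad event, of probability at most 8
  \<delta>.\<close>

lemma input_expectation_approx:
  fixes f g :: "(nat \<Rightarrow> real) \<times> (nat \<Rightarrow> nat list) \<Rightarrow> real"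
  assumes "AE x in joint_law n L. f x = g x" "g \<in> borel_measurable (joint_law n L)"
    and "AE x in joint_law n L. \<bar>f x - r\<bar> \<le> b"
    and "AE x in joint_law n L. good (fst x) \<longrightarrow> \<bar>f x - r\<bar> \<le> d"
    and "0 \<le> b" "0 \<le> d"
  shows "\<bar>integral\<^sup>L (input_law n L) f - r\<bar> \<le> d + b * (8 * \<delta>)"
proof -
  interpret prob_space "joint_law n L" by (rule prob_space_joint_law)
  have ps: "prob_space (completion (joint_law n L))"
    by (rule prob_spaceI) (simp add: emeasure_space_1)
  let ?B = "{x \<in> space (joint_law n L). \<not> good (fst x)}"
  have "AE x in joint_law n L. x \<in> space (joint_law n L)" by simp
  with assms(4) have d: "AE x in joint_law n L. x \<notin> ?B \<longrightarrow> \<bar>f x - r\<bar> \<le> d"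
    by eventually_elim auto
  have "\<bar>integral\<^sup>L (completion (joint_law n L)) f - r\<bar> \<le> d + b * measure (completion (joint_law n L)) ?B"
    using assms bad_joint(1) d
    by (intro expectation_approx ps borel_measurable_completion_AE_eq[OF assms(1,2)] AE_completion) auto
  also have "measure (completion (joint_law n L)) ?B = measure (joint_law n L) ?B"
    using bad_joint(1) by simp
  also have "d + b * measure (joint_law n L) ?B \<le> d + b * (8 * \<delta>)"
    using bad_joint(2) assms(5) by (intro add_left_mono mult_left_mono)
  finally show ?thesis by (simp add: input_law_eq)
qed

lemma K_upper_approx:
  assumes "good u" "\<And>i. i < n \<Longrightarrow> 0 \<le> u i \<and> u i \<le> 1"
    and "upper_in (est_utility G2 \<beta> u) {..<n} S" "card S = K"
  shows "\<bar>real (card (S \<inter> G1)) - a1\<bar> \<le> 3 * \<epsilon>" "\<bar>real (card (S \<inter> G2)) - a2\<bar> \<le> 3 * \<epsilon>"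
  using selected_counts[OF G pos(1,2) \<beta> assms(2-4) pos(3) good_uniform_counts[OF assms(1)]] by auto

lemma a1_ge: "\<eta>2 \<le> a1 / real n1"
proof -
  have "\<eta>2 \<le> real K / real n" using K_ge n_pos by (simp add: le_divide_eq)
  also have "real n = real n1 + real n2" using n_eq by simp
  also have "real K / (real n1 + real n2) \<le> a1 / real n1" by (rule alpha(7))
  finally show ?thesis .
qed

lemma representation_approx:
  assumes "good u" "\<And>i. i < n \<Longrightarrow> 0 \<le> u i \<and> u i \<le> 1"
    and "upper_in (est_utility G2 \<beta> u) {..<n} S" "card S = K"
  shows "\<bar>min_max_ratio (real (card (S \<inter> G1)) / real n1) (real (card (S \<inter> G2)) / real n2) - \<rho>\<bar>
    \<le> 12 * (\<delta> / (\<eta>1 * \<eta>2))"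
proof -
  \<comment> \<open>The 6 combines the 3 \<epsilon> of the counts with \<epsilon> at most 2 n
    \<delta>.\<close>
  have d: "\<bar>x / real m - y / real m\<bar> \<le> 6 * \<delta> / \<eta>1"
    if "\<bar>x - y\<bar> \<le> 3 * \<epsilon>" "\<eta>1 * real n \<le> real m" for x y :: real and m
  proof -
    have "\<bar>x / real m - y / real m\<bar> = \<bar>x - y\<bar> / real m" by (simp add: diff_divide_distrib[symmetric])
    also have "\<dots> \<le> 3 * (\<epsilon> / real m)" using that(1) by (simp add: divide_right_mono)
    also have "\<dots> \<le> 3 * (2 * \<delta> / \<eta>1)" using \<epsilon>_div_le[OF that(2) \<eta>(1)] by simp
    finally show ?thesis by simp
  qed
  have a: "0 < a1 / real n1" using a1_ge \<eta> by linarith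
  have "\<bar>min_max_ratio (real (card (S \<inter> G1)) / real n1) (real (card (S \<inter> G2)) / real n2) - \<rho>\<bar>
      \<le> 2 * (6 * \<delta> / \<eta>1) / (a1 / real n1)"
    unfolding alpha(8)
    by (rule min_max_ratio_approx)
      (use d[OF K_upper_approx(1)[OF assms] n1_ge] d[OF K_upper_approx(2)[OF assms] n2_ge] alpha(6) a in auto)
  also have "\<dots> \<le> 2 * (6 * \<delta> / \<eta>1) / \<eta>2"
    using a1_ge \<eta> \<delta>_pos by (intro frac_le) auto
  finally show ?thesis by simp
qed

text \<open>Almost surely all estimated utilities are positive and distinct, so the selected set is
  determined. The last conjunct makes the metrics functions of the queue and thereby
  measurable.\<close>

lemma AE_maximizer:
  assumes "maximizes_est_utility n p k G2 \<beta> \<A>"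
  shows "AE x in joint_law n L. (\<forall>i<n. 0 \<le> fst x i \<and> fst x i \<le> 1) \<and>
    upper_in (est_utility G2 \<beta> (fst x)) {..<n} (dom (\<A> (est_utility G2 \<beta> (fst x)) (snd x))) \<and>
    card (dom (\<A> (est_utility G2 \<beta> (fst x)) (snd x))) = K \<and>
    dom (\<A> (est_utility G2 \<beta> (fst x)) (snd x)) = set (take K (queue (est_utility G2 \<beta> (fst x)) n))"
  using AE_joint_law_utility[OF AE_utilities_range] AE_joint_law_utility[OF AE_utilities_PiE]
    AE_joint_law_preference[OF AE_preferences_rankings[OF L]]
    AE_joint_law_utility[OF AE_est_utility_inj[OF \<beta>(1), of G2 n]]
proof eventually_elim
  case (elim x)
  let ?w = "est_utility G2 \<beta> (fst x)"
  let ?M = "\<A> ?w (snd x)"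
  have "0 < ?w i" if "i < n" for i using elim(1) that \<beta> by (auto simp: est_utility_def)
  moreover have "?M \<in> assignments n p k" "\<And>M'. M' \<in> assignments n p k \<Longrightarrow> total_utility ?w M' \<le> total_utility ?w ?M"
    using assms elim(2,3) unfolding maximizes_est_utility_def Let_def by blast+
  ultimately have *: "upper_in ?w {..<n} (dom ?M)" "card (dom ?M) = K"
    using maximizer_dom[of ?M n p k ?w] K_le by blast+
  have "dom ?M = set (take K (queue ?w n))"
    by (rule upper_in_unique[OF *(1) upper_in_take_queue _ _ elim(4)])
      (use * card_take_queue[OF K_le] in auto)
  thus ?case using * elim(1) by (auto simp: less_imp_le)
qed

lemma measurable_queue_fst:
  "(\<lambda>x. queue (est_utility G2 \<beta> (fst x)) n) \<in> joint_law n L \<rightarrow>\<^sub>M count_space UNIV"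
  by (rule measurable_compose[OF measurable_fst measurable_queue])

lemma representation_bound:
  assumes "maximizes_est_utility n p k G2 \<beta> \<A>"
  shows "\<bar>representation_metric n G1 G2 \<beta> L \<A> - \<rho>\<bar> \<le> 20 * (\<delta> / (\<eta>1 * \<eta>2))"
proof -
  define f where "f = (\<lambda>x. let M = \<A> (est_utility G2 \<beta> (fst x)) (snd x) in
      min_max_ratio (assigned_fraction G1 M) (assigned_fraction G2 M))"
  define h where "h = (\<lambda>xs :: nat list. min_max_ratio (real (card (set (take K xs) \<inter> G1)) / real n1)
      (real (card (set (take K xs) \<inter> G2)) / real n2))"
  have af: "assigned_fraction G M = real (card (dom M \<inter> G)) / real (card G)" for G M
    by (simp add: assigned_fraction_def dom_def Int_def conj_commute)
  have f: "f x = min_max_ratio (real (card (dom M \<inter> G1)) / real n1) (real (card (dom M \<inter> G2)) / real n2)"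
    if "M = \<A> (est_utility G2 \<beta> (fst x)) (snd x)" for M x
    unfolding f_def Let_def af that ..
  have "\<bar>integral\<^sup>L (input_law n L) f - \<rho>\<bar> \<le> 12 * (\<delta> / (\<eta>1 * \<eta>2)) + 1 * (8 * \<delta>)"
  proof (rule input_expectation_approx)
    show "AE x in joint_law n L. f x = h (queue (est_utility G2 \<beta> (fst x)) n)"
      using AE_maximizer[OF assms] by eventually_elim (auto simp: f[OF refl] h_def)
    show "(\<lambda>x. h (queue (est_utility G2 \<beta> (fst x)) n)) \<in> borel_measurable (joint_law n L)"
      by (rule measurable_compose[OF measurable_queue_fst]) simp
    show "AE x in joint_law n L. \<bar>f x - \<rho>\<bar> \<le> 1"
    proof (rule AE_I2)
      fix x
      have "0 \<le> f x" "f x \<le> 1" unfolding f[OF refl] by (auto intro!: min_max_ratio_bounds)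
      thus "\<bar>f x - \<rho>\<bar> \<le> 1" using alpha(9,10) by linarith
    qed
    show "AE x in joint_law n L. good (fst x) \<longrightarrow> \<bar>f x - \<rho>\<bar> \<le> 12 * (\<delta> / (\<eta>1 * \<eta>2))"
      using AE_maximizer[OF assms]
    proof eventually_elim
      case (elim x)
      thus ?case using representation_approx[of "fst x"] unfolding f[OF refl] by blast
    qed
  qed (use \<eta> \<delta>_pos in auto)
  moreover have "\<delta> \<le> \<delta> / (\<eta>1 * \<eta>2)"
    using \<eta> \<eta>1_le \<eta>2_le \<delta>_pos by (simp add: le_divide_eq mult_left_le mult_le_one)
  moreover have "representation_metric n G1 G2 \<beta> L \<A> = integral\<^sup>L (input_law n L) f"
    unfolding representation_metric_def f_def
    by (intro Bochner_Integration.integral_cong refl) (auto simp: split_beta)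
  ultimately show ?thesis by simp
qed

section \<open>Utility of the selected candidates\<close>

definition "utility_limit = (f_sel a1 (real n1) + f_sel a2 (real n2)) / f_sel (real K) (real n)"

lemma f_sel_K: "\<eta>2 * real n / 2 \<le> f_sel (real K) (real n)" "0 < f_sel (real K) (real n)"
  using f_sel_bounds(1)[of "real K" "real n"] K_le K_ge n_pos pos by auto

text \<open>An a priori bound for use on the bad event; the 2 is the gap between x / 2 and x, which
  enclose \<open>f_sel x y\<close>.\<close>

lemma utility_limit_bounds: "0 \<le> utility_limit" "utility_limit \<le> 2"
proof -
  have f: "a1 / 2 \<le> f_sel a1 (real n1)" "f_sel a1 (real n1) \<le> a1"
    "a2 / 2 \<le> f_sel a2 (real n2)" "f_sel a2 (real n2) \<le> a2"
    using f_sel_bounds[of a1 "real n1"] f_sel_bounds[of a2 "real n2"] alpha pos by auto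
  show "0 \<le> utility_limit"
    unfolding utility_limit_def using f alpha(2,4) f_sel_K(2) by (intro divide_nonneg_pos) linarith+
  have "f_sel a1 (real n1) + f_sel a2 (real n2) \<le> 2 * f_sel (real K) (real n)"
    using f alpha(1) f_sel_bounds(1)[of "real K" "real n"] K_le n_pos by simp
  thus "utility_limit \<le> 2"
    unfolding utility_limit_def using f_sel_K(2) by (simp add: divide_le_eq)
qed

text \<open>The error consists of \<epsilon> from the layer-cake integral, 3 \<epsilon> from the
  count through the 1-Lipschitz function x - x^2 / (2m), and 1 from passing to
  \<open>f_sel\<close>.\<close>

lemma group_utility_approx:
  assumes "upper_in u G S" "finite G" "\<And>i. i \<in> G \<Longrightarrow> 0 \<le> u i \<and> u i \<le> 1"
    and "uniform_counts \<epsilon> G u" "0 < card G"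
    and "\<bar>real (card S) - a\<bar> \<le> 3 * \<epsilon>" "0 \<le> a" "a \<le> real (card G)"
  shows "\<bar>(\<Sum>i\<in>S. u i) - f_sel a (real (card G))\<bar> \<le> 4 * \<epsilon> + 1"
proof -
  have "card S \<le> card G" using assms(1,2) by (intro card_mono) (auto simp: upper_in_def)
  thus ?thesis
    using sum_upper_in_approx[OF assms(1-5)] f_sel_approx[OF assms(7,8)] assms(5-8)
      quadratic_lipschitz[of "real (card S)" "real (card G)" a] by simp
qed

lemma utility_approx:
  assumes "good u" "\<And>i. i < n \<Longrightarrow> 0 \<le> u i \<and> u i \<le> 1"
    and "upper_in (est_utility G2 \<beta> u) {..<n} S" "card S = K"
  shows "\<bar>(\<Sum>i\<in>S. u i) / optimal_utility n K u - utility_limit\<bar> \<le> 52 * (\<delta> / \<eta>2)"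
proof -
  define T where "T = set (take K (queue u n))"
  have T: "upper_in u {..<n} T" "card T = K"
    using upper_in_take_queue card_take_queue[OF K_le] by (auto simp: T_def)
  have opt: "optimal_utility n K u = (\<Sum>i\<in>T. u i)"
    unfolding T_def by (rule optimal_utility_queue[OF K_le])
  have Sn: "S \<subseteq> {..<n}" using assms(3) by (auto simp: upper_in_def)
  have lt: "i < n" if "i \<in> G1 \<or> i \<in> G2" for i using that G by auto
  have nonneg: "0 \<le> (\<Sum>i\<in>S. u i)" "0 \<le> (\<Sum>i\<in>T. u i)"
    using Sn T(1) assms(2) by (auto simp: upper_in_def intro!: sum_nonneg)
  have le: "(\<Sum>i\<in>S. u i) \<le> (\<Sum>i\<in>T. u i)"
    using sum_le_upper_in[OF T(1) _ Sn] assms(2,4) T(2) by simp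
  \<comment> \<open>Inside one group the bias is a common positive factor, so the candidates
    selected there are also the best by latent utility.\<close>
  have up1: "upper_in u G1 (S \<inter> G1)"
    unfolding upper_in_def
  proof (intro conjI ballI)
    fix i j assume "i \<in> S \<inter> G1" "j \<in> G1 - S \<inter> G1"
    moreover from this have "i \<notin> G2" "j \<notin> G2" using G(2) by auto
    moreover from calculation have "est_utility G2 \<beta> u j \<le> est_utility G2 \<beta> u i"
      using assms(3) lt by (auto simp: upper_in_def)
    ultimately show "u j \<le> u i" by (simp add: est_utility_def)
  qed auto
  have up2: "upper_in u G2 (S \<inter> G2)"
    unfolding upper_in_def
  proof (intro conjI ballI)
    fix i j assume ij: "i \<in> S \<inter> G2" "j \<in> G2 - S \<inter> G2"
    moreover from this have "est_utility G2 \<beta> u j \<le> est_utility G2 \<beta> u i"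
      using assms(3) lt by (auto simp: upper_in_def)
    ultimately show "u j \<le> u i" using \<beta> by (simp add: est_utility_def)
  qed auto
  note c = good_uniform_counts[OF assms(1)]
  have "S = (S \<inter> G1) \<union> (S \<inter> G2)" using Sn G by auto
  hence split: "(\<Sum>i\<in>S. u i) = (\<Sum>i\<in>S \<inter> G1. u i) + (\<Sum>i\<in>S \<inter> G2. u i)"
    using finite_G G(2) by (subst sum.union_disjoint[symmetric]) auto
  have 1: "\<bar>(\<Sum>i\<in>S \<inter> G1. u i) - f_sel a1 (real n1)\<bar> \<le> 4 * \<epsilon> + 1"
    using K_upper_approx(1)[OF assms] alpha(4,5) assms(2)[OF lt] pos
    by (intro group_utility_approx[OF up1 finite_G(1) _ c(1)]) auto
  have 2: "\<bar>(\<Sum>i\<in>S \<inter> G2. u i) - f_sel a2 (real n2)\<bar> \<le> 4 * \<epsilon> + 1"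
    using K_upper_approx(2)[OF assms] alpha(2,3) assms(2)[OF lt] pos
    by (intro group_utility_approx[OF up2 finite_G(2) _ c(2)]) auto
  \<comment> \<open>The optimum ignores the groups, so it needs counts for the whole population,
    obtained by adding those of the groups.\<close>
  have c12: "uniform_counts (2 * \<epsilon>) {..<n} u"
    unfolding uniform_counts_def
  proof (intro ballI)
    fix t :: real assume t: "t \<in> {0..1}"
    have e: "card {i\<in>{..<n}. P i} = card {i\<in>G1. P i} + card {i\<in>G2. P i}" for P
    proof -
      have "{i\<in>{..<n}. P i} = {i\<in>G1. P i} \<union> {i\<in>G2. P i}" using G by auto
      thus ?thesis using finite_G G(2) by (simp add: card_Un_disjoint disjoint_iff)
    qed
    have n: "real (card {..<n}) * (1 - t) = real n1 * (1 - t) + real n2 * (1 - t)"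
      by (subst (1) n_eq) (simp add: distrib_right)
    show "\<bar>real (card {i\<in>{..<n}. t < u i}) - real (card {..<n}) * (1 - t)\<bar> \<le> 2 * \<epsilon> \<and>
        \<bar>real (card {i\<in>{..<n}. t \<le> u i}) - real (card {..<n}) * (1 - t)\<bar> \<le> 2 * \<epsilon>"
    proof -
      have "0 \<le> t" "t \<le> 1" using t by auto
      note uniform_countsD[OF c(1) this] uniform_countsD[OF c(2) this]
      thus ?thesis unfolding e n of_nat_add by linarith
    qed
  qed
  have den: "\<bar>(\<Sum>i\<in>T. u i) - f_sel (real K) (real n)\<bar> \<le> 2 * \<epsilon> + 1"
    using sum_upper_in_approx[OF T(1) _ _ c12] assms(2) T(2) n_pos K_le
      f_sel_approx[of "real K" "real n"] by simp
  have "\<bar>(\<Sum>i\<in>S. u i) / (\<Sum>i\<in>T. u i) - utility_limit\<bar> \<le> ((8 * \<epsilon> + 2) + (2 * \<epsilon> + 1)) / f_sel (real K) (real n)"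
    unfolding utility_limit_def
  proof (rule ratio_approx)
    show "(\<Sum>i\<in>S. u i) = (\<Sum>i\<in>S. u i) / (\<Sum>i\<in>T. u i) * (\<Sum>i\<in>T. u i)"
      using le nonneg by auto
    show "\<bar>(\<Sum>i\<in>S. u i) / (\<Sum>i\<in>T. u i)\<bar> \<le> 1"
      using le nonneg by (auto simp: divide_le_eq_1)
    show "\<bar>(\<Sum>i\<in>S. u i) - (f_sel a1 (real n1) + f_sel a2 (real n2))\<bar> \<le> 8 * \<epsilon> + 2"
      using 1 2 unfolding split by linarith
  qed (use den f_sel_K in auto)
  \<comment> \<open>Since \<epsilon> is at least 1, the additive 3 is absorbed into 10
    \<epsilon>.\<close>
  also have "\<dots> \<le> 13 * \<epsilon> / (\<eta>2 * real n / 2)"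
    using f_sel_K(1) \<epsilon>_pos \<eta> n_pos by (intro frac_le) auto
  also have "\<dots> = 26 * (\<epsilon> / (\<eta>2 * real n))" by simp
  also have "\<dots> \<le> 26 * (2 * \<delta> / \<eta>2)" using \<epsilon>_div_le[OF order_refl \<eta>(2)] by simp
  finally show ?thesis unfolding opt by simp
qed

lemma utility_bound:
  assumes "maximizes_est_utility n p k G2 \<beta> \<A>"
  shows "\<bar>utility_metric n K G2 \<beta> L \<A> - utility_limit\<bar> \<le> 68 * (\<delta> / \<eta>2)"
proof -
  define f where "f = (\<lambda>x. total_utility (fst x) (\<A> (est_utility G2 \<beta> (fst x)) (snd x)) / optimal_utility n K (fst x))"
  define h where "h = (\<lambda>xs ys (x :: (nat \<Rightarrow> real) \<times> (nat \<Rightarrow> nat list)).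
      (\<Sum>i\<in>set (take K xs). fst x i) / (\<Sum>i\<in>set (take K ys). fst x i))"
  have "\<bar>integral\<^sup>L (input_law n L) f - utility_limit\<bar> \<le> 52 * (\<delta> / \<eta>2) + 2 * (8 * \<delta>)"
  proof (rule input_expectation_approx)
    show "AE x in joint_law n L. f x = h (queue (est_utility G2 \<beta> (fst x)) n) (queue (fst x) n) x"
      using AE_maximizer[OF assms]
      by eventually_elim (auto simp: f_def h_def total_utility_def optimal_utility_queue[OF K_le])
    have [measurable]: "(\<lambda>x. fst x i) \<in> borel_measurable (joint_law n L)" for i
      by (rule measurable_compose[OF measurable_fst measurable_utility])
    have "(\<lambda>x. h xs ys x) \<in> borel_measurable (joint_law n L)" for xs ys
      unfolding h_def by measurable
    hence "(\<lambda>x. h xs (queue (fst x) n) x) \<in> borel_measurable (joint_law n L)" for xs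
      by (rule measurable_compose_countable[OF _ measurable_compose[OF measurable_fst measurable_queue']])
    thus "(\<lambda>x. h (queue (est_utility G2 \<beta> (fst x)) n) (queue (fst x) n) x) \<in> borel_measurable (joint_law n L)"
      by (rule measurable_compose_countable[OF _ measurable_queue_fst])
    show "AE x in joint_law n L. \<bar>f x - utility_limit\<bar> \<le> 2"
      using AE_maximizer[OF assms]
    proof eventually_elim
      case (elim x)
      let ?S = "dom (\<A> (est_utility G2 \<beta> (fst x)) (snd x))"
      have S: "?S \<subseteq> {..<n}" using elim unfolding upper_in_def by blast
      have "0 \<le> sum (fst x) ?S" using elim S by (intro sum_nonneg) blast
      moreover have "sum (fst x) ?S \<le> optimal_utility n K (fst x)"
        unfolding optimal_utility_queue[OF K_le]
        by (rule sum_le_upper_in[OF upper_in_take_queue _ S])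
          (use elim card_take_queue[OF K_le] in auto)
      ultimately have "0 \<le> f x" "f x \<le> 1" by (auto simp: f_def total_utility_def divide_le_eq_1)
      thus ?case using utility_limit_bounds by linarith
    qed
    show "AE x in joint_law n L. good (fst x) \<longrightarrow> \<bar>f x - utility_limit\<bar> \<le> 52 * (\<delta> / \<eta>2)"
      using AE_maximizer[OF assms]
    proof eventually_elim
      case (elim x)
      thus ?case using utility_approx[of "fst x"] unfolding f_def total_utility_def by blast
    qed
  qed (use \<eta> \<delta>_pos in auto)
  moreover have "\<delta> \<le> \<delta> / \<eta>2" using \<eta> \<eta>2_le \<delta>_pos by (simp add: le_divide_eq mult_left_le)
  moreover have "utility_metric n K G2 \<beta> L \<A> = integral\<^sup>L (input_law n L) f"
    unfolding utility_metric_def f_def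
    by (intro Bochner_Integration.integral_cong refl) (auto simp: split_beta)
  ultimately show ?thesis by simp
qed

end

subsection \<open>Binomial expectations\<close>

text \<open>The mean of h under the binomial law with N trials, by conditioning on one trial; this
  matches processing the queue one candidate at a time.\<close>

primrec binexp :: "nat \<Rightarrow> real \<Rightarrow> (nat \<Rightarrow> real) \<Rightarrow> real" where
  "binexp 0 q h = h 0"
| "binexp (Suc N) q h = q * binexp N q (\<lambda>m. h (Suc m)) + (1 - q) * binexp N q h"

lemma binexp_add: "binexp N q (\<lambda>m. g m + h m) = binexp N q g + binexp N q h"
  by (induction N arbitrary: g h) (auto simp: algebra_simps)

lemma binexp_const: "binexp N q (\<lambda>m. c) = c"
  by (induction N) (auto simp: algebra_simps)

lemma binexp_mono:
  assumes "0 \<le> q" "q \<le> 1" "\<And>m. g m \<le> h m"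
  shows "binexp N q g \<le> binexp N q h"
  using assms(3)
  by (induction N arbitrary: g h) (auto intro!: add_mono mult_left_mono simp: assms(1,2))

lemma binexp_mono_prob:
  assumes "0 \<le> q" "q \<le> q'" "q' \<le> 1" "mono h"
  shows "binexp N q h \<le> binexp N q' h"
  using assms(4)
proof (induction N arbitrary: h)
  case (Suc N)
  have S: "mono (\<lambda>m. h (Suc m))" using Suc.prems by (auto simp: mono_def)
  have le: "binexp N q h \<le> binexp N q (\<lambda>m. h (Suc m))"
    using assms Suc.prems by (intro binexp_mono) (auto simp: mono_def)
  have "q * binexp N q (\<lambda>m. h (Suc m)) + (1 - q) * binexp N q h
      \<le> q' * binexp N q (\<lambda>m. h (Suc m)) + (1 - q') * binexp N q h"
  proof -
    have "0 \<le> (q' - q) * (binexp N q (\<lambda>m. h (Suc m)) - binexp N q h)" using assms le by simp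
    thus ?thesis by (simp add: algebra_simps)
  qed
  also have "\<dots> \<le> q' * binexp N q' (\<lambda>m. h (Suc m)) + (1 - q') * binexp N q' h"
    using assms Suc.IH[OF S] Suc.IH[OF Suc.prems] by (intro add_mono mult_left_mono) auto
  finally show ?case by simp
qed simp

text \<open>A binomial variable is a sum of exchangeable indicators, so the weight m singles out one
  trial that succeeds and leaves N free ones.\<close>

lemma binexp_size_bias:
  "binexp (Suc N) q (\<lambda>m. real m * h m) = real (Suc N) * (q * binexp N q (\<lambda>m. h (Suc m)))"
proof (induction N arbitrary: h)
  case (Suc N)
  have "binexp (Suc (Suc N)) q (\<lambda>m. real m * h m)
      = q * binexp (Suc N) q (\<lambda>m. h (Suc m) + real m * h (Suc m))
        + (1 - q) * binexp (Suc N) q (\<lambda>m. real m * h m)"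
    by (simp add: algebra_simps)
  also have "\<dots> = q * binexp (Suc N) q (\<lambda>m. h (Suc m))
      + real (Suc N) * q * (q * binexp N q (\<lambda>m. h (Suc (Suc m))) + (1 - q) * binexp N q (\<lambda>m. h (Suc m)))"
    unfolding binexp_add Suc.IH[of h] Suc.IH[of "\<lambda>m. h (Suc m)"] by (simp only: algebra_simps)
  also have "\<dots> = real (Suc (Suc N)) * (q * binexp (Suc N) q (\<lambda>m. h (Suc m)))"
    by (simp add: algebra_simps)
  finally show ?case .
qed simp

text \<open>
  \<open>share c a e q\<close> is the expected proportion of late successes after \<open>e\<close> early ones, when \<open>a\<close>
  early and \<open>c\<close> late trials remain and all of them succeed independently with probability \<open>q\<close>.
\<close>

definition share :: "nat \<Rightarrow> nat \<Rightarrow> nat \<Rightarrow> real \<Rightarrow> real" where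
  "share c a e q = real c / real (a + c) * binexp (a + c) q (\<lambda>m. real m / (real e + real m))"

lemma mono_proportion: "mono (\<lambda>m. real m / (real e + real m))"
proof (rule monoI)
  fix x y :: nat assume "x \<le> y"
  show "real x / (real e + real x) \<le> real y / (real e + real y)"
  \<comment> \<open>For e = 0 the quotient at 0 is 0/0 = 0, so this value is compared
    separately.\<close>
  proof (cases "x = 0")
    case False
    hence "real x * (real e + real y) \<le> real y * (real e + real x)"
      using \<open>x \<le> y\<close> by (simp add: algebra_simps mult_left_mono)
    thus ?thesis using False \<open>x \<le> y\<close> by (intro frac_le_eq[THEN iffD2] divide_nonpos_pos) auto
  qed simp
qed

lemma share_mono: "0 \<le> q \<Longrightarrow> q \<le> q' \<Longrightarrow> q' \<le> 1 \<Longrightarrow> share c a e q \<le> share c a e q'"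
  unfolding share_def by (intro mult_left_mono binexp_mono_prob mono_proportion) auto

lemma share_nonneg: "0 \<le> q \<Longrightarrow> q \<le> 1 \<Longrightarrow> 0 \<le> share c a e q"
  unfolding share_def
  using binexp_mono[of q "\<lambda>_. 0" "\<lambda>m. real m / (real e + real m)" "a + c"]
  by (intro mult_nonneg_nonneg) (auto simp: binexp_const)

text \<open>Every proportion is at most 1; what remains is the late candidates' share c / (a + c) of
  the queue.\<close>

lemma share_le: 
  assumes "0 \<le> q" "q \<le> 1"
  shows "share c a e q \<le> real c / real (a + c)"
proof -
  have "binexp (a + c) q (\<lambda>m. real m / (real e + real m)) \<le> binexp (a + c) q (\<lambda>_. 1)"
    using assms by (intro binexp_mono) (auto simp: divide_le_eq_1)
  hence "binexp (a + c) q (\<lambda>m. real m / (real e + real m)) \<le> 1" by (simp add: binexp_const)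
  thus ?thesis unfolding share_def by (intro mult_left_le) auto
qed

lemma share_0: "0 < c \<Longrightarrow> share c 0 e q = binexp c q (\<lambda>m. real m / (real e + real m))"
  by (simp add: share_def)

lemma share_size_bias:
  assumes "a + c = Suc N"
  shows "share c a e q = real c * (q * binexp N q (\<lambda>m. 1 / (real (Suc e) + real m)))"
  using binexp_size_bias[of N q "\<lambda>m. 1 / (real e + real m)"] unfolding share_def assms
  by (simp add: algebra_simps del: binexp.simps of_nat_Suc) (simp add: algebra_simps)

text \<open>Conditioning on the next early trial: a success adds to e, a failure leaves e alone. In
  size-biased form the varying prefactor c / (a + c) disappears, and the claim becomes the recursion
  of the binomial mean.\<close>

lemma share_Suc:
  assumes "0 < c"
  shows "share c (Suc a) e q = q * share c a (Suc e) q + (1 - q) * share c a e q"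
proof -
  obtain N where N: "a + c = Suc N" using assms by (cases "a + c") auto
  hence N': "Suc a + c = Suc (Suc N)" by simp
  have shift: "(\<lambda>m. 1 / (real (Suc e) + real (Suc m))) = (\<lambda>m. 1 / (real (Suc (Suc e)) + real m))"
    by (simp add: ac_simps)
  show ?thesis
    unfolding share_size_bias[OF N'] share_size_bias[OF N] binexp.simps shift by (simp add: algebra_simps)
qed

subsection \<open>The process of first choices\<close>

lemma nn_integral_pmf_two_values:
  assumes "\<And>s. s \<in> set_pmf L \<Longrightarrow> f s \<le> (if s \<in> S then ennreal A else ennreal B)" "0 \<le> A" "0 \<le> B"
  shows "(\<integral>\<^sup>+s. f s \<partial>measure_pmf L)
    \<le> ennreal (measure_pmf.prob L S * A + (1 - measure_pmf.prob L S) * B)"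
proof -
  let ?q = "measure_pmf.prob L S"
  have "(\<integral>\<^sup>+s. f s \<partial>measure_pmf L)
      \<le> (\<integral>\<^sup>+s. ennreal A * indicator S s + ennreal B * indicator (- S) s \<partial>measure_pmf L)"
    by (intro nn_integral_mono_AE)
      (auto simp: AE_measure_pmf_iff indicator_def intro: order_trans[OF assms(1)])
  also have "\<dots> = ennreal A * emeasure (measure_pmf L) S + ennreal B * emeasure (measure_pmf L) (- S)"
    by (subst nn_integral_add) (auto simp: nn_integral_cmult)
  also have "emeasure (measure_pmf L) (- S) = ennreal (1 - ?q)"
    using measure_pmf.prob_compl[of S L] by (simp add: measure_pmf.emeasure_eq_measure Compl_eq_Diff_UNIV)
  also have "ennreal A * emeasure (measure_pmf L) S + ennreal B * ennreal (1 - ?q)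
      = ennreal (?q * A + (1 - ?q) * B)"
    using assms(2,3) by (simp add: measure_pmf.emeasure_eq_measure ennreal_mult'[symmetric] ennreal_plus mult.commute)
  finally show ?thesis .
qed

text \<open>A finite product of countable discrete spaces is discrete, so every function of the
  preference lists is measurable.\<close>

lemma sets_preference_law: 
  assumes "finite I"
  shows "sets (PiM I (\<lambda>_::nat. measure_pmf (L :: nat list pmf))) = Pow (I \<rightarrow>\<^sub>E UNIV)"
proof -
  have "sets (PiM I (\<lambda>_. measure_pmf L)) = sets (PiM I (\<lambda>_. count_space (UNIV :: nat list set)))"
    by (intro sets_PiM_cong) auto
  also have "PiM I (\<lambda>_. count_space (UNIV :: nat list set)) = count_space (I \<rightarrow>\<^sub>E UNIV)"
    using assms by (intro count_space_PiM_finite) auto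
  finally show ?thesis by simp
qed

lemma measurable_preference_law:
  assumes "finite I"
  shows "f \<in> borel_measurable (PiM I (\<lambda>_::nat. measure_pmf (L :: nat list pmf)))"
  by (rule measurableI) (auto simp: sets_preference_law[OF assms] space_PiM)

text \<open>By independence the list of x may be redrawn. The inner integral still runs over all of
  I, with coordinate x overwritten, so the index set stays fixed during inductions along the
  queue.\<close>

lemma resample:
  fixes f :: "(nat \<Rightarrow> nat list) \<Rightarrow> ennreal"
  assumes "finite I" "x \<in> I"
  shows "(\<integral>\<^sup>+\<sigma>. f \<sigma> \<partial>PiM I (\<lambda>_. measure_pmf L))
    = (\<integral>\<^sup>+s. (\<integral>\<^sup>+\<sigma>. f (\<sigma>(x := s)) \<partial>PiM I (\<lambda>_. measure_pmf L)) \<partial>measure_pmf L)"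
proof -
  interpret product_prob_space "\<lambda>_::nat. measure_pmf L" UNIV ..
  define J where "J = I - {x}"
  have J: "finite J" "x \<notin> J" and ins: "I = insert x J" using assms by (auto simp: J_def)
  have *: "(\<integral>\<^sup>+\<sigma>. h \<sigma> \<partial>PiM I (\<lambda>_. measure_pmf L))
      = (\<integral>\<^sup>+s. (\<integral>\<^sup>+\<sigma>. h (\<sigma>(x := s)) \<partial>PiM J (\<lambda>_. measure_pmf L)) \<partial>measure_pmf L)" for h :: "(nat \<Rightarrow> nat list) \<Rightarrow> ennreal"
    using product_nn_integral_insert_rev[OF J, of h] measurable_preference_law[of "insert x J" h L] J assms(1)
    unfolding ins[symmetric] by simp
  have "(\<integral>\<^sup>+\<sigma>. f (\<sigma>(x := s)) \<partial>PiM I (\<lambda>_. measure_pmf L))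
      = (\<integral>\<^sup>+\<sigma>. f (\<sigma>(x := s)) \<partial>PiM J (\<lambda>_. measure_pmf L))" for s
    by (subst *) simp
  thus ?thesis by (subst *) simp
qed

abbreviation mean :: "nat set \<Rightarrow> nat list pmf \<Rightarrow> ((nat \<Rightarrow> nat list) \<Rightarrow> real) \<Rightarrow> ennreal" where
  "mean I L f \<equiv> (\<integral>\<^sup>+\<sigma>. ennreal (f \<sigma>) \<partial>PiM I (\<lambda>_. measure_pmf L))"

definition vacant :: "(nat \<Rightarrow> nat) \<Rightarrow> assignment \<Rightarrow> nat \<Rightarrow> bool" where
  "vacant k M l \<longleftrightarrow> card {i. M i = Some l} < k l"

text \<open>A candidate is recorded on arrival if the first choice is vacant at that moment, which
  makes induction along the queue possible. \<open>fold_greedy_hits\<close> identifies these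
  candidates with those who hold their first choice at the end.\<close>

primrec hits :: "(nat \<Rightarrow> nat) \<Rightarrow> (nat \<Rightarrow> nat list) \<Rightarrow> nat list \<Rightarrow> assignment \<Rightarrow> nat set" where
  "hits k \<sigma> [] M = {}"
| "hits k \<sigma> (x # xs) M =
     (if vacant k M (hd (\<sigma> x)) then {x} else {}) \<union> hits k \<sigma> xs (greedy_step k \<sigma> x M)"

definition hit_rate :: "(nat \<Rightarrow> nat) \<Rightarrow> nat list pmf \<Rightarrow> assignment \<Rightarrow> real" where
  "hit_rate k L M = measure_pmf.prob L {s. vacant k M (hd s)}"

lemma hit_rate_bounds: "0 \<le> hit_rate k L M" "hit_rate k L M \<le> 1"
  by (auto simp: hit_rate_def)

lemma hits_subset: "hits k \<sigma> xs M \<subseteq> set xs"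
  by (induction xs arbitrary: M) auto

lemma finite_hits: "finite (hits k \<sigma> xs M)"
  by (rule finite_subset[OF hits_subset]) simp

lemma greedy_step_cong: "\<sigma> x = \<sigma>' x \<Longrightarrow> greedy_step k \<sigma> x M = greedy_step k \<sigma>' x M"
  by (simp add: greedy_step_def)

lemma hits_cong: "(\<And>x. x \<in> set xs \<Longrightarrow> \<sigma> x = \<sigma>' x) \<Longrightarrow> hits k \<sigma> xs M = hits k \<sigma>' xs M"
proof (induction xs arbitrary: M)
  case (Cons x xs)
  thus ?case using greedy_step_cong[of \<sigma> x \<sigma>' k M] by auto
qed simp

lemma hits_Cons_update:
  assumes "x \<notin> set xs"
  shows "hits k (\<sigma>(x := s)) (x # xs) M =
    (if vacant k M (hd s) then {x} else {}) \<union> hits k \<sigma> xs (greedy_step k (\<lambda>_. s) x M)"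
proof -
  have "greedy_step k (\<sigma>(x := s)) x M = greedy_step k (\<lambda>_. s) x M"
    by (rule greedy_step_cong) simp
  moreover have "hits k (\<sigma>(x := s)) xs M' = hits k \<sigma> xs M'" for M'
    using assms by (intro hits_cong) auto
  ultimately show ?thesis by simp
qed

lemma finite_dom_greedy_step: "finite (dom M) \<Longrightarrow> finite (dom (greedy_step k \<sigma> x M))"
  by (auto simp: greedy_step_def split: option.split)

lemma dom_greedy_step: "dom (greedy_step k \<sigma> x M) \<subseteq> insert x (dom M)"
  by (auto simp: greedy_step_def split: option.split)

text \<open>Slots are only filled, never freed, so the set of vacant institutions can only
  shrink.\<close>

lemma hit_rate_greedy_step:
  assumes "finite (dom M)" "x \<notin> dom M"
  shows "hit_rate k L (greedy_step k \<sigma> x M) \<le> hit_rate k L M"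
  unfolding hit_rate_def
proof (rule measure_pmf.finite_measure_mono)
  have "card {i. M i = Some l} \<le> card {i. greedy_step k \<sigma> x M i = Some l}" for l
  proof (rule card_mono)
    show "finite {i. greedy_step k \<sigma> x M i = Some l}"
      by (rule finite_subset[OF _ finite_dom_greedy_step[OF assms(1)]]) auto
  qed (use assms(2) in \<open>auto simp: greedy_step_def split: option.split\<close>)
  thus "{s. vacant k (greedy_step k \<sigma> x M) (hd s)} \<subseteq> {s. vacant k M (hd s)}"
    by (auto simp: vacant_def intro: le_less_trans)
qed simp

definition fresh :: "nat list \<Rightarrow> assignment \<Rightarrow> bool" where
  "fresh xs M \<longleftrightarrow> distinct xs \<and> finite (dom M) \<and> dom M \<inter> set xs = {}"

lemma fresh_greedy_step: "fresh (x # xs) M \<Longrightarrow> fresh xs (greedy_step k \<sigma> x M)"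
  using dom_greedy_step[of k \<sigma> x M] finite_dom_greedy_step[of M k \<sigma> x] by (auto simp: fresh_def)

lemma fresh_hit_rate: "fresh (x # xs) M \<Longrightarrow> hit_rate k L (greedy_step k \<sigma> x M) \<le> hit_rate k L M"
  by (intro hit_rate_greedy_step) (auto simp: fresh_def)

text \<open>Redrawing the list of x separates a hit, of probability \<open>hit_rate k L M\<close>,
  from a miss. The next assignment still depends on the redrawn list, hence the premises for every
  M' whose rate is no larger.\<close>

lemma nn_integral_step:
  fixes F :: "nat set \<Rightarrow> ennreal"
  assumes "finite I" "set (x # xs) \<subseteq> I" "fresh (x # xs) M" "0 \<le> A" "0 \<le> B"
    and hit: "\<And>M'. fresh xs M' \<Longrightarrow> hit_rate k L M' \<le> hit_rate k L M \<Longrightarrow>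
      (\<integral>\<^sup>+\<sigma>. F (insert x (hits k \<sigma> xs M')) \<partial>PiM I (\<lambda>_. measure_pmf L)) \<le> ennreal A"
    and miss: "\<And>M'. fresh xs M' \<Longrightarrow> hit_rate k L M' \<le> hit_rate k L M \<Longrightarrow>
      (\<integral>\<^sup>+\<sigma>. F (hits k \<sigma> xs M') \<partial>PiM I (\<lambda>_. measure_pmf L)) \<le> ennreal B"
  shows "(\<integral>\<^sup>+\<sigma>. F (hits k \<sigma> (x # xs) M) \<partial>PiM I (\<lambda>_. measure_pmf L))
    \<le> ennreal (hit_rate k L M * A + (1 - hit_rate k L M) * B)"
proof -
  have x: "x \<in> I" "x \<notin> set xs" using assms by (auto simp: fresh_def)
  show ?thesis
    apply (subst resample[OF assms(1) x(1)])
    unfolding hits_Cons_update[OF x(2)] hit_rate_def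
    using hit[OF fresh_greedy_step[OF assms(3)] fresh_hit_rate[OF assms(3)]]
      miss[OF fresh_greedy_step[OF assms(3)] fresh_hit_rate[OF assms(3)]] assms(4,5)
    by (intro nn_integral_pmf_two_values) auto
qed

text \<open>
  The hit rate only decreases, so the number of hits in a set is stochastically dominated by a
  binomial variable with the current rate.
\<close>

lemma hits_binomial_domination:
  assumes "finite I" "set xs \<subseteq> I" "fresh xs M" "mono g" "\<And>m. 0 \<le> g m"
  shows "mean I L (\<lambda>\<sigma>. g (card (C \<inter> hits k \<sigma> xs M)))
    \<le> ennreal (binexp (card (C \<inter> set xs)) (hit_rate k L M) g)"
  using assms(2-5)
proof (induction xs arbitrary: M g)
  case Nil
  interpret prob_space "PiM I (\<lambda>_. measure_pmf L)"
    by (intro prob_space_PiM measure_pmf.prob_space_axioms)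
  show ?case by (simp add: emeasure_space_1)
next
  case (Cons x xs)
  have x: "x \<notin> set xs" and sub: "set xs \<subseteq> I" using Cons.prems by (auto simp: fresh_def)
  let ?N = "card (C \<inter> set xs)" and ?q = "hit_rate k L M"
  have q: "0 \<le> ?q" "?q \<le> 1" by (auto simp: hit_rate_bounds)
  have xh: "x \<notin> hits k \<sigma> xs M'" for \<sigma> M' using x hits_subset by blast
  have fin: "finite (C \<inter> hits k \<sigma> xs M')" for \<sigma> M' using finite_hits by blast
  have IH: "mean I L (\<lambda>\<sigma>. h (card (C \<inter> hits k \<sigma> xs M'))) \<le> ennreal (binexp ?N ?q h)"
    if "fresh xs M'" "hit_rate k L M' \<le> ?q" "mono h" "\<And>m. 0 \<le> h m" for M' h
    using Cons.IH[OF sub that(1,3,4)] binexp_mono_prob[OF hit_rate_bounds(1) that(2) q(2) that(3)]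
    by (meson ennreal_leI order_trans)
  have nonneg: "0 \<le> binexp ?N ?q h" if "\<And>m. 0 \<le> h m" for h
    using binexp_mono[OF q, of "\<lambda>_. 0" h ?N] that by (simp add: binexp_const)
  show ?case
  proof (cases "x \<in> C")
    case True
    have S: "mono (\<lambda>m. g (Suc m))" using Cons.prems(3) by (auto simp: mono_def)
    have ins: "card (C \<inter> insert x (hits k \<sigma> xs M')) = Suc (card (C \<inter> hits k \<sigma> xs M'))" for \<sigma> M'
      using True xh fin by (simp add: Int_insert_right)
    have N: "card (C \<inter> set (x # xs)) = Suc ?N" using True x by (simp add: Int_insert_right)
    show ?thesis unfolding N binexp.simps
      by (rule nn_integral_step[OF assms(1) Cons.prems(1,2), where F = "\<lambda>H. ennreal (g (card (C \<inter> H)))"])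
        (use IH S Cons.prems(3,4) in \<open>auto simp: ins intro!: nonneg\<close>)
  next
    case False
    have "ennreal (?q * binexp ?N ?q g + (1 - ?q) * binexp ?N ?q g) = ennreal (binexp ?N ?q g)"
      by (simp add: algebra_simps)
    thus ?thesis
      using nn_integral_step[OF assms(1) Cons.prems(1,2), where F = "\<lambda>H. ennreal (g (card (C \<inter> H)))"
          and A = "binexp ?N ?q g" and B = "binexp ?N ?q g" and k = k and L = L] IH Cons.prems(3,4) nonneg False
      by (simp add: Int_insert_right)
  qed
qed

lemma hits_not_in: "x \<notin> set xs \<Longrightarrow> x \<notin> hits k \<sigma> xs M"
  using hits_subset by blast

text \<open>Induction over the early candidates: a hit increases e, the rate afterwards is no
  larger, and \<open>share\<close> is monotone in the rate, so \<open>share_Suc\<close> closes the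
  step. Once they are used up, binomial domination applies; late candidates outside C only take
  slots away.\<close>

lemma late_share_bound:
  assumes "finite I" "set (ys @ zs) \<subseteq> I" "fresh (ys @ zs) M" "C \<subseteq> set zs" "C \<noteq> {}"
  shows "(\<integral>\<^sup>+\<sigma>. (let H = hits k \<sigma> (ys @ zs) M in
      ennreal (real (card (C \<inter> H)) / (real e + real (card (set ys \<inter> H)) + real (card (C \<inter> H)))))
        \<partial>PiM I (\<lambda>_. measure_pmf L))
    \<le> ennreal (share (card C) (length ys) e (hit_rate k L M))"
  using assms(2,3)
proof (induction ys arbitrary: M e)
  case Nil
  have "0 < card C" using assms(4,5) by (meson card_gt_0_iff finite_set finite_subset)
  moreover have "C \<inter> set zs = C" using assms(4) by auto
  ultimately show ?case
    using hits_binomial_domination[OF assms(1) _ _ mono_proportion[of e], where xs = zs and C = C and M = M and k = k and L = L] Nil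
    by (simp add: share_0 Let_def)
next
  case (Cons y ys)
  have c: "0 < card C" using assms(4,5) by (meson card_gt_0_iff finite_set finite_subset)
  have sub: "set (y # (ys @ zs)) \<subseteq> I" "set (ys @ zs) \<subseteq> I" and fr: "fresh (y # (ys @ zs)) M"
    using Cons.prems by auto
  have y: "y \<notin> set (ys @ zs)" "y \<notin> C" "y \<notin> set ys" using fr assms(4) by (auto simp: fresh_def)
  let ?F = "\<lambda>H. ennreal (real (card (C \<inter> H)) / (real e + real (card (set (y # ys) \<inter> H)) + real (card (C \<inter> H))))"
  let ?q = "hit_rate k L M"
  have q: "0 \<le> ?q" "?q \<le> 1" by (auto simp: hit_rate_bounds)
  let ?h = "\<lambda>M' \<sigma>. hits k \<sigma> (ys @ zs) M'"
  have hit: "?F (insert y (?h M' \<sigma>)) = ennreal (real (card (C \<inter> ?h M' \<sigma>)) /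
      (real (Suc e) + real (card (set ys \<inter> ?h M' \<sigma>)) + real (card (C \<inter> ?h M' \<sigma>))))" for M' \<sigma>
  proof -
    have "set (y # ys) \<inter> insert y (?h M' \<sigma>) = insert y (set ys \<inter> ?h M' \<sigma>)" by auto
    hence "card (set (y # ys) \<inter> insert y (?h M' \<sigma>)) = Suc (card (set ys \<inter> ?h M' \<sigma>))"
      using y by simp
    moreover have "C \<inter> insert y (?h M' \<sigma>) = C \<inter> ?h M' \<sigma>" using y by auto
    ultimately show ?thesis by (simp add: ac_simps)
  qed
  have miss: "?F (?h M' \<sigma>) = ennreal (real (card (C \<inter> ?h M' \<sigma>)) /
      (real e + real (card (set ys \<inter> ?h M' \<sigma>)) + real (card (C \<inter> ?h M' \<sigma>))))" for M' \<sigma>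
  proof -
    have "set (y # ys) \<inter> ?h M' \<sigma> = set ys \<inter> ?h M' \<sigma>" using hits_not_in[OF y(1)] by auto
    thus ?thesis by simp
  qed
  have mono: "ennreal (share (card C) (length ys) e' (hit_rate k L M')) \<le> ennreal (share (card C) (length ys) e' ?q)"
    if "hit_rate k L M' \<le> ?q" for M' e'
    by (intro ennreal_leI share_mono that q hit_rate_bounds)
  have "(\<integral>\<^sup>+\<sigma>. ?F (hits k \<sigma> (y # (ys @ zs)) M) \<partial>PiM I (\<lambda>_. measure_pmf L))
      \<le> ennreal (?q * share (card C) (length ys) (Suc e) ?q + (1 - ?q) * share (card C) (length ys) e ?q)"
  proof (rule nn_integral_step[OF assms(1) sub(1) fr])
    show "(\<integral>\<^sup>+\<sigma>. ?F (insert y (?h M' \<sigma>)) \<partial>PiM I (\<lambda>_. measure_pmf L)) \<le> ennreal (share (card C) (length ys) (Suc e) ?q)"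
      if "fresh (ys @ zs) M'" "hit_rate k L M' \<le> ?q" for M'
      unfolding hit using Cons.IH[OF sub(2) that(1), of "Suc e"] mono[OF that(2)]
      unfolding Let_def by (rule order_trans)
    show "(\<integral>\<^sup>+\<sigma>. ?F (?h M' \<sigma>) \<partial>PiM I (\<lambda>_. measure_pmf L)) \<le> ennreal (share (card C) (length ys) e ?q)"
      if "fresh (ys @ zs) M'" "hit_rate k L M' \<le> ?q" for M'
      unfolding miss using Cons.IH[OF sub(2) that(1), of e] mono[OF that(2)]
      unfolding Let_def by (rule order_trans)
  qed (auto intro!: share_nonneg hit_rate_bounds)
  thus ?case by (simp only: Let_def append_Cons length_Cons share_Suc[OF c])
qed

text \<open>
  The first early hit is not counted in the denominator; its place is taken below by the member of
  the second group that joins \<open>C\<close>.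
\<close>

definition late_share :: "nat list \<Rightarrow> nat set \<Rightarrow> nat set \<Rightarrow> real" where
  "late_share ys C H = (if set ys \<inter> H = {} then 0 else
     real (card (C \<inter> H)) / (real (card (set ys \<inter> H)) - 1 + real (card (C \<inter> H))))"

text \<open>The exceptional event of the exchange argument: without an early hit there is nothing to
  pay for the exchanged candidate, and the ratio is bounded by 1.\<close>

definition early_miss :: "nat list \<Rightarrow> nat list \<Rightarrow> nat set \<Rightarrow> real" where
  "early_miss ys zs H = of_bool (set ys \<inter> H = {} \<and> set zs \<inter> H \<noteq> {})"

text \<open>The interface between the process and the exchange argument: late hits get at most their
  proportional share up to a relative error \<kappa> / length, and the exceptional event is as rare.
  The two parts treat all splittings of a queue, since the actual one depends on the
  utilities.\<close>

definition first_choice_control :: "(nat \<Rightarrow> nat) \<Rightarrow> nat list pmf \<Rightarrow> nat \<Rightarrow> real \<Rightarrow> bool" where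
  "first_choice_control k L n \<kappa> \<longleftrightarrow> (\<forall>ys zs. distinct (ys @ zs) \<longrightarrow> set (ys @ zs) \<subseteq> {..<n} \<longrightarrow> ys \<noteq> [] \<longrightarrow>
     (\<forall>C. C \<subseteq> set zs \<longrightarrow> C \<noteq> {} \<longrightarrow>
       mean {..<n} L (\<lambda>\<sigma>. late_share ys C (hits k \<sigma> (ys @ zs) Map.empty))
         \<le> ennreal (real (card C) * (1 + \<kappa> / real (length ys)) / (real (length ys) + real (card C)))) \<and>
     mean {..<n} L (\<lambda>\<sigma>. early_miss ys zs (hits k \<sigma> (ys @ zs) Map.empty))
       \<le> ennreal (\<kappa> / real (length ys)))"

lemma late_share_insert:
  assumes "y \<notin> set (ys @ zs)" "C \<subseteq> set zs" "H \<subseteq> set (ys @ zs)"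
  shows "late_share (y # ys) C (insert y H)
    = real (card (C \<inter> H)) / (real 0 + real (card (set ys \<inter> H)) + real (card (C \<inter> H)))"
proof -
  have "set (y # ys) \<inter> insert y H = insert y (set ys \<inter> H)" by auto
  moreover have "y \<notin> set ys \<inter> H" using assms by auto
  ultimately have "card (set (y # ys) \<inter> insert y H) = Suc (card (set ys \<inter> H))" by simp
  moreover have "C \<inter> insert y H = C \<inter> H" using assms by auto
  ultimately show ?thesis by (simp add: late_share_def)
qed

lemma late_share_skip:
  assumes "y \<notin> set (ys @ zs)" "H \<subseteq> set (ys @ zs)"
  shows "late_share (y # ys) C H = late_share ys C H"
proof -
  have "set (y # ys) \<inter> H = set ys \<inter> H" using assms by auto
  thus ?thesis by (simp add: late_share_def)
qed

text \<open>The hit of y is the one that \<open>late_share\<close> omits from the denominator, so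
  the rest of the queue starts with e = 0.\<close>

lemma late_share_hit:
  assumes "finite I" "set (y # ys @ zs) \<subseteq> I" "fresh (y # ys @ zs) M" "C \<subseteq> set zs" "C \<noteq> {}"
    and "fresh (ys @ zs) M'"
  shows "mean I L (\<lambda>\<sigma>. late_share (y # ys) C (insert y (hits k \<sigma> (ys @ zs) M')))
    \<le> ennreal (real (card C) / (real (length ys) + real (card C)))"
proof -
  have y: "y \<notin> set (ys @ zs)" using assms(3) by (simp add: fresh_def)
  have "set (ys @ zs) \<subseteq> I" using assms(2) by simp
  from late_share_bound[OF assms(1) this assms(6) assms(4,5), where k = k and e = 0 and L = L]
  have "mean I L (\<lambda>\<sigma>. late_share (y # ys) C (insert y (hits k \<sigma> (ys @ zs) M')))
      \<le> ennreal (share (card C) (length ys) 0 (hit_rate k L M'))"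
    unfolding late_share_insert[OF y assms(4) hits_subset] Let_def .
  also have "\<dots> \<le> ennreal (real (card C) / (real (length ys) + real (card C)))"
    using share_le[OF hit_rate_bounds, of "card C" "length ys" 0 k L M'] by (intro ennreal_leI) simp
  finally show ?thesis .
qed

lemma late_share_bounds: "0 \<le> late_share ys C H" "late_share ys C H \<le> 1"
proof -
  have "set ys \<inter> H \<noteq> {} \<Longrightarrow> 1 \<le> card (set ys \<inter> H)"
    by (simp add: Suc_le_eq card_gt_0_iff)
  hence 1: "set ys \<inter> H \<noteq> {} \<Longrightarrow> 0 \<le> real (card (set ys \<inter> H)) - 1" by auto
  show "0 \<le> late_share ys C H" using 1 by (auto simp: late_share_def)
  show "late_share ys C H \<le> 1" using 1 by (auto simp: late_share_def divide_le_eq_1)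
qed

lemma early_miss_bounds: "0 \<le> early_miss ys zs H" "early_miss ys zs H \<le> 1"
  by (auto simp: early_miss_def)

lemma early_miss_insert: "early_miss (y # ys) zs (insert y H) = 0"
  by (auto simp: early_miss_def)

lemma early_miss_skip:
  assumes "y \<notin> H" shows "early_miss (y # ys) zs H = early_miss ys zs H"
  using assms by (auto simp: early_miss_def)

lemma nn_integral_preference_law_le_1:
  assumes "\<And>\<sigma>. f \<sigma> \<le> 1"
  shows "mean I L (\<lambda>\<sigma>. f \<sigma>) \<le> ennreal 1"
proof -
  interpret prob_space "PiM I (\<lambda>_. measure_pmf L)"
    by (intro prob_space_PiM measure_pmf.prob_space_axioms)
  have "mean I L (\<lambda>\<sigma>. f \<sigma>) \<le> (\<integral>\<^sup>+\<sigma>. ennreal 1 \<partial>PiM I (\<lambda>_. measure_pmf L))"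
    using assms by (intro nn_integral_mono ennreal_leI) auto
  also have "\<dots> = ennreal 1" by (simp add: emeasure_space_1)
  finally show ?thesis .
qed

section \<open>Control of first choices when every institution starts with a slot\<close>

lemma hd_ranking:
  assumes "s \<in> rankings p" "0 < p"
  shows "s \<noteq> []" "hd s < p"
proof -
  have "set s = {..<p}"
    using assms(1) permutations_of_setD(1) by (auto simp: rankings_def)
  thus "s \<noteq> []" using assms(2) by (metis empty_iff lessThan_iff list.set(1))
  thus "hd s < p" using \<open>set s = {..<p}\<close> by (metis hd_in_set lessThan_iff)
qed

text \<open>The first candidate surely hits. Hence an early miss cannot occur, and the omitted hit
  is that of the first candidate; the value \<kappa> = 1 only compensates for the early part being
  shorter by one.\<close>

lemma first_choice_control_all_vacant:
  assumes "\<forall>l<p. 0 < k l" "set_pmf L \<subseteq> rankings p" "0 < p"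
  shows "first_choice_control k L n 1"
  unfolding first_choice_control_def
proof (intro allI impI conjI)
  fix ys0 zs :: "nat list" assume d: "distinct (ys0 @ zs)" "set (ys0 @ zs) \<subseteq> {..<n}" "ys0 \<noteq> []"
  then obtain y ys where ys0: "ys0 = y # ys" by (cases ys0) auto
  have sub: "set (y # ys @ zs) \<subseteq> {..<n}" and fr: "fresh (y # ys @ zs) Map.empty"
    using d unfolding ys0 by (auto simp: fresh_def)
  have hd: "hd s < p" if "s \<in> set_pmf L" for s using hd_ranking[OF _ assms(3)] that assms(2) by blast
  have rate: "hit_rate k L Map.empty = 1"
    unfolding hit_rate_def using hd assms(1)
    by (subst measure_pmf.prob_eq_1) (auto simp: AE_measure_pmf_iff vacant_def)
  have y: "y \<notin> set (ys @ zs)" using d unfolding ys0 by auto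
  have sub': "set (y # (ys @ zs)) \<subseteq> {..<n}" and fr': "fresh (y # (ys @ zs)) Map.empty"
    using sub fr by auto
  {
    fix C assume C: "C \<subseteq> set zs" "C \<noteq> {}"
    define c a where "c = real (card C)" and "a = real (length ys)"
    have "0 < card C" using C by (meson card_gt_0_iff finite_set finite_subset)
    hence c: "1 \<le> c" "0 \<le> a" by (auto simp: c_def a_def)
    have "mean {..<n} L (\<lambda>\<sigma>. late_share (y # ys) C (hits k \<sigma> (y # (ys @ zs)) Map.empty))
        \<le> ennreal (hit_rate k L Map.empty * (c / (a + c)) + (1 - hit_rate k L Map.empty) * 1)"
    proof (rule nn_integral_step[OF _ sub' fr'])
      show "mean {..<n} L (\<lambda>\<sigma>. late_share (y # ys) C (insert y (hits k \<sigma> (ys @ zs) M')))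
          \<le> ennreal (c / (a + c))" if "fresh (ys @ zs) M'" for M'
        unfolding c_def a_def using late_share_hit[OF _ sub fr C that] by simp
      show "mean {..<n} L (\<lambda>\<sigma>. late_share (y # ys) C (hits k \<sigma> (ys @ zs) M')) \<le> ennreal 1" for M'
        by (intro nn_integral_preference_law_le_1 late_share_bounds)
    qed (use c in auto)
    also have "\<dots> = ennreal (c / (a + c))" by (simp add: rate)
    also have "c / (a + c) \<le> c * (1 + 1 / (a + 1)) / ((a + 1) + c)"
    proof -
      \<comment> \<open>The two sides differ by c - 1.\<close>
      have "(a + 1) * (a + 1 + c) \<le> (a + 1 + 1) * (a + c)" using c by (simp add: algebra_simps)
      hence "1 / (a + c) \<le> (1 + 1 / (a + 1)) / (a + 1 + c)"
        using c by (simp add: divide_simps)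
      hence "c * (1 / (a + c)) \<le> c * ((1 + 1 / (a + 1)) / (a + 1 + c))"
        using c by (intro mult_left_mono) auto
      thus ?thesis by simp
    qed
    hence "ennreal (c / (a + c)) \<le> ennreal (c * (1 + 1 / (a + 1)) / ((a + 1) + c))" by (rule ennreal_leI)
    finally show "mean {..<n} L (\<lambda>\<sigma>. late_share ys0 C (hits k \<sigma> (ys0 @ zs) Map.empty))
         \<le> ennreal (real (card C) * (1 + 1 / real (length ys0)) / (real (length ys0) + real (card C)))"
      by (simp add: ys0 c_def a_def ac_simps)
  }
  have "mean {..<n} L (\<lambda>\<sigma>. early_miss (y # ys) zs (hits k \<sigma> (y # (ys @ zs)) Map.empty))
      \<le> ennreal (hit_rate k L Map.empty * 0 + (1 - hit_rate k L Map.empty) * 1)"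
  proof (rule nn_integral_step[OF _ sub' fr'])
    show "mean {..<n} L (\<lambda>\<sigma>. early_miss (y # ys) zs (hits k \<sigma> (ys @ zs) M')) \<le> ennreal 1" for M'
      by (intro nn_integral_preference_law_le_1 early_miss_bounds)
  qed (auto simp: early_miss_insert)
  also have "\<dots> \<le> ennreal (1 / real (length ys0))" by (simp add: rate)
  finally show "mean {..<n} L (\<lambda>\<sigma>. early_miss ys0 zs (hits k \<sigma> (ys0 @ zs) Map.empty))
       \<le> ennreal (1 / real (length ys0))"
    by (simp add: ys0)
qed

section \<open>Control of first choices from a least positive hit rate\<close>

text \<open>A bound on the late share per member of C while a early candidates remain and none has
  hit. The value 1 / c expresses that a share is at most 1; it takes over when \<kappa> / a is too
  large to help. At a = 0 the convention \<kappa> / 0 = 0 makes both values equal to 1 / c.\<close>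

definition miss_bound :: "real \<Rightarrow> real \<Rightarrow> nat \<Rightarrow> real" where
  "miss_bound \<kappa> c a = min (1 / c) ((1 + \<kappa> / real a) / (real a + c))"

text \<open>A hit leads to the exact share 1 / (a + c), a miss to the same problem with a candidates
  left. The bound is preserved because a miss multiplies the excess \<kappa> / a by 1 - q, which
  outweighs the slow change from a to a + 1 once a is large against 1 / q.\<close>

lemma miss_bound_step:
  assumes q: "0 < q" "q \<le> 1" and c: "1 \<le> c"
  shows "q / (real a + c) + (1 - q) * miss_bound (25 / q\<^sup>2) c a \<le> miss_bound (25 / q\<^sup>2) c (Suc a)"
proof -
  define \<kappa> where "\<kappa> = 25 / q\<^sup>2"
  define x where "x = real a"
  have x: "0 \<le> x" by (simp add: x_def)
  have \<kappa>: "0 < \<kappa>" using q by (simp add: \<kappa>_def)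
  have "q / (x + c) + (1 - q) * miss_bound \<kappa> c a \<le> q * (1 / c) + (1 - q) * (1 / c)"
    using q c x by (intro add_mono mult_left_mono) (auto simp: miss_bound_def frac_le)
  also have "\<dots> = 1 / c" by (simp add: add_divide_distrib[symmetric])
  finally have 1: "q / (x + c) + (1 - q) * miss_bound \<kappa> c a \<le> 1 / c" .
  have 2: "q / (x + c) + (1 - q) * miss_bound \<kappa> c a \<le> (1 + \<kappa> / (x + 1)) / (x + 1 + c)"
  \<comment> \<open>For x < 4 / q we have x + 1 at most 5 / q, and \<kappa> = (5 / q)^2 is chosen so
    that the claimed bound is then at least 1 / c. Otherwise q x is at least 4, which lets half of q
    x absorb the lower-order terms.\<close>
  proof (cases "x < 4 / q")
    case True
    have "x + 1 \<le> 5 / q" using True q by (simp add: field_simps)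
    hence "(x + 1)\<^sup>2 \<le> (5 / q)\<^sup>2" using x by (intro power_mono) auto
    also have "\<dots> = \<kappa>" by (simp add: \<kappa>_def power_divide)
    also have "\<dots> \<le> \<kappa> * c" using \<kappa> c by simp
    finally have "x + 1 \<le> c * (\<kappa> / (x + 1))"
      using x by (simp add: le_divide_eq power2_eq_square mult.commute)
    hence "x + 1 + c \<le> c * (1 + \<kappa> / (x + 1))" by (simp add: algebra_simps)
    hence "1 / c * (x + 1 + c) \<le> 1 + \<kappa> / (x + 1)"
      using c by (simp only: times_divide_eq_left mult_1_left) (subst pos_divide_le_eq, auto simp: mult.commute)
    hence "1 / c \<le> (1 + \<kappa> / (x + 1)) / (x + 1 + c)"
      using c x by (subst pos_le_divide_eq) auto
    thus ?thesis using 1 by linarith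
  next
    case False
    have xq: "4 \<le> q * x" using False q by (simp add: field_simps)
    have xp: "0 < x" using xq q x by (metis mult_zero_right not_numeral_le_zero order_less_le)
    have "q / (x + c) + (1 - q) * miss_bound \<kappa> c a \<le> q / (x + c) + (1 - q) * ((1 + \<kappa> / x) / (x + c))"
      using q by (intro add_mono mult_left_mono) (auto simp: miss_bound_def x_def)
    also have "\<dots> = (1 + (1 - q) * \<kappa> / x) / (x + c)"
    proof -
      have "q + (1 - q) * (1 + \<kappa> / x) = 1 + (1 - q) * \<kappa> / x"
        by (simp add: algebra_simps diff_divide_distrib)
      thus ?thesis by (simp only: times_divide_eq_right add_divide_distrib[symmetric])
    qed
    also have "\<dots> \<le> (1 + \<kappa> / (x + 1)) / (x + 1 + c)"
    proof -
      have kq: "4 \<le> \<kappa> * q" 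
      proof -
        have "\<kappa> * q = 25 / q" using q by (simp add: \<kappa>_def power2_eq_square)
        thus ?thesis using q by (simp add: le_divide_eq)
      qed
      have "(x + 1 + c) * (x + (1 - q) * \<kappa>) * (x + 1) \<le> (x + c) * (x + 1 + \<kappa>) * x"
      proof -
        \<comment> \<open>The gain \<kappa> (q (x + 1) - 1) comes from the factor 1 - q, the loss
          from replacing x by x + 1.\<close>
        have "(x + c) * (x + 1 + \<kappa>) * x - (x + 1 + c) * (x + (1 - q) * \<kappa>) * (x + 1)
            = (x + c) * (\<kappa> * (q * (x + 1) - 1)) - (x + (1 - q) * \<kappa>) * (x + 1)"
          by (simp add: algebra_simps)
        moreover have "(x + (1 - q) * \<kappa>) * (x + 1) \<le> (x + c) * (\<kappa> * (q * (x + 1) - 1))"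
        proof -
          have "q * x / 2 \<le> q * (x + 1) - 1" using xq q by (simp add: algebra_simps)
          hence "\<kappa> * (q * x / 2) \<le> \<kappa> * (q * (x + 1) - 1)" using \<kappa> by (intro mult_left_mono) auto
          moreover have "x + (1 - q) * \<kappa> \<le> \<kappa> * (q * x / 2)"
          proof -
            have "\<kappa> * 4 \<le> \<kappa> * (q * x)" using \<kappa> xq by (intro mult_left_mono) auto
            moreover have "4 * x \<le> \<kappa> * q * x" using kq xp by (intro mult_right_mono) auto
            moreover have "0 \<le> q * \<kappa>" using q \<kappa> by simp
            ultimately show ?thesis by (simp add: algebra_simps)
          qed
          ultimately have "x + (1 - q) * \<kappa> \<le> \<kappa> * (q * (x + 1) - 1)" by linarith
          moreover have "0 \<le> x + (1 - q) * \<kappa>" using q \<kappa> x by simp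
          moreover have "x + 1 \<le> x + c" using c by simp
          ultimately show ?thesis using x by (subst mult.commute) (intro mult_mono, auto)
        qed
        ultimately show ?thesis by linarith
      qed
      hence "(x + (1 - q) * \<kappa>) / (x * (x + c)) \<le> (x + 1 + \<kappa>) / ((x + 1) * (x + 1 + c))"
        using xp c by (simp add: divide_simps mult_ac)
      moreover have "(1 + (1 - q) * \<kappa> / x) / (x + c) = (x + (1 - q) * \<kappa>) / (x * (x + c))"
        using xp by (simp add: divide_simps)
      moreover have "(1 + \<kappa> / (x + 1)) / (x + 1 + c) = (x + 1 + \<kappa>) / ((x + 1) * (x + 1 + c))"
        using xp by (simp add: divide_simps)
      ultimately show ?thesis by simp
    qed
    finally show ?thesis .
  qed
  show ?thesis using 1 2 unfolding \<kappa>_def[symmetric] by (simp add: miss_bound_def x_def ac_simps)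
qed

text \<open>A hit is the more favourable branch, so lowering the hit probability can only increase
  the recursive bound.\<close>

lemma miss_bound_ge: 
  assumes "1 \<le> c" "0 \<le> \<kappa>"
  shows "1 / (real a + c) \<le> miss_bound \<kappa> c a"
  using assms by (auto simp: miss_bound_def intro!: frac_le divide_right_mono)

text \<open>Follows the queue up to the first early hit. A rate of 0 stays 0 because rates never
  increase; any other rate is at least q.\<close>

lemma late_share_miss_bound:
  assumes q: "0 < q" "q \<le> 1" "\<And>M. hit_rate k L M = 0 \<or> q \<le> hit_rate k L M"
    and C: "finite I" "C \<subseteq> set zs" "C \<noteq> {}"
    and "set (ys @ zs) \<subseteq> I" "fresh (ys @ zs) M"
  shows "mean I L (\<lambda>\<sigma>. late_share ys C (hits k \<sigma> (ys @ zs) M))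
    \<le> ennreal (if hit_rate k L M = 0 then 0 else real (card C) * miss_bound (25 / q\<^sup>2) (real (card C)) (length ys))"
  using assms(7,8)
proof (induction ys arbitrary: M)
  case Nil
  show ?case by (simp add: late_share_def)
next
  case (Cons y ys)
  define c where "c = real (card C)"
  define a where "a = length ys"
  define \<kappa> where "\<kappa> = 25 / q\<^sup>2"
  define r where "r = hit_rate k L M"
  define B where "B = (if r = 0 then 0 else c * miss_bound \<kappa> c a)"
  have "0 < card C" using C by (meson card_gt_0_iff finite_set finite_subset)
  hence c: "1 \<le> c" by (simp add: c_def)
  have \<kappa>: "0 \<le> \<kappa>" by (simp add: \<kappa>_def)
  have mb: "1 / (real a + c) \<le> miss_bound \<kappa> c a" by (rule miss_bound_ge[OF c \<kappa>])
  have "0 \<le> 1 / (real a + c)" using c by simp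
  hence mb0: "0 \<le> miss_bound \<kappa> c a" using mb by linarith
  have sub: "set (y # (ys @ zs)) \<subseteq> I" "set (ys @ zs) \<subseteq> I" and fr: "fresh (y # (ys @ zs)) M"
    and fr': "fresh (y # ys @ zs) M"
    using Cons.prems by auto
  have y: "y \<notin> set (ys @ zs)" using fr by (auto simp: fresh_def)
  have step: "mean I L (\<lambda>\<sigma>. late_share (y # ys) C (hits k \<sigma> (y # (ys @ zs)) M))
      \<le> ennreal (hit_rate k L M * (c / (real a + c)) + (1 - hit_rate k L M) * B)"
  proof (rule nn_integral_step[OF C(1) sub(1) fr])
    show "mean I L (\<lambda>\<sigma>. late_share (y # ys) C (insert y (hits k \<sigma> (ys @ zs) M')))
        \<le> ennreal (c / (real a + c))" if "fresh (ys @ zs) M'" for M'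
      unfolding c_def a_def using late_share_hit[OF C(1) _ fr' C(2,3) that] sub by simp
    show "mean I L (\<lambda>\<sigma>. late_share (y # ys) C (hits k \<sigma> (ys @ zs) M')) \<le> ennreal B"
      if M': "fresh (ys @ zs) M'" "hit_rate k L M' \<le> hit_rate k L M" for M'
    proof -
      have "hit_rate k L M = 0 \<Longrightarrow> hit_rate k L M' = 0" using M'(2) hit_rate_bounds(1)[of k L M'] by linarith
      hence "(if hit_rate k L M' = 0 then 0 else c * miss_bound \<kappa> c a) \<le> B"
        unfolding B_def r_def using mb0 c by auto
      from order_trans[OF Cons.IH[OF sub(2) M'(1)] ennreal_leI[OF this[unfolded c_def \<kappa>_def a_def]]]
      show ?thesis unfolding late_share_skip[OF y hits_subset] .
    qed
  qed (use c mb0 in \<open>auto simp: B_def\<close>)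
  have bound: "hit_rate k L M * (c / (real a + c)) + (1 - hit_rate k L M) * B
      \<le> (if hit_rate k L M = 0 then 0 else c * miss_bound \<kappa> c (Suc a))"
  proof (cases "r = 0")
    case True thus ?thesis by (simp add: B_def r_def[symmetric])
  next
    case False
    hence rq: "q \<le> r" using q(3)[of M] by (simp add: r_def)
    have "r * (c / (real a + c)) + (1 - r) * B = c * (r * (1 / (real a + c)) + (1 - r) * miss_bound \<kappa> c a)"
      using False by (simp add: B_def algebra_simps)
    \<comment> \<open>By \<open>miss_bound_ge\<close> the mixture decreases in the hit probability,
      so r may be replaced by the smaller q.\<close>
    also have "\<dots> \<le> c * (q * (1 / (real a + c)) + (1 - q) * miss_bound \<kappa> c a)"
    proof (rule mult_left_mono)
      have "0 \<le> (r - q) * (miss_bound \<kappa> c a - 1 / (real a + c))" using rq mb by simp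
      thus "r * (1 / (real a + c)) + (1 - r) * miss_bound \<kappa> c a \<le> q * (1 / (real a + c)) + (1 - q) * miss_bound \<kappa> c a"
        by (simp only: algebra_simps)
    qed (use c in auto)
    also have "\<dots> \<le> c * miss_bound \<kappa> c (Suc a)"
      using miss_bound_step[OF q(1,2) c, of a] c unfolding \<kappa>_def by (intro mult_left_mono) auto
    finally show ?thesis using False by (simp add: r_def)
  qed
  show ?case
    using order_trans[OF step ennreal_leI[OF bound]]
    unfolding c_def \<kappa>_def a_def by (simp only: append_Cons length_Cons)
qed

lemma binexp_0_prob: "binexp N 0 h = h 0"
  by (induction N) auto

text \<open>While the rate is positive it is at least q, so a run of early misses has probability at
  most a power of 1 - q. If the rate has dropped to 0, late hits have probability 0, by binomial
  domination.\<close>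

lemma early_miss_bound:
  assumes q: "0 < q" "q \<le> 1" "\<And>M. hit_rate k L M = 0 \<or> q \<le> hit_rate k L M"
    and I: "finite I" and "set (ys @ zs) \<subseteq> I" "fresh (ys @ zs) M"
  shows "mean I L (\<lambda>\<sigma>. early_miss ys zs (hits k \<sigma> (ys @ zs) M))
    \<le> ennreal (if hit_rate k L M = 0 then 0 else (1 - q) ^ length ys)"
  using assms(5,6)
proof (induction ys arbitrary: M)
  case Nil
  show ?case
  proof (cases "hit_rate k L M = 0")
    case True
    define g :: "nat \<Rightarrow> real" where "g = (\<lambda>m. of_bool (0 < m))"
    have "early_miss [] zs H = g (card (set zs \<inter> H))" for H
      by (simp add: early_miss_def g_def card_gt_0_iff)
    moreover have "mean I L (\<lambda>\<sigma>. g (card (set zs \<inter> hits k \<sigma> zs M)))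
        \<le> ennreal (binexp (card (set zs \<inter> set zs)) (hit_rate k L M) g)"
      using Nil I by (intro hits_binomial_domination) (auto simp: g_def mono_def)
    ultimately show ?thesis using True by (simp add: binexp_0_prob) (simp add: g_def)
  next
    case False
    thus ?thesis using nn_integral_preference_law_le_1[OF early_miss_bounds(2)] by simp
  qed
next
  case (Cons y ys)
  define B where "B = (if hit_rate k L M = 0 then 0 else (1 - q) ^ length ys)"
  have B: "0 \<le> B" using q by (simp add: B_def)
  have sub: "set (y # (ys @ zs)) \<subseteq> I" "set (ys @ zs) \<subseteq> I" and fr: "fresh (y # (ys @ zs)) M"
    using Cons.prems by auto
  have y: "y \<notin> set (ys @ zs)" using fr by (auto simp: fresh_def)
  have "mean I L (\<lambda>\<sigma>. early_miss (y # ys) zs (hits k \<sigma> (y # (ys @ zs)) M))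
      \<le> ennreal (hit_rate k L M * 0 + (1 - hit_rate k L M) * B)"
  proof (rule nn_integral_step[OF I sub(1) fr _ B])
    show "mean I L (\<lambda>\<sigma>. early_miss (y # ys) zs (hits k \<sigma> (ys @ zs) M')) \<le> ennreal B"
      if M': "fresh (ys @ zs) M'" "hit_rate k L M' \<le> hit_rate k L M" for M'
    proof -
      have "hit_rate k L M = 0 \<Longrightarrow> hit_rate k L M' = 0" using M'(2) hit_rate_bounds(1)[of k L M'] by linarith
      hence "(if hit_rate k L M' = 0 then 0 else (1 - q) ^ length ys) \<le> B"
        unfolding B_def using q by auto
      from order_trans[OF Cons.IH[OF sub(2) M'(1)] ennreal_leI[OF this]]
      show ?thesis unfolding early_miss_skip[OF hits_not_in[OF y]] .
    qed
  qed (auto simp: early_miss_insert)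
  also have "hit_rate k L M * 0 + (1 - hit_rate k L M) * B
      \<le> (if hit_rate k L M = 0 then 0 else (1 - q) ^ length (y # ys))"
    using q(1,2) q(3)[of M] by (auto simp: B_def intro!: mult_right_mono)
  finally show ?case by (simp add: ennreal_leI)
qed

lemma first_choice_control_min_rate:
  assumes q: "0 < q" "q \<le> 1" "\<And>M. hit_rate k L M = 0 \<or> q \<le> hit_rate k L M"
  shows "first_choice_control k L n (25 / q\<^sup>2)"
  unfolding first_choice_control_def
proof (intro allI impI conjI)
  fix ys zs :: "nat list" assume d: "distinct (ys @ zs)" "set (ys @ zs) \<subseteq> {..<n}" "ys \<noteq> []"
  have fr: "fresh (ys @ zs) Map.empty" using d by (auto simp: fresh_def)
  define a where "a = real (length ys)"
  have a: "1 \<le> a" using d(3) by (simp add: a_def Suc_le_eq)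
  define \<kappa> where "\<kappa> = 25 / q\<^sup>2"
  have \<kappa>: "1 / q \<le> \<kappa>" "0 \<le> \<kappa>" using q by (auto simp: \<kappa>_def divide_simps power2_eq_square)
  {
    fix C assume C: "C \<subseteq> set zs" "C \<noteq> {}"
    have "mean {..<n} L (\<lambda>\<sigma>. late_share ys C (hits k \<sigma> (ys @ zs) Map.empty))
      \<le> ennreal (if hit_rate k L Map.empty = 0 then 0
          else real (card C) * miss_bound (25 / q\<^sup>2) (real (card C)) (length ys))"
      by (rule late_share_miss_bound[OF q _ C d(2) fr]) simp
    also have "\<dots> \<le> ennreal (real (card C) * ((1 + \<kappa> / a) / (a + real (card C))))"
    proof (rule ennreal_leI)
      have "real (card C) * miss_bound (25 / q\<^sup>2) (real (card C)) (length ys)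
          \<le> real (card C) * ((1 + \<kappa> / a) / (a + real (card C)))"
        unfolding miss_bound_def a_def \<kappa>_def by (intro mult_left_mono min.cobounded2) auto
      moreover have "0 \<le> real (card C) * ((1 + \<kappa> / a) / (a + real (card C)))"
        using \<kappa> a by (intro mult_nonneg_nonneg divide_nonneg_nonneg add_nonneg_nonneg) auto
      ultimately show "(if hit_rate k L Map.empty = 0 then 0
          else real (card C) * miss_bound (25 / q\<^sup>2) (real (card C)) (length ys))
          \<le> real (card C) * ((1 + \<kappa> / a) / (a + real (card C)))" by auto
    qed
    finally show "mean {..<n} L (\<lambda>\<sigma>. late_share ys C (hits k \<sigma> (ys @ zs) Map.empty))
         \<le> ennreal (real (card C) * (1 + (25 / q\<^sup>2) / real (length ys)) / (real (length ys) + real (card C)))"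
      by (simp add: \<kappa>_def a_def)
  }
  have "mean {..<n} L (\<lambda>\<sigma>. early_miss ys zs (hits k \<sigma> (ys @ zs) Map.empty))
      \<le> ennreal (if hit_rate k L Map.empty = 0 then 0 else (1 - q) ^ length ys)"
    by (rule early_miss_bound[OF q _ d(2) fr]) simp
  also have "\<dots> \<le> ennreal (\<kappa> / a)"
  proof (rule ennreal_leI)
    \<comment> \<open>Only a decay of order 1 / length is needed: exp (-q a) is at most 1 / (q a),
      and 1 / q is at most \<kappa>.\<close>
    have "(1 - q) ^ length ys \<le> exp (- q) ^ length ys"
      using q exp_ge_add_one_self[of "- q"] by (intro power_mono) auto
    also have "\<dots> = exp (real (length ys) * - q)" by (rule exp_of_nat_mult[symmetric])
    also have "\<dots> = 1 / exp (q * a)" by (simp add: a_def exp_minus inverse_eq_divide mult.commute)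
    also have "\<dots> \<le> 1 / (q * a)"
    proof (rule divide_left_mono)
      show "q * a \<le> exp (q * a)" using exp_ge_add_one_self[of "q * a"] by linarith
    qed (use q a in auto)
    also have "\<dots> = (1 / q) / a" by simp
    also have "\<dots> \<le> \<kappa> / a" using \<kappa> a by (intro divide_right_mono) auto
    finally show "(if hit_rate k L Map.empty = 0 then 0 else (1 - q) ^ length ys) \<le> \<kappa> / a"
      using \<kappa> a by simp
  qed
  finally show "mean {..<n} L (\<lambda>\<sigma>. early_miss ys zs (hits k \<sigma> (ys @ zs) Map.empty))
       \<le> ennreal ((25 / q\<^sup>2) / real (length ys))"
    by (simp add: \<kappa>_def a_def)
qed

text \<open>The rate is determined by the set of vacant institutions, so only finitely many values
  occur for given p and L, simultaneously for all capacities and assignments. The least positive one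
  is q; inserting 1 keeps the set nonempty.\<close>

lemma ex_min_hit_rate:
  assumes "set_pmf L \<subseteq> rankings p" "0 < p"
  obtains q where "0 < q" "q \<le> 1" "\<And>k M. hit_rate k L M = 0 \<or> q \<le> hit_rate k L M"
proof -
  define R where "R = (\<lambda>S. measure_pmf.prob L {s. hd s \<in> S}) ` Pow {..<p}"
  define q where "q = Min (insert 1 {r\<in>R. r \<noteq> 0})"
  have fin: "finite R" by (simp add: R_def)
  have "hit_rate k L M \<in> R" for k M
  proof -
    have "hit_rate k L M = measure_pmf.prob L {s. hd s \<in> {l\<in>{..<p}. vacant k M l}}"
      unfolding hit_rate_def
    proof (rule measure_pmf.finite_measure_eq_AE)
      show "AE s in measure_pmf L. s \<in> {s. vacant k M (hd s)} \<longleftrightarrow> s \<in> {s. hd s \<in> {l\<in>{..<p}. vacant k M l}}"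
        using hd_ranking(2)[OF _ assms(2)] assms(1) by (auto simp: AE_measure_pmf_iff)
    qed auto
    thus ?thesis
      unfolding R_def by (rule image_eqI[where x = "{l\<in>{..<p}. vacant k M l}"]) auto
  qed
  hence "hit_rate k L M = 0 \<or> q \<le> hit_rate k L M" for k M
    using fin by (auto simp: q_def intro!: Min_le)
  moreover have "q \<le> 1" using fin by (simp add: q_def)
  moreover have "0 < q"
    unfolding q_def using fin by (subst Min_gr_iff) (auto simp: R_def zero_less_measure_iff)
  ultimately show thesis using that by blast
qed

subsection \<open>First choices under the greedy algorithm\<close>

lemma fold_greedy_other: "x \<notin> set xs \<Longrightarrow> fold (greedy_step k \<sigma>) xs M x = M x"
proof (induction xs arbitrary: M)
  case (Cons y xs)
  thus ?case by (auto simp: greedy_step_def split: option.split)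
qed simp

text \<open>If the first choice is full, the candidate may still be placed, but never at that
  institution.\<close>

lemma greedy_step_hit:
  assumes "\<sigma> x \<noteq> []" "M x = None"
  shows "greedy_step k \<sigma> x M x = Some (hd (\<sigma> x)) \<longleftrightarrow> vacant k M (hd (\<sigma> x))"
proof -
  obtain l ls where s: "\<sigma> x = l # ls" using assms(1) by (cases "\<sigma> x") auto
  show ?thesis
  proof (cases "vacant k M l")
    case True thus ?thesis by (simp add: s greedy_step_def vacant_def)
  next
    case False
    have "find (\<lambda>l. card {i'. M i' = Some l} < k l) ls \<noteq> Some l"
      using False by (auto simp: find_Some_iff vacant_def)
    thus ?thesis using False assms(2)
      by (auto simp: s greedy_step_def vacant_def split: option.split)
  qed
qed

lemma fold_greedy_hits:
  assumes "fresh xs M" "x \<in> set xs" "\<And>x. x \<in> set xs \<Longrightarrow> \<sigma> x \<noteq> []"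
  shows "fold (greedy_step k \<sigma>) xs M x = Some (hd (\<sigma> x)) \<longleftrightarrow> x \<in> hits k \<sigma> xs M"
  using assms
proof (induction xs arbitrary: M)
  case (Cons y xs)
  have fr: "fresh xs (greedy_step k \<sigma> y M)" by (rule fresh_greedy_step[OF Cons.prems(1)])
  have y: "y \<notin> set xs" "M y = None" using Cons.prems(1) by (auto simp: fresh_def)
  show ?case
  proof (cases "x = y")
    case True
    have "fold (greedy_step k \<sigma>) (y # xs) M y = greedy_step k \<sigma> y M y"
      using y by (simp add: fold_greedy_other)
    moreover have "y \<in> hits k \<sigma> (y # xs) M \<longleftrightarrow> vacant k M (hd (\<sigma> y))"
      using hits_not_in[OF y(1)] by auto
    ultimately show ?thesis using greedy_step_hit[of \<sigma> y M k] Cons.prems(3) y True by simp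
  next
    case False
    thus ?thesis using Cons.IH[OF fr] Cons.prems by auto
  qed
qed simp

lemma hits_append:
  "hits k \<sigma> (xs @ ys) M = hits k \<sigma> xs M \<union> hits k \<sigma> ys (fold (greedy_step k \<sigma>) xs M)"
  by (induction xs arbitrary: M) auto

lemma ranking_set: "s \<in> rankings p \<Longrightarrow> set s = {..<p}"
  using permutations_of_setD(1) by (auto simp: rankings_def)

lemma hits_full:
  assumes "\<And>l. l < p \<Longrightarrow> \<not> vacant k M l" "\<And>x. x \<in> set xs \<Longrightarrow> \<sigma> x \<in> rankings p" "0 < p"
  shows "hits k \<sigma> xs M = {}"
  using assms(2)
proof (induction xs)
  case (Cons x xs)
  have x: "\<sigma> x \<in> rankings p" using Cons.prems by simp
  have "find (\<lambda>l. card {i'. M i' = Some l} < k l) (\<sigma> x) = None"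
    using assms(1) ranking_set[OF x] by (auto simp: find_None_iff vacant_def)
  hence "greedy_step k \<sigma> x M = M" by (simp add: greedy_step_def)
  thus ?case using Cons assms(1) hd_ranking(2)[OF x assms(3)] by simp
qed simp

lemma card_greedy_step:
  assumes "finite (dom M)" "x \<notin> dom M" "\<sigma> x \<in> rankings p"
    and "\<And>l. l < p \<Longrightarrow> card {i. M i = Some l} \<le> k l"
    and "(\<Sum>l<p. card {i. M i = Some l}) < total_capacity p k"
  defines "M' \<equiv> greedy_step k \<sigma> x M"
  shows "\<And>l. l < p \<Longrightarrow> card {i. M' i = Some l} \<le> k l"
    and "(\<Sum>l<p. card {i. M' i = Some l}) = Suc (\<Sum>l<p. card {i. M i = Some l})"
proof -
  obtain l0 where "l0 < p" "card {i. M i = Some l0} < k l0"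
    using assms(5) unfolding total_capacity_def by (metis lessThan_iff not_le sum_mono)
  hence "find (\<lambda>l. card {i'. M i' = Some l} < k l) (\<sigma> x) \<noteq> None"
    using ranking_set[OF assms(3)] by (auto simp: find_None_iff)
  then obtain l1 where l1: "find (\<lambda>l. card {i'. M i' = Some l} < k l) (\<sigma> x) = Some l1" by auto
  hence "card {i. M i = Some l1} < k l1" "l1 \<in> set (\<sigma> x)" by (auto simp: find_Some_iff)
  hence l1p: "card {i. M i = Some l1} < k l1" "l1 < p" using ranking_set[OF assms(3)] by auto
  have M': "M' = M(x \<mapsto> l1)" by (simp add: M'_def greedy_step_def l1)
  have "{i. M' i = Some l} = (if l = l1 then insert x {i. M i = Some l} else {i. M i = Some l})" for l
    using assms(2) by (auto simp: M')
  moreover have "finite {i. M i = Some l}" for l by (rule finite_subset[OF _ assms(1)]) auto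
  ultimately have c: "card {i. M' i = Some l} = card {i. M i = Some l} + of_bool (l = l1)" for l
    using assms(2) by (auto simp: domIff card_insert_if)
  show "card {i. M' i = Some l} \<le> k l" if "l < p" for l
    unfolding c using assms(4)[OF that] l1p by auto
  show "(\<Sum>l<p. card {i. M' i = Some l}) = Suc (\<Sum>l<p. card {i. M i = Some l})"
    unfolding c sum.distrib using l1p(2) by simp
qed

lemma fold_greedy_card:
  assumes "fresh xs M" "\<And>x. x \<in> set xs \<Longrightarrow> \<sigma> x \<in> rankings p"
    and "\<And>l. l < p \<Longrightarrow> card {i. M i = Some l} \<le> k l"
    and "(\<Sum>l<p. card {i. M i = Some l}) + length xs \<le> total_capacity p k"
  defines "M' \<equiv> fold (greedy_step k \<sigma>) xs M"
  shows "(\<forall>l<p. card {i. M' i = Some l} \<le> k l) \<and>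
    (\<Sum>l<p. card {i. M' i = Some l}) = (\<Sum>l<p. card {i. M i = Some l}) + length xs"
  using assms(1-4) unfolding M'_def
proof (induction xs arbitrary: M)
  case (Cons x xs)
  have *: "finite (dom M)" "x \<notin> dom M" "\<sigma> x \<in> rankings p"
    using Cons.prems(1,2) by (auto simp: fresh_def)
  have less: "(\<Sum>l<p. card {i. M i = Some l}) < total_capacity p k" using Cons.prems(4) by simp
  note step = card_greedy_step[where M = M and k = k and p = p and \<sigma> = \<sigma> and x = x, OF * Cons.prems(3) less]
  show ?case
    using Cons.IH[OF fresh_greedy_step[OF Cons.prems(1)]] Cons.prems(2,4) step by simp
qed simp

text \<open>Rankings list every institution, so each candidate takes a slot as long as one is left.
  After as many candidates as there are slots everything is full, and the rest of the queue obtains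
  nothing.\<close>

lemma first_choices_alg_st:
  assumes "\<And>i. i < n \<Longrightarrow> \<sigma> i \<in> rankings p" "0 < p" "total_capacity p k \<le> n" "G \<subseteq> {..<n}"
  shows "{i \<in> G. alg_st n k w \<sigma> i = Some (hd (\<sigma> i))}
    = G \<inter> hits k \<sigma> (take (total_capacity p k) (queue w n)) Map.empty"
proof -
  define xs ys where "xs = take (total_capacity p k) (queue w n)" and "ys = drop (total_capacity p k) (queue w n)"
  have q: "queue w n = xs @ ys" by (simp add: xs_def ys_def)
  have alg: "alg_st n k w \<sigma> = fold (greedy_step k \<sigma>) (queue w n) Map.empty"
    by (simp add: alg_st_def queue_def)
  have set_q: "set (queue w n) = {..<n}" by simp
  have sub: "set xs \<subseteq> {..<n}" "set ys \<subseteq> {..<n}"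
    using set_q unfolding q set_append by auto
  have fr: "fresh (queue w n) Map.empty" "fresh xs Map.empty"
    using queue_simps(2)[of w n] by (auto simp: fresh_def xs_def)
  have len: "length xs = total_capacity p k" using assms(3) by (simp add: xs_def)
  let ?M = "fold (greedy_step k \<sigma>) xs Map.empty"
  have full: "(\<forall>l<p. card {i. ?M i = Some l} \<le> k l)" "(\<Sum>l<p. card {i. ?M i = Some l}) = total_capacity p k"
    using fold_greedy_card[OF fr(2), of \<sigma> p k] assms(1) sub len by auto
  have "\<not> vacant k ?M l" if "l < p" for l
  proof
    assume "vacant k ?M l"
    hence "(\<Sum>l<p. card {i. ?M i = Some l}) < (\<Sum>l<p. k l)"
      using full(1) that by (intro sum_strict_mono_ex1) (auto simp: vacant_def)
    thus False using full(2) by (simp add: total_capacity_def)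
  qed
  hence "hits k \<sigma> ys ?M = {}" using assms(1,2) sub by (intro hits_full) auto
  hence "hits k \<sigma> (queue w n) Map.empty = hits k \<sigma> xs Map.empty"
    unfolding q hits_append by simp
  moreover have "alg_st n k w \<sigma> i = Some (hd (\<sigma> i)) \<longleftrightarrow> i \<in> hits k \<sigma> (queue w n) Map.empty" if "i < n" for i
    unfolding alg by (rule fold_greedy_hits[OF fr(1)]) (use that assms(1,2) hd_ranking(1) in auto)
  ultimately show ?thesis using assms(4) by (auto simp: xs_def)
qed

subsection \<open>Exchanging two candidates\<close>

text \<open>The procedure is equivariant under relabelling by an involution: it uses names of
  candidates only to look up lists and to record assignments.\<close>

lemma greedy_step_permute:
  assumes "\<And>x. \<pi> (\<pi> x) = x"
  shows "greedy_step k (\<sigma> \<circ> \<pi>) (\<pi> x) (M \<circ> \<pi>) = greedy_step k \<sigma> x M \<circ> \<pi>"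
    and "vacant k (M \<circ> \<pi>) = vacant k M"
proof -
  have inj: "inj \<pi>" using assms by (metis injI)
  have "{i. (M \<circ> \<pi>) i = Some l} = \<pi> ` {i. M i = Some l}" for l
  proof (intro set_eqI iffI)
    fix i assume "i \<in> {i. (M \<circ> \<pi>) i = Some l}"
    thus "i \<in> \<pi> ` {i. M i = Some l}" using assms[of i] by (intro image_eqI[of _ _ "\<pi> i"]) auto
  qed (auto simp: assms)
  hence c: "card {i. (M \<circ> \<pi>) i = Some l} = card {i. M i = Some l}" for l
    using inj by (simp add: card_image inj_on_subset)
  thus "vacant k (M \<circ> \<pi>) = vacant k M" by (simp add: vacant_def fun_eq_iff)
  have "(M \<circ> \<pi>)(\<pi> x \<mapsto> l) = M(x \<mapsto> l) \<circ> \<pi>" for l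
    using assms by (auto simp: fun_eq_iff)
  thus "greedy_step k (\<sigma> \<circ> \<pi>) (\<pi> x) (M \<circ> \<pi>) = greedy_step k \<sigma> x M \<circ> \<pi>"
    unfolding greedy_step_def c by (auto simp: assms split: option.split)
qed

lemma hits_permute:
  assumes "\<And>x. \<pi> (\<pi> x) = x"
  shows "hits k (\<sigma> \<circ> \<pi>) (map \<pi> xs) (M \<circ> \<pi>) = \<pi> ` hits k \<sigma> xs M"
proof (induction xs arbitrary: M)
  case (Cons x xs)
  show ?case
    unfolding list.map hits.simps greedy_step_permute[OF assms] Cons.IH
    by (auto simp: assms)
qed simp

text \<open>Injectivity matters because ties are broken by index, which a relabelling does not
  respect.\<close>

lemma queue_permute:
  assumes "\<And>x. \<pi> (\<pi> x) = x" "\<pi> ` {..<n} = {..<n}" "inj_on w {..<n}"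
  shows "queue (w \<circ> \<pi>) n = map \<pi> (queue w n)"
proof -
  have inj\<pi>: "inj \<pi>" using assms(1) by (metis injI)
  have sorted: "sorted (map (\<lambda>i. - w i) (queue w n))" for w by (simp add: queue_def)
  have "map (\<lambda>i. - (w \<circ> \<pi>) i) (queue (w \<circ> \<pi>) n) = map (\<lambda>i. - (w \<circ> \<pi>) i) (map \<pi> (queue w n))"
  proof (rule sorted_distinct_set_unique)
    show "sorted (map (\<lambda>i. - (w \<circ> \<pi>) i) (queue (w \<circ> \<pi>) n))" by (rule sorted)
    show "sorted (map (\<lambda>i. - (w \<circ> \<pi>) i) (map \<pi> (queue w n)))"
      using sorted[of w] by (simp add: comp_def assms(1))
    have "inj_on (\<lambda>i. - w i) {..<n}" using assms(3) by (auto simp: inj_on_def)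
    moreover have inj: "inj_on (\<lambda>i. - w (\<pi> i)) {..<n}"
    proof (rule inj_onI)
      fix x y assume "x \<in> {..<n}" "y \<in> {..<n}" "- w (\<pi> x) = - w (\<pi> y)"
      moreover have "\<pi> x \<in> {..<n}" "\<pi> y \<in> {..<n}" using calculation assms(2) by blast+
      ultimately have "\<pi> x = \<pi> y" using assms(3) by (auto dest: inj_onD)
      thus "x = y" using inj\<pi> by (auto dest: injD)
    qed
    ultimately show "distinct (map (\<lambda>i. - (w \<circ> \<pi>) i) (queue (w \<circ> \<pi>) n))"
      "distinct (map (\<lambda>i. - (w \<circ> \<pi>) i) (map \<pi> (queue w n)))"
      by (simp_all add: distinct_map comp_def assms(1))
    show "set (map (\<lambda>i. - (w \<circ> \<pi>) i) (queue (w \<circ> \<pi>) n)) = set (map (\<lambda>i. - (w \<circ> \<pi>) i) (map \<pi> (queue w n)))"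
      using assms(2) by (simp only: set_map queue_simps)
  qed
  moreover have "inj_on (\<lambda>i. - (w \<circ> \<pi>) i) (set (queue (w \<circ> \<pi>) n) \<union> set (map \<pi> (queue w n)))"
  proof -
    have "set (queue (w \<circ> \<pi>) n) \<union> set (map \<pi> (queue w n)) = {..<n}" using assms(2) by simp
    moreover have "inj_on (\<lambda>i. - (w \<circ> \<pi>) i) {..<n}"
    proof (rule inj_onI)
      fix x y assume "x \<in> {..<n}" "y \<in> {..<n}" "- (w \<circ> \<pi>) x = - (w \<circ> \<pi>) y"
      moreover have "\<pi> x \<in> {..<n}" "\<pi> y \<in> {..<n}" using calculation assms(2) by blast+
      ultimately have "\<pi> x = \<pi> y" using assms(3) by (auto dest: inj_onD)
      thus "x = y" using inj\<pi> by (auto dest: injD)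
    qed
    ultimately show ?thesis by simp
  qed
  ultimately show ?thesis by (rule map_inj_on)
qed

lemma nn_integral_preference_permute:
  assumes "\<pi> permutes {..<n}"
  shows "(\<integral>\<^sup>+\<sigma>. f (\<sigma> \<circ> \<pi>) \<partial>preference_law n L) = (\<integral>\<^sup>+\<sigma>. f \<sigma> \<partial>preference_law n L)"
proof -
  have \<pi>: "\<pi> i < n \<longleftrightarrow> i < n" for i using permutes_in_image[OF assms, of i] by simp
  let ?r = "\<lambda>\<sigma>. \<lambda>i\<in>{..<n}. \<sigma> (\<pi> i)"
  have d: "distr (preference_law n L) (preference_law n L) ?r = preference_law n L"
    by (rule distr_PiM_reindex[where M = "\<lambda>_. measure_pmf L"])
      (use assms in \<open>auto simp: measure_pmf.prob_space_axioms \<pi> intro: permutes_inj_on\<close>)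
  have "?r \<sigma> = \<sigma> \<circ> \<pi>" if "\<sigma> \<in> space (preference_law n L)" for \<sigma>
  proof
    fix x show "?r \<sigma> x = (\<sigma> \<circ> \<pi>) x"
      using that assms by (cases "x < n") (auto simp: space_PiM PiE_def extensional_def permutes_not_in)
  qed
  hence "(\<integral>\<^sup>+\<sigma>. f (\<sigma> \<circ> \<pi>) \<partial>preference_law n L) = (\<integral>\<^sup>+\<sigma>. f (?r \<sigma>) \<partial>preference_law n L)"
    by (intro nn_integral_cong) simp
  also have "\<dots> = (\<integral>\<^sup>+\<sigma>. f \<sigma> \<partial>distr (preference_law n L) (preference_law n L) ?r)"
  proof (rule nn_integral_distr[symmetric])
    show "?r \<in> preference_law n L \<rightarrow>\<^sub>M preference_law n L"
      by (intro measurable_restrict measurable_component_singleton) (simp add: \<pi>)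
  qed (simp add: measurable_preference_law)
  finally show ?thesis unfolding d .
qed

text \<open>The uniform law restricted to values at most \<beta> has mass \<beta>, and after
  normalisation it is the law of \<beta> times a uniform variable.\<close>

lemma nn_integral_unif_scale:
  assumes "0 < \<beta>" "\<beta> \<le> 1" and [measurable]: "g \<in> borel_measurable borel"
  shows "(\<integral>\<^sup>+b. g b * indicator {..\<beta>} b \<partial>unif) = ennreal \<beta> * (\<integral>\<^sup>+b. g (\<beta> * b) \<partial>unif)"
proof -
  have "(\<integral>\<^sup>+b. g b * indicator {..\<beta>} b \<partial>unif) = (\<integral>\<^sup>+b. g b * indicator {..\<beta>} b * indicator {0..1} b \<partial>lborel)"
    by (subst nn_integral_uniform_measure) (auto simp: divide_ennreal_def)
  also have "\<dots> = ennreal \<beta> * (\<integral>\<^sup>+b. g (\<beta> * b) * indicator {..\<beta>} (\<beta> * b) * indicator {0..1} (\<beta> * b) \<partial>lborel)"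
    using assms(1) by (subst nn_integral_real_affine[where c = \<beta> and t = 0]) auto
  also have "(\<integral>\<^sup>+b. g (\<beta> * b) * indicator {..\<beta>} (\<beta> * b) * indicator {0..1} (\<beta> * b) \<partial>lborel)
      = (\<integral>\<^sup>+b. g (\<beta> * b) * indicator {0..1} b \<partial>lborel)"
  proof (rule nn_integral_cong)
    fix b :: real
    have "b \<le> 1 \<Longrightarrow> \<beta> * b \<le> 1" using assms mult_mono[of \<beta> 1 b 1]
      by (cases "0 \<le> b") (auto intro: order_trans[OF mult_nonneg_nonpos])
    thus "g (\<beta> * b) * indicator {..\<beta>} (\<beta> * b) * indicator {0..1} (\<beta> * b) = g (\<beta> * b) * indicator {0..1} b"
      using assms by (auto simp: indicator_def zero_le_mult_iff)
  qed
  also have "\<dots> = (\<integral>\<^sup>+b. g (\<beta> * b) \<partial>unif)"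
    by (subst nn_integral_uniform_measure) (auto simp: divide_ennreal_def)
  finally show ?thesis .
qed

text \<open>Swaps the estimated utilities of i in the second group and j in the first. If u j is at
  most \<beta>, the new latent utility u j / \<beta> is admissible.\<close>

definition exchange :: "real \<Rightarrow> nat \<Rightarrow> nat \<Rightarrow> (nat \<Rightarrow> real) \<Rightarrow> nat \<Rightarrow> real" where
  "exchange \<beta> i j u = u(j := \<beta> * u i, i := u j / \<beta>)"

text \<open>Given that u j is at most \<beta>, the variables \<beta> u i and u j are independent and
  both uniform on [0, \<beta>], so swapping them preserves the law. The proof integrates these two
  coordinates innermost, rescales each and applies Fubini.\<close>

lemma nn_integral_exchange:
  assumes "i < n" "j < n" "i \<noteq> j" "0 < \<beta>" "\<beta> \<le> 1"
    and f: "f \<in> borel_measurable (utility_law n)"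
  shows "(\<integral>\<^sup>+u. f (exchange \<beta> i j u) * indicator {..\<beta>} (u j) \<partial>utility_law n)
    = (\<integral>\<^sup>+u. f u * indicator {..\<beta>} (u j) \<partial>utility_law n)"
proof -
  define J where "J = {..<n} - {i, j}"
  have J: "finite J" "j \<notin> J" "i \<notin> insert j J" "finite (insert j J)" using assms by (auto simp: J_def)
  have ins: "insert i (insert j J) = {..<n}" using assms by (auto simp: J_def)
  have two: "(\<integral>\<^sup>+u. h u \<partial>utility_law n)
      = (\<integral>\<^sup>+x. (\<integral>\<^sup>+b. (\<integral>\<^sup>+a. h (x(j := b, i := a)) \<partial>unif) \<partial>unif) \<partial>PiM J (\<lambda>_. unif))"
    if h: "h \<in> borel_measurable (utility_law n)" for h
  proof -
    have h': "h \<in> borel_measurable (PiM (insert i (insert j J)) (\<lambda>_. unif))" using h by (simp only: ins)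
    have "(\<integral>\<^sup>+u. h u \<partial>PiM (insert i (insert j J)) (\<lambda>_. unif))
        = (\<integral>\<^sup>+x. (\<integral>\<^sup>+a. h (x(i := a)) \<partial>unif) \<partial>PiM (insert j J) (\<lambda>_. unif))"
      by (rule utilities.product_nn_integral_insert[OF J(4,3) h'])
    also have "\<dots> = (\<integral>\<^sup>+x. (\<integral>\<^sup>+b. (\<integral>\<^sup>+a. h (x(j := b, i := a)) \<partial>unif) \<partial>unif) \<partial>PiM J (\<lambda>_. unif))"
    proof (rule utilities.product_nn_integral_insert[OF J(1,2)])
      have "(\<lambda>p. h ((fst p)(i := snd p))) \<in> borel_measurable (PiM (insert j J) (\<lambda>_. unif) \<Otimes>\<^sub>M unif)"
        using measurable_compose[OF measurable_add_dim h'] by (simp add: split_beta')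
      thus "(\<lambda>x. \<integral>\<^sup>+a. h (x(i := a)) \<partial>unif) \<in> borel_measurable (PiM (insert j J) (\<lambda>_. unif))"
        using unif.borel_measurable_nn_integral[of "\<lambda>x a. h (x(i := a))"] by (simp add: split_beta')
    qed
    finally show ?thesis by (simp only: ins)
  qed
  have [measurable]: "(\<lambda>u. u j) \<in> borel_measurable (utility_law n)" by (rule measurable_utility)
  have ex: "exchange \<beta> i j \<in> utility_law n \<rightarrow>\<^sub>M utility_law n"
  proof (rule measurable_PiM_single')
    fix l assume "l \<in> {..<n}"
    have "(\<lambda>u. u j / \<beta>) \<in> borel_measurable (utility_law n)"
      "(\<lambda>u. \<beta> * u i) \<in> borel_measurable (utility_law n)"
      by (auto intro!: borel_measurable_divide borel_measurable_times measurable_utility)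
    hence "(\<lambda>u. exchange \<beta> i j u l) \<in> borel_measurable (utility_law n)"
      unfolding exchange_def by (cases "l = i"; cases "l = j") (auto intro: measurable_utility)
    thus "(\<lambda>u. exchange \<beta> i j u l) \<in> utility_law n \<rightarrow>\<^sub>M unif"
      by (simp cong: measurable_cong_sets)
  qed (use assms in \<open>auto simp: exchange_def space_PiM PiE_def extensional_def\<close>)
  have fm: "(\<lambda>u. f (exchange \<beta> i j u)) \<in> borel_measurable (utility_law n)"
    by (rule measurable_compose[OF ex f])
  have m1: "(\<lambda>u. f u * indicator {..\<beta>} (u j)) \<in> borel_measurable (utility_law n)"
    and m2: "(\<lambda>u. f (exchange \<beta> i j u) * indicator {..\<beta>} (u j)) \<in> borel_measurable (utility_law n)"
    using f fm by measurable
  show ?thesis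
    unfolding two[OF m1] two[OF m2]
  proof (rule nn_integral_cong)
    fix x assume x: "x \<in> space (PiM J (\<lambda>_. unif))"
    define \<phi> where "\<phi> = (\<lambda>a b. f (x(j := b, i := a)))"
    have "(\<lambda>p. (x(j := snd p), fst p)) \<in> unif \<Otimes>\<^sub>M unif \<rightarrow>\<^sub>M PiM (insert j J) (\<lambda>_. unif) \<Otimes>\<^sub>M unif"
      by (intro measurable_Pair measurable_compose[OF measurable_snd measurable_component_update[OF x J(2)]] measurable_fst)
    from measurable_compose[OF this measurable_compose[OF measurable_add_dim, of f]]
    have \<phi>[measurable]: "(\<lambda>p. \<phi> (fst p) (snd p)) \<in> borel_measurable (borel \<Otimes>\<^sub>M borel)"
      using f by (simp add: ins \<phi>_def cong: measurable_cong_sets sets_pair_measure_cong)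
    have ps: "pair_sigma_finite unif unif"
      using unif.sigma_finite_measure_axioms by (simp add: pair_sigma_finite_def)
    interpret pair_sigma_finite unif unif by (rule ps)
    have m3: "(\<lambda>p. \<phi> (snd p) (\<beta> * fst p)) \<in> borel_measurable (unif \<Otimes>\<^sub>M unif)"
    proof -
      have "(\<lambda>p :: real \<times> real. (snd p, \<beta> * fst p)) \<in> borel \<Otimes>\<^sub>M borel \<rightarrow>\<^sub>M borel \<Otimes>\<^sub>M borel"
        by measurable
      from measurable_compose[OF this \<phi>] show ?thesis
        by (simp cong: measurable_cong_sets sets_pair_measure_cong)
    qed
    have meas: "(\<lambda>b. \<integral>\<^sup>+a. \<phi> a b \<partial>unif) \<in> borel_measurable borel" 
      "(\<lambda>b. \<integral>\<^sup>+a. \<phi> (b / \<beta>) (\<beta> * a) \<partial>unif) \<in> borel_measurable borel"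
    proof -
      have "(\<lambda>p :: real \<times> real. (snd p, fst p)) \<in> borel \<Otimes>\<^sub>M borel \<rightarrow>\<^sub>M borel \<Otimes>\<^sub>M borel"
        "(\<lambda>p :: real \<times> real. (fst p / \<beta>, \<beta> * snd p)) \<in> borel \<Otimes>\<^sub>M borel \<rightarrow>\<^sub>M borel \<Otimes>\<^sub>M borel"
        by measurable
      from this[THEN measurable_compose, OF \<phi>]
      have "(\<lambda>p. \<phi> (snd p) (fst p)) \<in> borel_measurable (borel \<Otimes>\<^sub>M unif)"
        "(\<lambda>p. \<phi> (fst p / \<beta>) (\<beta> * snd p)) \<in> borel_measurable (borel \<Otimes>\<^sub>M unif)"
        by (simp_all cong: measurable_cong_sets sets_pair_measure_cong)
      thus "(\<lambda>b. \<integral>\<^sup>+a. \<phi> a b \<partial>unif) \<in> borel_measurable borel"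
        "(\<lambda>b. \<integral>\<^sup>+a. \<phi> (b / \<beta>) (\<beta> * a) \<partial>unif) \<in> borel_measurable borel"
        using unif.borel_measurable_nn_integral[of "\<lambda>b a. \<phi> a b" borel]
          unif.borel_measurable_nn_integral[of "\<lambda>b a. \<phi> (b / \<beta>) (\<beta> * a)" borel]
        by (simp_all add: split_beta')
    qed
    have "(\<integral>\<^sup>+b. (\<integral>\<^sup>+a. f (exchange \<beta> i j (x(j := b, i := a))) * indicator {..\<beta>} ((x(j := b, i := a)) j) \<partial>unif) \<partial>unif)
        = (\<integral>\<^sup>+b. (\<integral>\<^sup>+a. \<phi> (b / \<beta>) (\<beta> * a) \<partial>unif) * indicator {..\<beta>} b \<partial>unif)"
    proof (rule nn_integral_cong)
      fix b show "(\<integral>\<^sup>+a. f (exchange \<beta> i j (x(j := b, i := a))) * indicator {..\<beta>} ((x(j := b, i := a)) j) \<partial>unif)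
          = (\<integral>\<^sup>+a. \<phi> (b / \<beta>) (\<beta> * a) \<partial>unif) * indicator {..\<beta>} b"
        using assms(3) by (cases "b \<le> \<beta>") (auto simp: \<phi>_def exchange_def fun_upd_twist)
    qed
    also have "\<dots> = ennreal \<beta> * (\<integral>\<^sup>+b. (\<integral>\<^sup>+a. \<phi> b (\<beta> * a) \<partial>unif) \<partial>unif)"
      using assms(4) by (subst nn_integral_unif_scale[OF assms(4,5) meas(2)]) simp
    also have "(\<integral>\<^sup>+b. (\<integral>\<^sup>+a. \<phi> b (\<beta> * a) \<partial>unif) \<partial>unif) = (\<integral>\<^sup>+a. (\<integral>\<^sup>+b. \<phi> b (\<beta> * a) \<partial>unif) \<partial>unif)"
      by (rule Fubini') (simp add: split_beta' m3)
    also have "ennreal \<beta> * \<dots> = (\<integral>\<^sup>+b. (\<integral>\<^sup>+a. \<phi> a b \<partial>unif) * indicator {..\<beta>} b \<partial>unif)"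
      by (subst nn_integral_unif_scale[OF assms(4,5) meas(1)]) simp
    also have "\<dots> = (\<integral>\<^sup>+b. (\<integral>\<^sup>+a. f (x(j := b, i := a)) * indicator {..\<beta>} ((x(j := b, i := a)) j) \<partial>unif) \<partial>unif)"
    proof (rule nn_integral_cong)
      fix b show "(\<integral>\<^sup>+a. \<phi> a b \<partial>unif) * indicator {..\<beta>} b
          = (\<integral>\<^sup>+a. f (x(j := b, i := a)) * indicator {..\<beta>} ((x(j := b, i := a)) j) \<partial>unif)"
        using assms(3) by (cases "b \<le> \<beta>") (auto simp: \<phi>_def)
    qed
    finally show "(\<integral>\<^sup>+b. (\<integral>\<^sup>+a. f (exchange \<beta> i j (x(j := b, i := a))) * indicator {..\<beta>} ((x(j := b, i := a)) j) \<partial>unif) \<partial>unif)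
        = (\<integral>\<^sup>+b. (\<integral>\<^sup>+a. f (x(j := b, i := a)) * indicator {..\<beta>} ((x(j := b, i := a)) j) \<partial>unif) \<partial>unif)" .
  qed
qed

subsection \<open>Preferences\<close>

lemma dropWhile_sorted_le:
  fixes w :: "nat \<Rightarrow> real"
  assumes "sorted (map (\<lambda>i. - w i) xs)" "x \<in> set (dropWhile (\<lambda>i. \<beta> < w i) xs)"
  shows "w x \<le> \<beta>"
  using assms by (induction xs) (auto split: if_splits)

context selection
begin

section \<open>Splitting the selected candidates at \<beta>\<close>

definition "sel u = take K (queue (est_utility G2 \<beta> u) n)"
text \<open>Members of the second group have estimated utility at most \<beta>, so the early part
  consists of first-group candidates; in the late part an exchange across the groups preserves the
  law.\<close>

definition "high u = takeWhile (\<lambda>i. \<beta> < est_utility G2 \<beta> u i) (sel u)"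
definition "low u = dropWhile (\<lambda>i. \<beta> < est_utility G2 \<beta> u i) (sel u)"

lemma sel_eq: "high u @ low u = sel u" by (simp add: high_def low_def)

lemma sel_simps: "distinct (sel u)" "set (sel u) \<subseteq> {..<n}" "card (set (sel u)) = K"
  using set_take_subset[of K "queue (est_utility G2 \<beta> u) n"] card_take_queue[OF K_le]
  by (auto simp: sel_def)

lemma high_low: "distinct (high u @ low u)" "set (high u @ low u) \<subseteq> {..<n}"
  unfolding sel_eq by (rule sel_simps)+

lemma in_high: "x \<in> set (high u) \<Longrightarrow> \<beta> < est_utility G2 \<beta> u x"
  by (auto simp: high_def dest: set_takeWhileD)

lemma in_low: 
  assumes "x \<in> set (low u)" shows "est_utility G2 \<beta> u x \<le> \<beta>"
proof (rule dropWhile_sorted_le)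
  have "sorted (map (\<lambda>i. - est_utility G2 \<beta> u i) (queue (est_utility G2 \<beta> u) n))"
    by (simp add: queue_def)
  thus "sorted (map (\<lambda>i. - est_utility G2 \<beta> u i) (sel u))"
    unfolding sel_def by (simp add: take_map[symmetric] sorted_wrt_take)
qed (use assms in \<open>simp add: low_def\<close>)

lemma est_utility_G2_le:
  assumes "\<And>i. i < n \<Longrightarrow> 0 \<le> u i \<and> u i \<le> 1" "i \<in> G2"
  shows "est_utility G2 \<beta> u i \<le> \<beta>"
proof -
  have "i < n" using assms(2) G by auto
  thus ?thesis using assms \<beta> by (simp add: est_utility_def mult_left_le)
qed

lemma high_subset_G1:
  assumes "\<And>i. i < n \<Longrightarrow> 0 \<le> u i \<and> u i \<le> 1"
  shows "set (high u) \<subseteq> G1" "G2 \<inter> set (high u) = {}"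
proof -
  show e: "G2 \<inter> set (high u) = {}"
    using in_high est_utility_G2_le[OF assms] by (meson disjoint_iff leD)
  have "set (high u) \<subseteq> G1 \<union> G2" using high_low(2)[of u] G(1) by auto
  thus "set (high u) \<subseteq> G1" using e by auto
qed

lemma measurable_takeWhile:
  fixes w :: "'a \<Rightarrow> nat \<Rightarrow> real"
  assumes [measurable]: "\<And>i. (\<lambda>u. w u i) \<in> borel_measurable M"
  shows "(\<lambda>u. takeWhile (\<lambda>i. b < w u i) xs) \<in> M \<rightarrow>\<^sub>M count_space UNIV"
proof (induction xs)
  case (Cons x xs)
  have [measurable]: "(\<lambda>u. x # takeWhile (\<lambda>i. b < w u i) xs) \<in> M \<rightarrow>\<^sub>M count_space UNIV"
    by (rule measurable_compose[OF Cons]) simp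
  show ?case unfolding takeWhile.simps by measurable
qed simp

lemma measurable_high: "high \<in> utility_law n \<rightarrow>\<^sub>M count_space UNIV"
proof -
  have "(\<lambda>u. takeWhile (\<lambda>i. \<beta> < est_utility G2 \<beta> u i) (take K xs)) \<in> utility_law n \<rightarrow>\<^sub>M count_space UNIV" for xs
    by (rule measurable_takeWhile[OF measurable_est_utility])
  from measurable_compose_countable[OF this measurable_queue[of G2 \<beta> n]]
  show ?thesis unfolding high_def[abs_def] sel_def .
qed

lemma measurable_low: "low \<in> utility_law n \<rightarrow>\<^sub>M count_space UNIV"
proof -
  have "low u = drop (length (high u)) (take K (queue (est_utility G2 \<beta> u) n))" for u
    using sel_eq[of u] by (metis append_eq_conv_conj sel_def)
  hence "low = (\<lambda>u. drop (length (high u)) (take K (queue (est_utility G2 \<beta> u) n)))" by blast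
  moreover have "(\<lambda>u. drop (length ys) (take K (queue (est_utility G2 \<beta> u) n))) \<in> utility_law n \<rightarrow>\<^sub>M count_space UNIV" for ys :: "nat list"
    by (rule measurable_compose[OF measurable_queue]) simp
  from measurable_compose_countable[OF this measurable_high]
  have "(\<lambda>u. drop (length (high u)) (take K (queue (est_utility G2 \<beta> u) n))) \<in> utility_law n \<rightarrow>\<^sub>M count_space UNIV" .
  ultimately show ?thesis by simp
qed

text \<open>An arbitrary f is allowed because the two lists range over a countable type and the
  preference space is discrete.\<close>

lemma measurable_joint:
  "(\<lambda>x. f (high (fst x)) (low (fst x)) (snd x)) \<in> borel_measurable (joint_law n L)"
proof -
  have "(\<lambda>x. f ys zs (snd x)) \<in> borel_measurable (joint_law n L)" for ys zs
    by (rule measurable_compose[OF measurable_snd measurable_preference_law]) simp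
  hence "(\<lambda>x. f ys (low (fst x)) (snd x)) \<in> borel_measurable (joint_law n L)" for ys
    by (rule measurable_compose_countable[OF _ measurable_compose[OF measurable_fst measurable_low]])
  thus ?thesis
    by (rule measurable_compose_countable[OF _ measurable_compose[OF measurable_fst measurable_high]])
qed

abbreviation "hit \<sigma> ys zs \<equiv> hits k \<sigma> (ys @ zs) Map.empty"
abbreviation "hit_at u \<sigma> \<equiv> hit \<sigma> (high u) (low u)"

lemma nn_integral_joint:
  "(\<integral>\<^sup>+x. f (high (fst x)) (low (fst x)) (snd x) \<partial>joint_law n L)
    = (\<integral>\<^sup>+u. (\<integral>\<^sup>+\<sigma>. f (high u) (low u) \<sigma> \<partial>preference_law n L) \<partial>utility_law n)"
  and measurable_inner: "(\<lambda>u. \<integral>\<^sup>+\<sigma>. f (high u) (low u) \<sigma> \<partial>preference_law n L) \<in> borel_measurable (utility_law n)"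
proof -
  interpret S: prob_space "preference_law n L" by (rule prob_space_preference_law)
  show "(\<integral>\<^sup>+x. f (high (fst x)) (low (fst x)) (snd x) \<partial>joint_law n L)
      = (\<integral>\<^sup>+u. (\<integral>\<^sup>+\<sigma>. f (high u) (low u) \<sigma> \<partial>preference_law n L) \<partial>utility_law n)"
    using S.nn_integral_fst[OF measurable_joint[of f]] by simp
  show "(\<lambda>u. \<integral>\<^sup>+\<sigma>. f (high u) (low u) \<sigma> \<partial>preference_law n L) \<in> borel_measurable (utility_law n)"
    using S.borel_measurable_nn_integral_fst[OF measurable_joint[of f]] by simp
qed

section \<open>The exchange argument\<close>

text \<open>The limiting proportion of second-group to first-group members among the selected
  candidates, with a margin; the 24 is derived in \<open>typical_if_good\<close>.\<close>

definition "\<tau> = (real n2 / real n1) * (\<rho> + 24 * (\<delta> / (\<eta>1 * \<eta>2)))"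

text \<open>Typicality depends on the early list and on the set of late candidates only, hence is
  unaffected by an exchange and constant in the preferences. The lower bound on the length turns
  \<kappa> / length into \<kappa> \<delta>, and the additional 1 matches the candidate i that is
  added to the late first-group candidates.\<close>

definition typical :: "nat list \<Rightarrow> nat list \<Rightarrow> real" where
  "typical ys zs = of_bool (2 * real n * \<delta> \<le> real (length ys) \<and>
     real (card (G2 \<inter> set zs)) \<le> \<tau> * (real (length ys) + real (card (G1 \<inter> set zs)) + 1))"

text \<open>
  For fixed \<open>i\<close>, the sum over \<open>j\<close> with \<open>x = i\<close> is the contribution of \<open>i\<close> to the ratio of the
  group counts, and with \<open>x = j\<close> it is a multiple of \<open>late_share\<close>; exchanging \<open>i\<close> and \<open>j\<close> maps each
  summand of the one to the corresponding summand of the other.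
\<close>

definition exchange_term :: "nat \<Rightarrow> nat \<Rightarrow> nat list \<Rightarrow> nat list \<Rightarrow> nat \<Rightarrow> nat set \<Rightarrow> real" where
  "exchange_term i j ys zs x H =
     of_bool (i \<in> set zs \<and> j \<in> insert i (G1 \<inter> set zs)) *
     (typical ys zs / (real (card (G1 \<inter> set zs)) + 1)) *
     (of_bool (x \<in> H \<and> set ys \<inter> H \<noteq> {}) /
       (real (card (set ys \<inter> H)) - 1 + real (card (insert i (G1 \<inter> set zs) \<inter> H))))"

lemma est_utility_exchange:
  assumes "i \<in> G2" "j \<in> G1"
  shows "est_utility G2 \<beta> (exchange \<beta> i j u) = est_utility G2 \<beta> u \<circ> Transposition.transpose i j"
proof -
  have "j \<notin> G2" "i \<noteq> j" using assms G(2) by auto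
  thus ?thesis
    using assms \<beta> by (auto simp: fun_eq_iff est_utility_def exchange_def Transposition.transpose_def)
qed

text \<open>Exchanging the utilities amounts to relabelling by the transposition of i and j, and
  composing \<sigma> with it relabels the preferences too. Both candidates lie at or below \<beta>,
  so the early list is unchanged and the hits are relabelled along.\<close>

lemma exchange_term_permute:
  fixes \<sigma> :: "nat \<Rightarrow> nat list"
  assumes u: "inj_on (est_utility G2 \<beta> u) {..<n}" "\<And>i. i < n \<Longrightarrow> 0 \<le> u i \<and> u i \<le> 1"
    and ij: "i \<in> G2" "j \<in> G1" "u j \<le> \<beta>"
  defines "\<pi> \<equiv> Transposition.transpose i j" and "u' \<equiv> exchange \<beta> i j u"
  shows "exchange_term i j (high u') (low u') i (hit (\<sigma> \<circ> \<pi>) (high u') (low u'))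
    = exchange_term i j (high u) (low u) j (hit_at u \<sigma>)"
proof -
  have jn: "j \<notin> G2" "i \<noteq> j" "i < n" "j < n" using ij G by auto
  have inv: "\<pi> (\<pi> x) = x" for x by (simp add: \<pi>_def)
  have inj: "inj \<pi>" using inv by (metis injI)
  have per: "\<pi> permutes {..<n}" unfolding \<pi>_def using jn by (intro permutes_swap_id) auto
  have im: "\<pi> ` {..<n} = {..<n}" using per by (rule permutes_image)
  let ?w = "est_utility G2 \<beta> u"
  have w': "est_utility G2 \<beta> u' = ?w \<circ> \<pi>"
    unfolding u'_def \<pi>_def by (rule est_utility_exchange[OF ij(1,2)])
  have lowij: "?w i \<le> \<beta>" "?w j \<le> \<beta>"
    using est_utility_G2_le[OF u(2) ij(1)] ij(3) jn by (auto simp: est_utility_def)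
  have notin: "i \<notin> set (high u)" "j \<notin> set (high u)" using in_high lowij by (meson leD)+
  have fixed: "\<pi> x = x" if "x \<in> set (high u)" for x
    using that notin unfolding \<pi>_def by (metis transpose_apply_other)
  have sel': "sel u' = map \<pi> (sel u)"
    unfolding sel_def w' queue_permute[OF inv im u(1)] by (simp add: take_map)
  have comp: "(\<lambda>x. \<beta> < (?w \<circ> \<pi>) x) \<circ> \<pi> = (\<lambda>x. \<beta> < ?w x)" by (auto simp: fun_eq_iff inv)
  have "high u' = map \<pi> (high u)"
    unfolding high_def sel' w' takeWhile_map comp ..
  also have "\<dots> = high u" using fixed by (simp add: map_idI)
  finally have high': "high u' = high u" .
  have low': "low u' = map \<pi> (low u)"
    unfolding low_def sel' w' dropWhile_map comp ..
  define ys zs where "ys = high u" and "zs = low u"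
  define H where "H = hit \<sigma> ys zs"
  have "high u' @ low u' = map \<pi> (ys @ zs)"
    unfolding high' low' ys_def zs_def using fixed by (simp add: map_idI)
  moreover have "hits k (\<sigma> \<circ> \<pi>) (map \<pi> (ys @ zs)) (Map.empty \<circ> \<pi>) = \<pi> ` hits k \<sigma> (ys @ zs) Map.empty"
    by (rule hits_permute[OF inv])
  moreover have "Map.empty \<circ> \<pi> = Map.empty" by (simp add: fun_eq_iff)
  ultimately have hit': "hit (\<sigma> \<circ> \<pi>) (high u') (low u') = \<pi> ` H" by (simp add: H_def)
  have mem: "x \<in> \<pi> ` A \<longleftrightarrow> \<pi> x \<in> A" for x A using inv by (metis image_iff)
  have pij: "\<pi> i = j" "\<pi> j = i" by (auto simp: \<pi>_def)
  have "x \<in> set ys \<inter> \<pi> ` H \<longleftrightarrow> x \<in> set ys \<inter> H" for x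
    using fixed[of x] unfolding Int_iff mem by (auto simp: ys_def)
  hence ysH: "set ys \<inter> \<pi> ` H = set ys \<inter> H" by blast
  show ?thesis
  proof (cases "i \<in> set zs \<and> j \<in> set zs")
    case True
    have zs': "set (low u') = set zs"
    proof -
      have "\<pi> x \<in> set zs \<longleftrightarrow> x \<in> set zs" for x
        using True unfolding \<pi>_def by (cases "x = i"; cases "x = j") auto
      thus ?thesis unfolding low' zs_def[symmetric] set_map using mem by auto
    qed
    let ?C = "insert i (G1 \<inter> set zs)"
    have "\<pi> x \<in> ?C \<longleftrightarrow> x \<in> ?C" for x
      using True ij unfolding \<pi>_def by (cases "x = i"; cases "x = j") auto
    hence "?C \<inter> \<pi> ` H = \<pi> ` (?C \<inter> H)" using mem by auto
    hence c: "card (?C \<inter> \<pi> ` H) = card (?C \<inter> H)"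
      using inj by (metis card_image inj_on_subset subset_UNIV)
    have i: "i \<in> \<pi> ` H \<longleftrightarrow> j \<in> H" by (simp add: mem pij)
    have t: "typical ys (low u') = typical ys zs" by (simp add: typical_def zs')
    have "exchange_term i j ys (low u') i (\<pi> ` H) = exchange_term i j ys zs j H"
      unfolding exchange_term_def zs' ysH c i t ..
    thus ?thesis
      unfolding hit' unfolding high' unfolding ys_def zs_def H_def .
  next
    case False
    \<comment> \<open>Unless both candidates are late, both terms vanish: i must be late, and j,
      being different from i, must be a late first-group candidate.\<close>
    have "\<not> (i \<in> set (low u') \<and> j \<in> set (low u'))"
      using False unfolding low' zs_def[symmetric] set_map mem pij by auto
    thus ?thesis using False jn unfolding zs_def exchange_term_def by auto
  qed
qed

text \<open>Invariance of the utilities under the exchange is combined with invariance of the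
  preference law under the transposition.\<close>

lemma nn_integral_exchange_term:
  assumes ij: "i \<in> G2" "j \<in> G1"
  shows "(\<integral>\<^sup>+x. ennreal (exchange_term i j (high (fst x)) (low (fst x)) i (hit_at (fst x) (snd x))) \<partial>joint_law n L)
    = (\<integral>\<^sup>+x. ennreal (exchange_term i j (high (fst x)) (low (fst x)) j (hit_at (fst x) (snd x))) \<partial>joint_law n L)"
proof -
  have jn: "j \<notin> G2" "i \<noteq> j" "i < n" "j < n" using ij G by auto
  define F where "F = (\<lambda>y u. \<integral>\<^sup>+\<sigma>. ennreal (exchange_term i j (high u) (low u) y (hit_at u \<sigma>)) \<partial>preference_law n L)"
  have meas: "F y \<in> borel_measurable (utility_law n)" for y
    unfolding F_def by (rule measurable_inner)
  have joint: "(\<integral>\<^sup>+x. ennreal (exchange_term i j (high (fst x)) (low (fst x)) y (hit_at (fst x) (snd x))) \<partial>joint_law n L)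
      = (\<integral>\<^sup>+u. F y u \<partial>utility_law n)" for y
    unfolding F_def by (rule nn_integral_joint)
  \<comment> \<open>The exchange preserves the law only where u j is at most \<beta>; elsewhere j is
    not late and the term is 0.\<close>
  have restrict: "F y u = F y u * indicator {..\<beta>} (u j)" for y u
  proof (cases "u j \<le> \<beta>")
    case False
    hence "j \<notin> set (low u)" using in_low[of j u] jn by (auto simp: est_utility_def)
    hence "exchange_term i j (high u) (low u) y H = 0" for H using jn by (simp add: exchange_term_def)
    thus ?thesis using False by (simp add: F_def)
  qed simp
  let ?\<pi> = "Transposition.transpose i j"
  have per: "?\<pi> permutes {..<n}" using jn by (intro permutes_swap_id) auto
  have "(\<integral>\<^sup>+u. F i u \<partial>utility_law n) = (\<integral>\<^sup>+u. F i (exchange \<beta> i j u) * indicator {..\<beta>} (u j) \<partial>utility_law n)"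
    by (subst restrict) (rule nn_integral_exchange[OF jn(3,4,2) \<beta> meas, symmetric])
  also have "\<dots> = (\<integral>\<^sup>+u. F j u * indicator {..\<beta>} (u j) \<partial>utility_law n)"
  proof (rule nn_integral_cong_AE)
    show "AE u in utility_law n. F i (exchange \<beta> i j u) * indicator {..\<beta>} (u j) = F j u * indicator {..\<beta>} (u j)"
      using AE_est_utility_inj[OF \<beta>(1), of G2 n] AE_utilities_range[of n]
    proof eventually_elim
      case (elim u)
      show ?case
      proof (cases "u j \<le> \<beta>")
        case True
        let ?u = "exchange \<beta> i j u"
        have range: "0 \<le> u i \<and> u i \<le> 1" if "i < n" for i using elim(2) that by (auto simp: less_imp_le)
        have "F i ?u = mean {..<n} L (\<lambda>\<sigma>. exchange_term i j (high ?u) (low ?u) i (hit (\<sigma> \<circ> ?\<pi>) (high ?u) (low ?u)))"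
          unfolding F_def by (rule nn_integral_preference_permute[OF per, symmetric])
        also have "\<dots> = F j u"
          unfolding F_def
          by (intro nn_integral_cong arg_cong[of _ _ ennreal] exchange_term_permute elim(1) range ij True)
        finally show ?thesis by simp
      qed simp
    qed
  qed
  also have "\<dots> = (\<integral>\<^sup>+u. F j u \<partial>utility_law n)" by (subst (2) restrict) simp
  finally show ?thesis unfolding joint .
qed

lemma sum_of_bool_mem: "finite A \<Longrightarrow> (\<Sum>j\<in>A. of_bool (j \<in> B)) = real (card (A \<inter> B))"
  by (simp add: Int_def)

lemma sum_exchange_own:
  assumes "i \<notin> G1"
  shows "(\<Sum>j\<in>insert i G1. exchange_term i j ys zs i H) = of_bool (i \<in> set zs) * typical ys zs *
    (of_bool (i \<in> H \<and> set ys \<inter> H \<noteq> {}) / (real (card (set ys \<inter> H)) - 1 + real (card (insert i (G1 \<inter> set zs) \<inter> H))))"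
proof -
  let ?C = "insert i (G1 \<inter> set zs)"
  have "(\<Sum>j\<in>insert i G1. of_bool (j \<in> ?C) :: real) = real (card (insert i G1 \<inter> ?C))"
    by (intro sum_of_bool_mem) (simp add: finite_G)
  also have "insert i G1 \<inter> ?C = ?C" by auto
  also have "real (card ?C) = real (card (G1 \<inter> set zs)) + 1" using assms finite_G by simp
  finally have c: "(\<Sum>j\<in>insert i G1. of_bool (j \<in> ?C) :: real) = real (card (G1 \<inter> set zs)) + 1" .
  have eq: "exchange_term i j ys zs i H = of_bool (j \<in> ?C) * (of_bool (i \<in> set zs) *
      (typical ys zs / (real (card (G1 \<inter> set zs)) + 1)) * (of_bool (i \<in> H \<and> set ys \<inter> H \<noteq> {}) /
      (real (card (set ys \<inter> H)) - 1 + real (card (?C \<inter> H)))))" for j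
    by (auto simp: exchange_term_def)
  have ne: "0 < real (card (G1 \<inter> set zs)) + 1" by (simp add: add_nonneg_pos)
  show ?thesis unfolding eq sum_distrib_right[symmetric] c using ne by simp
qed

lemma sum_exchange_all:
  assumes "i \<notin> G1"
  shows "(\<Sum>j\<in>insert i G1. exchange_term i j ys zs j H) = of_bool (i \<in> set zs) *
    (typical ys zs / (real (card (G1 \<inter> set zs)) + 1)) * late_share ys (insert i (G1 \<inter> set zs)) H"
proof -
  let ?C = "insert i (G1 \<inter> set zs)"
  define A where "A = of_bool (i \<in> set zs) * (typical ys zs / (real (card (G1 \<inter> set zs)) + 1))"
  define D where "D = real (card (set ys \<inter> H)) - 1 + real (card (?C \<inter> H))"
  have "(\<Sum>j\<in>insert i G1. of_bool (j \<in> ?C \<inter> H) :: real) = real (card (insert i G1 \<inter> (?C \<inter> H)))"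
    by (intro sum_of_bool_mem) (simp add: finite_G)
  also have "insert i G1 \<inter> (?C \<inter> H) = ?C \<inter> H" by auto
  finally have c: "(\<Sum>j\<in>insert i G1. of_bool (j \<in> ?C \<inter> H) :: real) = real (card (?C \<inter> H))" .
  have eq: "exchange_term i j ys zs j H = of_bool (j \<in> ?C \<inter> H) * (A * of_bool (set ys \<inter> H \<noteq> {}) / D)" for j
    by (auto simp: exchange_term_def A_def D_def)
  have "(\<Sum>j\<in>insert i G1. exchange_term i j ys zs j H) = real (card (?C \<inter> H)) * (A * of_bool (set ys \<inter> H \<noteq> {}) / D)"
    unfolding eq sum_distrib_right[symmetric] c ..
  also have "\<dots> = A * late_share ys ?C H" by (simp add: late_share_def D_def)
  finally show ?thesis by (simp add: A_def)
qed

definition hit_ratio :: "nat list \<Rightarrow> nat list \<Rightarrow> nat set \<Rightarrow> real" where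
  "hit_ratio ys zs H = typical ys zs * (of_bool (set ys \<inter> H \<noteq> {}) * real (card (G2 \<inter> set zs \<inter> H)) /
     (real (card (set ys \<inter> H)) + real (card (G1 \<inter> set zs \<inter> H))))"

text \<open>If i is a hit, it counts once in the enlarged late set, which cancels the subtracted 1.
  The denominator is then the number of first-group hits.\<close>

lemma hit_ratio_eq: "hit_ratio ys zs H = (\<Sum>i\<in>G2. \<Sum>j\<in>insert i G1. exchange_term i j ys zs i H)"
proof -
  define A where "A = typical ys zs * of_bool (set ys \<inter> H \<noteq> {}) / (real (card (set ys \<inter> H)) + real (card (G1 \<inter> set zs \<inter> H)))"
  have "(\<Sum>j\<in>insert i G1. exchange_term i j ys zs i H) = of_bool (i \<in> set zs \<inter> H) * A" if "i \<in> G2" for i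
  proof -
    have i: "i \<notin> G1" using that G(2) by auto
    have "card (insert i (G1 \<inter> set zs) \<inter> H) = Suc (card (G1 \<inter> set zs \<inter> H))" if "i \<in> H"
      using that i finite_G by simp
    thus ?thesis unfolding sum_exchange_own[OF i] by (auto simp: A_def)
  qed
  hence "(\<Sum>i\<in>G2. \<Sum>j\<in>insert i G1. exchange_term i j ys zs i H) = (\<Sum>i\<in>G2. of_bool (i \<in> set zs \<inter> H) * A)"
    by (intro sum.cong) auto
  also have "\<dots> = (\<Sum>i\<in>G2. of_bool (i \<in> set zs \<inter> H)) * A" by (rule sum_distrib_right[symmetric])
  also have "(\<Sum>i\<in>G2. of_bool (i \<in> set zs \<inter> H) :: real) = real (card (G2 \<inter> (set zs \<inter> H)))"
    using sum_of_bool_mem[OF finite_G(2)] .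
  finally show ?thesis by (simp add: hit_ratio_def A_def Int_assoc)
qed

lemma typical_cases: "typical ys zs = 0 \<or> (typical ys zs = 1 \<and> 2 * real n * \<delta> \<le> real (length ys) \<and>
     real (card (G2 \<inter> set zs)) \<le> \<tau> * (real (length ys) + real (card (G1 \<inter> set zs)) + 1))"
  by (auto simp: typical_def)

text \<open>The second bound is n \<delta>^2 = ln n, which is at least 1/2 for n at least 2; this is
  where the length 2 n \<delta> comes from.\<close>

lemma n\<delta>: "1 \<le> real n * \<delta>" "1 / (2 * real n * \<delta>) \<le> \<delta>"
proof -
  show 1: "1 \<le> real n * \<delta>" using inverse_n_le n_pos by (simp add: divide_le_eq mult.commute)
  have "1 \<le> (real n * \<delta>) * (real n * \<delta>)" using mult_mono[OF 1 1] 1 by simp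
  have "1/2 \<le> ln (2::real)" using ln2_ge_two_thirds by simp
  also have "ln 2 \<le> ln (real n)" using n_ge_2 by simp
  finally have l: "1/2 \<le> ln (real n)" .
  have "(real n * \<delta>) * \<delta> = ln (real n)"
  proof -
    have "\<delta> * \<delta> = ln (real n) / real n" using n_ge_2 by (simp add: \<delta>_def)
    thus ?thesis using n_pos by (simp add: mult.assoc)
  qed
  hence "1 \<le> \<delta> * (2 * real n * \<delta>)" using l by (simp add: mult_ac)
  thus "1 / (2 * real n * \<delta>) \<le> \<delta>" using 1 by (subst pos_divide_le_eq) auto
qed

lemma exchange_term_nonneg: "0 \<le> exchange_term i j ys zs x H"
proof (cases "set ys \<inter> H = {}")
  case False
  hence "1 \<le> card (set ys \<inter> H)" by (simp add: Suc_le_eq card_gt_0_iff)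
  hence "0 \<le> real (card (set ys \<inter> H)) - 1" by simp
  thus ?thesis unfolding exchange_term_def typical_def by (intro mult_nonneg_nonneg divide_nonneg_nonneg) auto
qed (simp add: exchange_term_def)

lemma \<tau>_nonneg: "0 \<le> \<tau>"
  unfolding \<tau>_def using alpha(9) \<delta>_pos \<eta> by (intro mult_nonneg_nonneg add_nonneg_nonneg) auto

lemma late_share_inner:
  assumes "first_choice_control k L n \<kappa>" "0 \<le> \<kappa>" "i \<in> G2"
  shows "mean {..<n} L (\<lambda>\<sigma>. \<Sum>j\<in>insert i G1. exchange_term i j (high u) (low u) j (hit_at u \<sigma>))
    \<le> ennreal (of_bool (i \<in> set (low u)) * typical (high u) (low u) * ((1 + \<kappa> * \<delta>) /
        (real (length (high u)) + real (card (G1 \<inter> set (low u))) + 1)))"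
proof -
  have i: "i \<notin> G1" using assms(3) G(2) by auto
  define ys zs where "ys = high u" and "zs = low u"
  define C where "C = insert i (G1 \<inter> set zs)"
  define c where "c = real (card (G1 \<inter> set zs)) + 1"
  define A where "A = of_bool (i \<in> set zs) * (typical ys zs / c)"
  have c: "real (card C) = c" "0 < c" using i finite_G by (auto simp: C_def c_def)
  have A: "0 \<le> A" using c by (simp add: A_def typical_def)
  have eq: "(\<Sum>j\<in>insert i G1. exchange_term i j ys zs j H) = A * late_share ys C H" for H
    unfolding sum_exchange_all[OF i] A_def C_def c_def ..
  have "mean {..<n} L (\<lambda>\<sigma>. \<Sum>j\<in>insert i G1. exchange_term i j ys zs j (hit \<sigma> ys zs))
      = (\<integral>\<^sup>+\<sigma>. ennreal A * ennreal (late_share ys C (hit \<sigma> ys zs)) \<partial>preference_law n L)"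
    by (simp only: eq ennreal_mult'[OF A])
  also have "\<dots> = ennreal A * mean {..<n} L (\<lambda>\<sigma>. late_share ys C (hit \<sigma> ys zs))"
    by (intro nn_integral_cmult measurable_preference_law) simp
  also have "\<dots> \<le> ennreal (of_bool (i \<in> set zs) * typical ys zs * ((1 + \<kappa> * \<delta>) / (real (length ys) + c)))"
  proof (cases "A = 0")
    case False
    hence iz: "i \<in> set zs" and t: "typical ys zs = 1" "2 * real n * \<delta> \<le> real (length ys)"
      using typical_cases[of ys zs] by (auto simp: A_def)
    have len: "0 < 2 * real n * \<delta>" using n_pos \<delta>_pos by simp
    hence "ys \<noteq> []" using t(2) by auto
    moreover have "C \<subseteq> set zs" "C \<noteq> {}" using iz by (auto simp: C_def)
    ultimately have "mean {..<n} L (\<lambda>\<sigma>. late_share ys C (hit \<sigma> ys zs))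
        \<le> ennreal (real (card C) * (1 + \<kappa> / real (length ys)) / (real (length ys) + real (card C)))"
      using assms(1) high_low[of u] unfolding first_choice_control_def ys_def zs_def by blast
    also have "\<dots> \<le> ennreal (c * ((1 + \<kappa> * \<delta>) / (real (length ys) + c)))"
    proof (rule ennreal_leI)
      have "\<kappa> / real (length ys) \<le> \<kappa> / (2 * real n * \<delta>)"
        using len t(2) assms(2) by (intro frac_le) auto
      also have "\<dots> = \<kappa> * (1 / (2 * real n * \<delta>))" by simp
      also have "\<dots> \<le> \<kappa> * \<delta>" using n\<delta>(2) assms(2) by (intro mult_left_mono)
      finally have "c * (1 + \<kappa> / real (length ys)) / (real (length ys) + c) \<le> c * (1 + \<kappa> * \<delta>) / (real (length ys) + c)"
        using c by (intro divide_right_mono mult_left_mono) auto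
      thus "real (card C) * (1 + \<kappa> / real (length ys)) / (real (length ys) + real (card C))
          \<le> c * ((1 + \<kappa> * \<delta>) / (real (length ys) + c))" by (simp add: c)
    qed
    finally have "ennreal A * mean {..<n} L (\<lambda>\<sigma>. late_share ys C (hit \<sigma> ys zs))
        \<le> ennreal A * ennreal (c * ((1 + \<kappa> * \<delta>) / (real (length ys) + c)))"
      by (rule mult_left_mono) simp
    also have "\<dots> = ennreal (A * (c * ((1 + \<kappa> * \<delta>) / (real (length ys) + c))))"
      using A by (rule ennreal_mult'[symmetric])
    also have "A * (c * ((1 + \<kappa> * \<delta>) / (real (length ys) + c))) = (1 + \<kappa> * \<delta>) / (real (length ys) + c)"
      using iz t c by (simp add: A_def)
    finally show ?thesis using iz t by simp
  qed simp
  finally show ?thesis by (simp add: ys_def zs_def c_def add.assoc)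
qed

text \<open>After the summandwise exchange, each late second-group candidate contributes at most (1
  + \<kappa> \<delta>) / D, with D the number of selected first-group candidates plus one.
  Typicality bounds the number of such contributions by \<tau> D. Since the exchange mixes
  utilities, it must precede the conditioning on u.\<close>

lemma expected_hit_ratio:
  assumes "first_choice_control k L n \<kappa>" "0 \<le> \<kappa>"
  shows "(\<integral>\<^sup>+x. ennreal (hit_ratio (high (fst x)) (low (fst x)) (hit_at (fst x) (snd x))) \<partial>joint_law n L)
    \<le> ennreal (\<tau> * (1 + \<kappa> * \<delta>))"
proof -
  interpret U: prob_space "utility_law n" by (rule prob_space_utility_law)
  define E where "E = (\<lambda>i j y x. exchange_term i j (high (fst x)) (low (fst x)) y (hit_at (fst x) (snd x)))"
  have meas: "(\<lambda>x. ennreal (E i j y x)) \<in> borel_measurable (joint_law n L)" for i j y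
    unfolding E_def by (rule measurable_joint)
  have nonneg: "0 \<le> E i j y x" for i j y x unfolding E_def by (rule exchange_term_nonneg)
  have swap: "(\<integral>\<^sup>+x. ennreal (E i j i x) \<partial>joint_law n L) = (\<integral>\<^sup>+x. ennreal (E i j j x) \<partial>joint_law n L)"
    if "i \<in> G2" "j \<in> insert i G1" for i j
    using that nn_integral_exchange_term[of i j] unfolding E_def by auto
  have eq: "ennreal (hit_ratio (high (fst x)) (low (fst x)) (hit_at (fst x) (snd x)))
      = (\<Sum>i\<in>G2. \<Sum>j\<in>insert i G1. ennreal (E i j i x))" for x
    unfolding hit_ratio_eq E_def by (simp only: sum_ennreal sum_nonneg exchange_term_nonneg)
  have "(\<integral>\<^sup>+x. ennreal (hit_ratio (high (fst x)) (low (fst x)) (hit_at (fst x) (snd x))) \<partial>joint_law n L)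
      = (\<integral>\<^sup>+x. (\<Sum>i\<in>G2. \<Sum>j\<in>insert i G1. ennreal (E i j i x)) \<partial>joint_law n L)"
    unfolding eq ..
  also have "\<dots> = (\<Sum>i\<in>G2. \<Sum>j\<in>insert i G1. (\<integral>\<^sup>+x. ennreal (E i j i x) \<partial>joint_law n L))"
    using meas by (subst nn_integral_sum, simp, intro sum.cong refl nn_integral_sum) auto
  also have "\<dots> = (\<Sum>i\<in>G2. \<Sum>j\<in>insert i G1. (\<integral>\<^sup>+x. ennreal (E i j j x) \<partial>joint_law n L))"
    by (intro sum.cong refl swap)
  also have "\<dots> = (\<integral>\<^sup>+x. (\<Sum>i\<in>G2. \<Sum>j\<in>insert i G1. ennreal (E i j j x)) \<partial>joint_law n L)"
    using meas by (subst nn_integral_sum, simp, intro sum.cong refl nn_integral_sum[symmetric]) auto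
  also have "\<dots> = (\<integral>\<^sup>+u. (\<integral>\<^sup>+\<sigma>. (\<Sum>i\<in>G2. \<Sum>j\<in>insert i G1. ennreal (exchange_term i j (high u) (low u) j (hit_at u \<sigma>)))
      \<partial>preference_law n L) \<partial>utility_law n)"
    unfolding E_def by (rule nn_integral_joint)
  also have "\<dots> \<le> (\<integral>\<^sup>+u. ennreal (\<tau> * (1 + \<kappa> * \<delta>)) \<partial>utility_law n)"
  proof (rule nn_integral_mono)
    fix u
    define D where "D = real (length (high u)) + real (card (G1 \<inter> set (low u))) + 1"
    have "0 \<le> \<kappa> * \<delta>" using assms(2) \<delta>_pos by simp
    hence k: "0 \<le> (1 + \<kappa> * \<delta>) / D" "0 \<le> 1 + \<kappa> * \<delta>" by (auto simp: D_def)
    have "(\<integral>\<^sup>+\<sigma>. (\<Sum>i\<in>G2. \<Sum>j\<in>insert i G1. ennreal (exchange_term i j (high u) (low u) j (hit_at u \<sigma>))) \<partial>preference_law n L)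
        = (\<Sum>i\<in>G2. mean {..<n} L (\<lambda>\<sigma>. \<Sum>j\<in>insert i G1. exchange_term i j (high u) (low u) j (hit_at u \<sigma>)))"
      by (subst nn_integral_sum[OF measurable_preference_law]) (simp_all add: sum_ennreal exchange_term_nonneg)
    also have "\<dots> \<le> (\<Sum>i\<in>G2. ennreal (of_bool (i \<in> set (low u)) * typical (high u) (low u) * ((1 + \<kappa> * \<delta>) / D)))"
      unfolding D_def by (intro sum_mono late_share_inner assms)
    also have "\<dots> = ennreal (\<Sum>i\<in>G2. of_bool (i \<in> set (low u)) * (typical (high u) (low u) * ((1 + \<kappa> * \<delta>) / D)))"
      using k by (subst sum_ennreal) (auto simp: typical_def mult.assoc)
    also have "(\<Sum>i\<in>G2. of_bool (i \<in> set (low u)) * (typical (high u) (low u) * ((1 + \<kappa> * \<delta>) / D)))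
        = real (card (G2 \<inter> set (low u))) * (typical (high u) (low u) * ((1 + \<kappa> * \<delta>) / D))"
      unfolding sum_distrib_right[symmetric] sum_of_bool_mem[OF finite_G(2)] ..
    also have "ennreal \<dots> \<le> ennreal (\<tau> * (1 + \<kappa> * \<delta>))"
    proof (rule ennreal_leI)
      show "real (card (G2 \<inter> set (low u))) * (typical (high u) (low u) * ((1 + \<kappa> * \<delta>) / D)) \<le> \<tau> * (1 + \<kappa> * \<delta>)"
      proof (cases "typical (high u) (low u) = 0")
        case True thus ?thesis using \<tau>_nonneg k by simp
      next
        case False
        hence t: "typical (high u) (low u) = 1" "real (card (G2 \<inter> set (low u))) \<le> \<tau> * D"
          using typical_cases[of "high u" "low u"] by (auto simp: D_def)
        have "0 < D" by (simp add: D_def add_nonneg_pos)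
        have "real (card (G2 \<inter> set (low u))) * ((1 + \<kappa> * \<delta>) / D) \<le> (\<tau> * D) * ((1 + \<kappa> * \<delta>) / D)"
          using t(2) k by (intro mult_right_mono)
        thus ?thesis using t(1) \<open>0 < D\<close> by simp
      qed
    qed
    finally show "(\<integral>\<^sup>+\<sigma>. (\<Sum>i\<in>G2. \<Sum>j\<in>insert i G1. ennreal (exchange_term i j (high u) (low u) j (hit_at u \<sigma>))) \<partial>preference_law n L)
      \<le> ennreal (\<tau> * (1 + \<kappa> * \<delta>))" .
  qed
  also have "\<dots> = ennreal (\<tau> * (1 + \<kappa> * \<delta>))" by (simp add: U.emeasure_space_1)
  finally show ?thesis .
qed

lemma expected_early_miss:
  assumes "first_choice_control k L n \<kappa>" "0 \<le> \<kappa>"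
  shows "(\<integral>\<^sup>+x. ennreal (typical (high (fst x)) (low (fst x)) *
      early_miss (high (fst x)) (low (fst x)) (hit_at (fst x) (snd x))) \<partial>joint_law n L)
    \<le> ennreal (\<kappa> * \<delta>)"
proof -
  interpret U: prob_space "utility_law n" by (rule prob_space_utility_law)
  have "(\<integral>\<^sup>+x. ennreal (typical (high (fst x)) (low (fst x)) *
      early_miss (high (fst x)) (low (fst x)) (hit_at (fst x) (snd x))) \<partial>joint_law n L)
    = (\<integral>\<^sup>+u. mean {..<n} L (\<lambda>\<sigma>. typical (high u) (low u) * early_miss (high u) (low u) (hit_at u \<sigma>)) \<partial>utility_law n)"
    by (rule nn_integral_joint)
  also have "\<dots> \<le> (\<integral>\<^sup>+u. ennreal (\<kappa> * \<delta>) \<partial>utility_law n)"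
  proof (rule nn_integral_mono)
    fix u
    show "mean {..<n} L (\<lambda>\<sigma>. typical (high u) (low u) * early_miss (high u) (low u) (hit_at u \<sigma>))
      \<le> ennreal (\<kappa> * \<delta>)"
    proof (cases "typical (high u) (low u) = 0")
      case False
      hence t: "typical (high u) (low u) = 1" "2 * real n * \<delta> \<le> real (length (high u))"
        using typical_cases[of "high u" "low u"] by auto
      have len: "0 < 2 * real n * \<delta>" using n_pos \<delta>_pos by simp
      hence "high u \<noteq> []" using t(2) by auto
      hence "mean {..<n} L (\<lambda>\<sigma>. early_miss (high u) (low u) (hit_at u \<sigma>))
          \<le> ennreal (\<kappa> / real (length (high u)))"
        using assms(1) high_low[of u] unfolding first_choice_control_def by blast
      also have "\<dots> \<le> ennreal (\<kappa> * \<delta>)"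
      proof (rule ennreal_leI)
        have "\<kappa> / real (length (high u)) \<le> \<kappa> / (2 * real n * \<delta>)"
          using len t(2) assms(2) by (intro frac_le) auto
        also have "\<dots> = \<kappa> * (1 / (2 * real n * \<delta>))" by simp
        also have "\<dots> \<le> \<kappa> * \<delta>" using n\<delta>(2) assms(2) by (intro mult_left_mono)
        finally show "\<kappa> / real (length (high u)) \<le> \<kappa> * \<delta>" .
      qed
      finally show ?thesis using t by simp
    qed simp
  qed
  also have "\<dots> = ennreal (\<kappa> * \<delta>)" by (simp add: U.emeasure_space_1)
  finally show ?thesis .
qed

section \<open>From the exchange bound to the preference metric\<close>

text \<open>The gap 1 - \<beta> places about n1 (1 - \<beta>), at least 4 n \<delta>, first-group
  candidates above \<beta>, and the counting error \<epsilon> leaves 2 n \<delta> of them. The last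
  premise keeps the first group's selection rate at least half of its limit.\<close>

lemma typical_if_good:
  assumes "good u" "\<And>i. i < n \<Longrightarrow> 0 \<le> u i \<and> u i \<le> 1"
    and "4 * \<delta> / \<eta>1 \<le> 1 - \<beta>" "12 * (\<delta> / (\<eta>1 * \<eta>2)) \<le> 1"
  shows "typical (high u) (low u) = 1"
proof -
  have small: "12 * \<delta> / \<eta>1 \<le> \<eta>2"
    using assms(4) \<eta> by (simp add: divide_le_eq mult.commute)
  have lt: "i < n" if "i \<in> G1 \<or> i \<in> G2" for i using that G by auto
  have up: "upper_in (est_utility G2 \<beta> u) {..<n} (set (sel u))"
    unfolding sel_def by (rule upper_in_take_queue)
  have set_sel: "set (sel u) = set (high u) \<union> set (low u)" by (metis sel_eq set_append)
  have disj: "set (high u) \<inter> set (low u) = {}" using high_low(1)[of u] by simp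
  have hG: "set (high u) \<subseteq> G1" "G2 \<inter> set (high u) = {}"
    using high_subset_G1[of u] assms(2) by blast+
  have N1: "real (card (set (sel u) \<inter> G1)) = real (length (high u)) + real (card (G1 \<inter> set (low u)))"
  proof -
    have "set (sel u) \<inter> G1 = set (high u) \<union> (G1 \<inter> set (low u))" using hG set_sel by auto
    hence "card (set (sel u) \<inter> G1) = card (set (high u)) + card (G1 \<inter> set (low u))"
      using disj by (simp add: card_Un_disjoint disjoint_iff)
    thus ?thesis using high_low(1)[of u] by (simp add: distinct_card)
  qed
  have N2: "set (sel u) \<inter> G2 = G2 \<inter> set (low u)" using hG set_sel by auto
  have early: "2 * real n * \<delta> \<le> real (length (high u))"
  \<comment> \<open>If no one is late, all K slots go to the early part; otherwise every first-group
    candidate above \<beta> has been selected before the cut.\<close>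
  proof (cases "low u = []")
    case True
    hence "length (high u) = K" using sel_eq[of u] sel_simps(1,3)[of u] by (metis append_Nil2 distinct_card)
    moreover have "12 * \<delta> \<le> \<eta>2"
    proof -
      have "12 * \<delta> \<le> 12 * \<delta> / \<eta>1" using \<eta> \<eta>1_le \<delta>_pos by (simp add: le_divide_eq mult_left_le)
      thus ?thesis using small by simp
    qed
    hence "12 * \<delta> * real n \<le> \<eta>2 * real n" using n_pos by (intro mult_right_mono) auto
    moreover have "2 * real n * \<delta> \<le> 12 * \<delta> * real n" using \<delta>_pos by simp
    ultimately show ?thesis using K_ge by linarith
  next
    case False
    then obtain x where x: "x \<in> set (low u)" by (cases "low u") auto
    have "{i\<in>G1. \<beta> < u i} \<subseteq> set (high u)"
    proof
      fix i assume "i \<in> {i\<in>G1. \<beta> < u i}"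
      hence i: "i \<in> G1" "\<beta> < est_utility G2 \<beta> u i" using G(2) by (auto simp: est_utility_def)
      have "i \<in> set (sel u)"
      proof (rule ccontr)
        assume "i \<notin> set (sel u)"
        hence "est_utility G2 \<beta> u i \<le> est_utility G2 \<beta> u x"
          using up x set_sel lt i(1) by (auto simp: upper_in_def)
        thus False using in_low[OF x] i(2) by linarith
      qed
      thus "i \<in> set (high u)" using set_sel in_low[of i u] i(2) by auto
    qed
    hence "card {i\<in>G1. \<beta> < u i} \<le> card (set (high u))" by (intro card_mono) auto
    also have "\<dots> = length (high u)" using high_low(1)[of u] by (simp add: distinct_card)
    finally have "card {i\<in>G1. \<beta> < u i} \<le> length (high u)" .
    moreover have "real n1 * (1 - \<beta>) - \<epsilon> \<le> real (card {i\<in>G1. \<beta> < u i})"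
      using uniform_countsD(1)[OF good_uniform_counts(1)[OF assms(1)], of \<beta>] \<beta> by linarith
    moreover have "4 * (real n * \<delta>) \<le> real n1 * (1 - \<beta>)"
    proof -
      have "4 * (real n * \<delta>) = \<eta>1 * real n * (4 * \<delta> / \<eta>1)" using \<eta> by simp
      also have "\<dots> \<le> real n1 * (1 - \<beta>)"
        using n1_ge assms(3) \<eta> \<delta>_pos by (intro mult_mono) auto
      finally show ?thesis .
    qed
    moreover have "\<epsilon> \<le> 2 * (real n * \<delta>)"
      using \<epsilon>_le n_pos by (simp add: divide_le_eq mult_ac)
    ultimately show ?thesis by linarith
  qed
  have "real (card (set (sel u) \<inter> G2)) \<le> \<tau> * real (card (set (sel u) \<inter> G1))"
  proof -
    define d a b e where "d = 6 * \<delta> / \<eta>1" and "a = a1 / real n1" and "b = a2 / real n2"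
      and "e = 24 * (\<delta> / (\<eta>1 * \<eta>2))"
    define x y where "x = real (card (set (sel u) \<inter> G1)) / real n1"
      and "y = real (card (set (sel u) \<inter> G2)) / real n2"
    note approx = K_upper_approx[OF assms(1,2) up sel_simps(3)]
    have d: "3 * \<epsilon> / real n1 \<le> d" "3 * \<epsilon> / real n2 \<le> d"
      using \<epsilon>_div_le[OF n1_ge \<eta>(1)] \<epsilon>_div_le[OF n2_ge \<eta>(1)] by (auto simp: d_def)
    have "(a1 - 3 * \<epsilon>) / real n1 \<le> x"
      unfolding x_def using approx(1) by (intro divide_right_mono) auto
    hence x: "a - d \<le> x" using d(1) by (simp add: a_def diff_divide_distrib)
    have "y \<le> (a2 + 3 * \<epsilon>) / real n2"
      unfolding y_def using approx(2) by (intro divide_right_mono) auto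
    hence y: "y \<le> b + d" using d(2) by (simp add: b_def add_divide_distrib)
    have ab: "b \<le> a" "0 \<le> b" using alpha(6,2) by (auto simp: a_def b_def)
    have "2 * d \<le> \<eta>2" using small by (simp add: d_def)
    hence da: "2 * d \<le> a" "0 < a" using a1_ge \<eta> by (auto simp: a_def)
    have d0: "0 < d" using \<delta>_pos \<eta> by (simp add: d_def)
    have "4 * d / a \<le> 4 * d / \<eta>2" using d0 \<eta> a1_ge by (intro frac_le) (auto simp: a_def)
    also have "\<dots> = e" by (simp add: d_def e_def)
    finally have e: "4 * d / a \<le> e" .
    have e0: "0 \<le> e" using \<delta>_pos \<eta> by (simp add: e_def)
    \<comment> \<open>Of the 4 d one is lost since b is at most a, and two are lost since 2 d is at
      most a; one d remains.\<close>
    have "b + d \<le> (b / a + 4 * d / a) * (a - d)"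
    proof -
      have "(b / a + 4 * d / a) * (a - d) = (b + 4 * d) * (1 - d / a)"
        using da by (simp add: field_simps)
      also have "\<dots> = b + 4 * d - (b / a) * d - 4 * d * (d / a)"
        by (simp add: algebra_simps)
      also have "(b / a) * d \<le> 1 * d" using ab da d0 by (intro mult_right_mono) auto
      moreover have "4 * d * (d / a) \<le> 4 * d * (1 / 2)"
        using da d0 by (intro mult_left_mono) (auto simp: divide_le_eq)
      ultimately show ?thesis by linarith
    qed
    also have "\<dots> \<le> (b / a + e) * x"
      using e0 e x ab da d0 by (intro mult_mono add_nonneg_nonneg) auto
    finally have "y \<le> (\<rho> + e) * x" using y unfolding alpha(8) a_def b_def by linarith
    hence "real n2 * y \<le> real n2 * ((\<rho> + e) * x)" by (intro mult_left_mono) auto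
    thus ?thesis using pos by (simp add: x_def y_def \<tau>_def e_def mult_ac)
  qed
  also have "\<dots> \<le> \<tau> * (real (length (high u)) + real (card (G1 \<inter> set (low u))) + 1)"
    unfolding N1 using \<tau>_nonneg by (intro mult_left_mono) auto
  finally show ?thesis using early unfolding N2 by (simp add: typical_def)
qed

text \<open>With an early hit the first group's rate is positive, and the minimum over the maximum
  is at most the second rate over the first. An atypical queue and an early miss cost at most 1
  each.\<close>

lemma ratio_pointwise:
  assumes "\<And>i. i < n \<Longrightarrow> 0 \<le> u i \<and> u i \<le> 1" "\<And>i. i < n \<Longrightarrow> \<sigma> i \<in> rankings p" "0 < p"
  defines "H \<equiv> hit_at u \<sigma>"
  defines "M \<equiv> alg_st n k (est_utility G2 \<beta> u) \<sigma>"
  shows "min_max_ratio (first_choice_fraction G1 \<sigma> M) (first_choice_fraction G2 \<sigma> M)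
    \<le> real n1 / real n2 * hit_ratio (high u) (low u) H
      + typical (high u) (low u) * early_miss (high u) (low u) H + (1 - typical (high u) (low u))"
proof -
  define ys zs where "ys = high u" and "zs = low u"
  have sub: "G1 \<subseteq> {..<n}" "G2 \<subseteq> {..<n}" using G by auto
  have H: "H = hits k \<sigma> (take K (queue (est_utility G2 \<beta> u) n)) Map.empty"
    by (simp add: H_def sel_eq sel_def)
  have fc: "first_choice_fraction G \<sigma> M = real (card (G \<inter> H)) / real (card G)" if "G \<subseteq> {..<n}" for G
  proof -
    have "{i \<in> G. M i = Some (hd (\<sigma> i))} = G \<inter> H"
      unfolding H M_def by (rule first_choices_alg_st[where p = p]) (use assms(2,3) that K_le in auto)
    thus ?thesis by (simp add: first_choice_fraction_def)
  qed
  define X Y where "X = real (card (G1 \<inter> H)) / real n1" and "Y = real (card (G2 \<inter> H)) / real n2"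
  have XY: "0 \<le> X" "0 \<le> Y" by (auto simp: X_def Y_def)
  have goal: "min_max_ratio (first_choice_fraction G1 \<sigma> M) (first_choice_fraction G2 \<sigma> M) = min_max_ratio X Y"
    by (simp add: fc sub X_def Y_def)
  have Hsub: "H \<subseteq> set ys \<union> set zs"
    unfolding H_def ys_def zs_def using hits_subset by (metis set_append)
  have disj: "set ys \<inter> set zs = {}" using high_low(1)[of u] by (simp add: ys_def zs_def)
  have hG: "set ys \<subseteq> G1" "G2 \<inter> set ys = {}"
    unfolding ys_def using high_subset_G1[of u] assms(1) by blast+
  have H1: "G1 \<inter> H = (set ys \<inter> H) \<union> (G1 \<inter> set zs \<inter> H)" and H2: "G2 \<inter> H = G2 \<inter> set zs \<inter> H"
    using Hsub hG by auto
  have c1: "card (G1 \<inter> H) = card (set ys \<inter> H) + card (G1 \<inter> set zs \<inter> H)"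
    unfolding H1 using disj by (intro card_Un_disjoint) auto
  have le1: "min_max_ratio X Y \<le> 1" by (rule min_max_ratio_bounds[OF XY])
  have hr: "0 \<le> hit_ratio ys zs H" by (auto simp: hit_ratio_def typical_def)
  have nn: "0 \<le> real n1 / real n2 * hit_ratio ys zs H" using hr by simp
  show ?thesis
  proof (cases "typical ys zs = 0")
    case True
    thus ?thesis using le1 nn unfolding goal ys_def[symmetric] zs_def[symmetric] by simp
  next
    case False
    hence t: "typical ys zs = 1" using typical_cases[of ys zs] by auto
    show ?thesis
    proof (cases "set ys \<inter> H = {}")
      case True
      show ?thesis
      proof (cases "set zs \<inter> H = {}")
        case True
        hence "H = {}" using \<open>set ys \<inter> H = {}\<close> Hsub by auto
        \<comment> \<open>Without any hit the ratio is 0/0, whose value is 0.\<close>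
        hence "min_max_ratio X Y = 0" by (simp add: X_def Y_def min_max_ratio_def)
        thus ?thesis using nn early_miss_bounds(1)[of ys zs H] t
          unfolding goal ys_def[symmetric] zs_def[symmetric] by simp
      next
        case False
        hence "early_miss ys zs H = 1" using True by (simp add: early_miss_def)
        thus ?thesis using nn le1 t unfolding goal ys_def[symmetric] zs_def[symmetric] by simp
      qed
    next
      case False
      hence "0 < card (G1 \<inter> H)" unfolding c1 by (simp add: card_gt_0_iff)
      hence X: "0 < X" using pos by (simp add: X_def)
      have "min_max_ratio X Y \<le> Y / X"
        unfolding min_max_ratio_def using X XY by (intro frac_le) auto
      also have "\<dots> = real n1 / real n2 * hit_ratio ys zs H"
        using t False by (simp add: hit_ratio_def X_def Y_def c1 H2 mult_ac)
      finally show ?thesis using t early_miss_bounds(1)[of ys zs H]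
        unfolding goal ys_def[symmetric] zs_def[symmetric] by simp
    qed
  qed
qed

lemma p_pos: "0 < p" using pos(3) by (auto simp: total_capacity_def intro: gr0I)

text \<open>The integral of a non-integrable function is 0 by convention, so the bound holds without
  a measurability premise on f.\<close>

lemma lebesgue_integral_le_nn_integral:
  assumes "\<And>x. 0 \<le> f x" "(\<integral>\<^sup>+x. ennreal (f x) \<partial>M) \<le> ennreal c" "0 \<le> c"
  shows "integral\<^sup>L M f \<le> c"
proof (cases "integrable M f")
  case True
  hence "integral\<^sup>L M f = enn2real (\<integral>\<^sup>+x. ennreal (f x) \<partial>M)"
    using assms(1) by (intro integral_eq_nn_integral) auto
  also have "\<dots> \<le> enn2real (ennreal c)" using assms(2) by (intro enn2real_mono) auto
  finally show ?thesis using assms(3) by simp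
next
  case False
  thus ?thesis using assms(3) by (simp add: not_integrable_integral_eq)
qed

definition "first_choice_ratio x = (let M = alg_st n k (est_utility G2 \<beta> (fst x)) (snd x) in
  min_max_ratio (first_choice_fraction G1 (snd x) M) (first_choice_fraction G2 (snd x) M))"

lemma preference_metric_le:
  assumes "(\<integral>\<^sup>+x. ennreal (first_choice_ratio x) \<partial>joint_law n L) \<le> ennreal c" "0 \<le> c"
  shows "preference_metric n G1 G2 \<beta> L (alg_st n k) \<le> c"
proof -
  have "preference_metric n G1 G2 \<beta> L (alg_st n k) = integral\<^sup>L (input_law n L) first_choice_ratio"
    unfolding preference_metric_def first_choice_ratio_def
    by (intro Bochner_Integration.integral_cong refl) (auto simp: split_beta)
  also have "\<dots> \<le> c"
  proof (rule lebesgue_integral_le_nn_integral)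
    show "0 \<le> first_choice_ratio x" for x
      unfolding first_choice_ratio_def Let_def
      by (intro min_max_ratio_bounds) (auto simp: first_choice_fraction_def)
    show "(\<integral>\<^sup>+x. ennreal (first_choice_ratio x) \<partial>input_law n L) \<le> ennreal c"
      unfolding input_law_eq nn_integral_completion by (rule assms)
  qed fact
  finally show ?thesis .
qed

lemma preference_metric_le_1: "preference_metric n G1 G2 \<beta> L (alg_st n k) \<le> 1"
proof (rule preference_metric_le)
  interpret prob_space "joint_law n L" by (rule prob_space_joint_law)
  have "first_choice_ratio x \<le> 1" for x
    unfolding first_choice_ratio_def Let_def
    by (intro min_max_ratio_bounds) (auto simp: first_choice_fraction_def)
  hence "(\<integral>\<^sup>+x. ennreal (first_choice_ratio x) \<partial>joint_law n L) \<le> (\<integral>\<^sup>+x. ennreal 1 \<partial>joint_law n L)"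
    by (intro nn_integral_mono ennreal_leI)
  thus "(\<integral>\<^sup>+x. ennreal (first_choice_ratio x) \<partial>joint_law n L) \<le> ennreal 1"
    by (simp add: emeasure_space_1)
qed simp

lemma preference_bound_main:
  assumes c: "first_choice_control k L n \<kappa>" "0 \<le> \<kappa>"
    and "4 * \<delta> / \<eta>1 \<le> 1 - \<beta>" "12 * (\<delta> / (\<eta>1 * \<eta>2)) \<le> 1"
  shows "preference_metric n G1 G2 \<beta> L (alg_st n k)
    \<le> (\<rho> + 24 * (\<delta> / (\<eta>1 * \<eta>2))) * (1 + \<kappa> * \<delta>) + \<kappa> * \<delta> + 8 * \<delta>"
proof -
  define A where "A = (\<lambda>x. hit_ratio (high (fst x)) (low (fst x)) (hit_at (fst x) (snd x)))"
  define B where "B = (\<lambda>x. typical (high (fst x)) (low (fst x)) *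
      early_miss (high (fst x)) (low (fst x)) (hit_at (fst x) (snd x)))"
  let ?bad = "{x \<in> space (joint_law n L). \<not> good (fst x)}"
  define r where "r = real n1 / real n2"
  have r: "0 \<le> r" by (simp add: r_def)
  have A0: "0 \<le> A x" for x by (auto simp: A_def hit_ratio_def typical_def)
  have B0: "0 \<le> B x" for x using early_miss_bounds(1) by (auto simp: B_def typical_def)
  have meas: "(\<lambda>x. ennreal (A x)) \<in> borel_measurable (joint_law n L)" "(\<lambda>x. ennreal (B x)) \<in> borel_measurable (joint_law n L)"
    unfolding A_def B_def by (rule measurable_joint)+
  have "(\<integral>\<^sup>+x. ennreal (first_choice_ratio x) \<partial>joint_law n L)
      \<le> (\<integral>\<^sup>+x. ennreal r * ennreal (A x) + ennreal (B x) + indicator ?bad x \<partial>joint_law n L)"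
  proof (rule nn_integral_mono_AE)
    have "AE x in joint_law n L. x \<in> space (joint_law n L)" by simp
    with AE_joint_law_utility[OF AE_utilities_range] AE_joint_law_preference[OF AE_preferences_rankings[OF L]]
    show "AE x in joint_law n L. ennreal (first_choice_ratio x) \<le> ennreal r * ennreal (A x) + ennreal (B x) + indicator ?bad x"
    proof eventually_elim
      case (elim x)
      have range: "0 \<le> fst x i \<and> fst x i \<le> 1" if "i < n" for i using elim that by (auto simp: less_imp_le)
      have rank: "snd x i \<in> rankings p" if "i < n" for i using elim that by auto
      have "first_choice_ratio x \<le> r * A x + B x + (1 - typical (high (fst x)) (low (fst x)))"
        unfolding first_choice_ratio_def Let_def A_def B_def r_def
        by (rule ratio_pointwise[OF range rank p_pos])
      also have "1 - typical (high (fst x)) (low (fst x)) \<le> indicator ?bad x"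
        using typical_if_good[OF _ range assms(3,4)] elim by (auto simp: indicator_def typical_def)
      finally have "ennreal (first_choice_ratio x) \<le> ennreal (r * A x + B x + indicator ?bad x)"
        by (intro ennreal_leI) simp
      also have "\<dots> = ennreal (r * A x) + ennreal (B x) + ennreal (indicator ?bad x)"
        using r A0[of x] B0[of x] by (subst ennreal_plus, simp_all)+
      also have "\<dots> = ennreal r * ennreal (A x) + ennreal (B x) + indicator ?bad x"
        using r A0[of x] by (simp add: ennreal_mult indicator_def)
      finally show ?case .
    qed
  qed
  also have "\<dots> = ennreal r * (\<integral>\<^sup>+x. ennreal (A x) \<partial>joint_law n L) + (\<integral>\<^sup>+x. ennreal (B x) \<partial>joint_law n L)
      + emeasure (joint_law n L) ?bad"
    using meas bad_joint(1) by (simp add: nn_integral_add nn_integral_cmult)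
  also have "\<dots> \<le> ennreal r * ennreal (\<tau> * (1 + \<kappa> * \<delta>)) + ennreal (\<kappa> * \<delta>) + ennreal (8 * \<delta>)"
  proof (intro add_mono mult_left_mono)
    interpret prob_space "joint_law n L" by (rule prob_space_joint_law)
    show "emeasure (joint_law n L) ?bad \<le> ennreal (8 * \<delta>)"
      unfolding emeasure_eq_measure by (rule ennreal_leI[OF bad_joint(2)])
  qed (use expected_hit_ratio[OF c] expected_early_miss[OF c] in \<open>auto simp: A_def B_def\<close>)
  also have "\<dots> = ennreal (r * (\<tau> * (1 + \<kappa> * \<delta>)) + \<kappa> * \<delta> + 8 * \<delta>)"
    using r c(2) \<delta>_pos \<tau>_nonneg by (simp add: ennreal_mult[symmetric] ennreal_plus[symmetric] del: ennreal_plus)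
  also have "r * (\<tau> * (1 + \<kappa> * \<delta>)) = (\<rho> + 24 * (\<delta> / (\<eta>1 * \<eta>2))) * (1 + \<kappa> * \<delta>)"
    using pos by (simp add: r_def \<tau>_def)
  finally show ?thesis
    by (rule preference_metric_le) (use c(2) \<delta>_pos \<eta> alpha(9) in \<open>auto intro!: add_nonneg_nonneg mult_nonneg_nonneg\<close>)
qed

text \<open>If the error term is large or \<beta> is close to 1, the bound exceeds 1 and is trivial.
  The remaining case satisfies the premises of \<open>preference_bound_main\<close>.\<close>

lemma preference_bound:
  assumes "first_choice_control k L n \<kappa>" "0 \<le> \<kappa>"
  shows "preference_metric n G1 G2 \<beta> L (alg_st n k) \<le> \<rho> + (32 + 4 * \<kappa>) * (\<delta> / (\<eta>1 * \<eta>2))"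
proof -
  define e where "e = \<delta> / (\<eta>1 * \<eta>2)"
  have e: "0 < e" using \<delta>_pos \<eta> by (simp add: e_def)
  have \<delta>e: "\<delta> / \<eta>1 \<le> e" "\<delta> \<le> e"
    using \<delta>_pos \<eta> \<eta>1_le \<eta>2_le by (auto simp: e_def divide_simps mult_left_le mult_le_one)
  have \<kappa>e: "0 \<le> \<kappa> * e" using assms(2) e by simp
  have trivial: "?thesis" if "1 \<le> \<rho> + 12 * e"
    using preference_metric_le_1 that e \<kappa>e unfolding e_def[symmetric] by (simp add: algebra_simps)
  show ?thesis
  proof (cases "12 * e \<le> 1")
    case False
    thus ?thesis using trivial alpha(9) by linarith
  next
    case small: True
    show ?thesis
    proof (cases "4 * \<delta> / \<eta>1 \<le> 1 - \<beta>")
      case True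
      have "preference_metric n G1 G2 \<beta> L (alg_st n k)
          \<le> (\<rho> + 24 * e) * (1 + \<kappa> * \<delta>) + \<kappa> * \<delta> + 8 * \<delta>"
        using preference_bound_main[OF assms True] small by (simp add: e_def)
      \<comment> \<open>Here \<rho> is at most 1 and 24 e at most 2, so the mixed term is at most 3
        \<kappa> e.\<close>
      also have "\<dots> \<le> \<rho> + 24 * e + 3 * (\<kappa> * e) + \<kappa> * e + 8 * e"
      proof -
        have "\<kappa> * \<delta> \<le> \<kappa> * e" using \<delta>e assms(2) by (intro mult_left_mono) auto
        moreover have "(\<rho> + 24 * e) * (\<kappa> * \<delta>) \<le> 3 * (\<kappa> * e)"
          using \<delta>e assms(2) small alpha(9,10) e \<delta>_pos calculation by (intro mult_mono) auto
        ultimately show ?thesis using \<delta>e by (simp add: distrib_left)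
      qed
      finally show ?thesis unfolding e_def[symmetric] by (simp add: algebra_simps)
    next
      case False
      \<comment> \<open>Now 1 - \<beta> is at most 4 e and hence at most 1/3, so
        \<open>limit_ratio_ge\<close> applies and gives \<rho> at least 1 - 8 e.\<close>
      hence b: "1 - \<beta> \<le> 4 * e" using \<delta>e by simp
      have "1/2 \<le> \<beta>" using b small by simp
      from limit_ratio_ge[OF alpha_premises(1-4) this \<beta>(2)]
      have l: "1 - 2 * (1 - \<beta>) * (real n1 + real n2) / real K \<le> \<rho>" .
      have nn: "real n1 + real n2 = real n" by (simp add: n_eq)
      have "2 * (1 - \<beta>) * (real n1 + real n2) / real K \<le> 2 * (4 * \<delta> / \<eta>1) * real n / (\<eta>2 * real n)"
        unfolding nn
      proof (rule frac_le)
        show "2 * (1 - \<beta>) * real n \<le> 2 * (4 * \<delta> / \<eta>1) * real n"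
          using False by (intro mult_right_mono mult_left_mono) auto
      qed (use K_ge n_pos \<eta> \<delta>_pos in auto)
      also have "\<dots> = 8 * e" using n_pos by (simp add: e_def)
      finally show ?thesis using trivial l e by linarith
    qed
  qed
qed

end

lemma (in selection) scaled_error:
  "sqrt (ln (real n)) / (\<eta>1 * \<eta>2 * sqrt (real n)) = \<delta> / (\<eta>1 * \<eta>2)"
  "sqrt (ln (real n)) / (\<eta>2 * sqrt (real n)) = \<delta> / \<eta>2"
  "real p * sqrt (ln (real n)) / (\<eta>1 * \<eta>2 * sqrt (real n)) = real p * (\<delta> / (\<eta>1 * \<eta>2))"
  by (simp_all add: \<delta>_def mult.commute)

lemma (in selection) preference_bound_p:
  assumes "first_choice_control k L n \<kappa>" "0 \<le> \<kappa>" "32 + 4 * \<kappa> \<le> C"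
  shows "preference_metric n G1 G2 \<beta> L (alg_st n k) \<le> \<rho> + C * (real p * (\<delta> / (\<eta>1 * \<eta>2)))"
proof -
  have "0 \<le> \<delta> / (\<eta>1 * \<eta>2)" using \<delta>_pos \<eta> by simp
  hence "(32 + 4 * \<kappa>) * (\<delta> / (\<eta>1 * \<eta>2)) \<le> C * (real p * (\<delta> / (\<eta>1 * \<eta>2)))"
    using assms(2,3) p_pos mult_right_mono[of 1 "real p" "\<delta> / (\<eta>1 * \<eta>2)"] by (intro mult_mono) auto
  thus ?thesis using preference_bound[OF assms(1,2)] by linarith
qed

text \<open>Two constants are distinguished for the preference metric. Institutions without slots
  can make the initial hit rate arbitrarily small, so the wait for the first early hit, and with it
  \<kappa>, is bounded only in terms of p and L. Positive capacities make the initial rate 1, and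
  \<kappa> = 1 serves for all models.\<close>

theorem theorem5:
  shows
    "(\<exists>C>0. \<forall>n p k G1 G2 \<beta> L \<eta>1 \<eta>2.
        selection_model n p k G1 G2 \<beta> L \<eta>1 \<eta>2 \<longrightarrow>
        (let K = total_capacity p k; n1 = card G1; n2 = card G2 in
          (\<forall>\<A>. maximizes_est_utility n p k G2 \<beta> \<A> \<longrightarrow>
             \<bar>representation_metric n G1 G2 \<beta> L \<A> - limit_ratio \<beta> (real K) (real n1) (real n2)\<bar>
               \<le> C * (sqrt (ln (real n)) / (\<eta>1 * \<eta>2 * sqrt (real n))) \<and>
             \<bar>utility_metric n K G2 \<beta> L \<A>
                - (f_sel (\<alpha>1 \<beta> (real K) (real n1) (real n2)) (real n1)
                   + f_sel (\<alpha>2 \<beta> (real K) (real n1) (real n2)) (real n2)) / f_sel (real K) (real n)\<bar>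
               \<le> C * (sqrt (ln (real n)) / (\<eta>2 * sqrt (real n)))) \<and>
          ((\<forall>l<p. 0 < k l) \<longrightarrow>
             preference_metric n G1 G2 \<beta> L (alg_st n k)
               \<le> limit_ratio \<beta> (real K) (real n1) (real n2)
                  + C * (real p * sqrt (ln (real n)) / (\<eta>1 * \<eta>2 * sqrt (real n)))))) \<and>
     (\<forall>p L. \<exists>C>0. \<forall>n k G1 G2 \<beta> \<eta>1 \<eta>2.
        selection_model n p k G1 G2 \<beta> L \<eta>1 \<eta>2 \<longrightarrow>
        (let K = total_capacity p k; n1 = card G1; n2 = card G2 in
          preference_metric n G1 G2 \<beta> L (alg_st n k)
            \<le> limit_ratio \<beta> (real K) (real n1) (real n2)
               + C * (real p * sqrt (ln (real n)) / (\<eta>1 * \<eta>2 * sqrt (real n)))))"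
proof (rule conjI, goal_cases)
  case 1
  show ?case
  \<comment> \<open>The largest of the constants: 52 + 16 for utility, against 20 for representation
    and 32 + 4 for first choices.\<close>
  proof (intro exI[of _ "68::real"] conjI allI impI, goal_cases)
    case (2 n p k G1 G2 \<beta> L \<eta>1 \<eta>2)
    then interpret selection n p k G1 G2 \<beta> L \<eta>1 \<eta>2 by (rule selection.intro)
    have "\<bar>representation_metric n G1 G2 \<beta> L \<A> - \<rho>\<bar> \<le> 68 * (\<delta> / (\<eta>1 * \<eta>2)) \<and>
        \<bar>utility_metric n K G2 \<beta> L \<A> - utility_limit\<bar> \<le> 68 * (\<delta> / \<eta>2)"
      if "maximizes_est_utility n p k G2 \<beta> \<A>" for \<A>
    proof -
      have "0 \<le> \<delta> / (\<eta>1 * \<eta>2)" using \<delta>_pos \<eta> by simp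
      thus ?thesis using representation_bound[OF that] utility_bound[OF that] by linarith
    qed
    moreover have "preference_metric n G1 G2 \<beta> L (alg_st n k) \<le> \<rho> + 68 * (real p * (\<delta> / (\<eta>1 * \<eta>2)))"
      if "\<forall>l<p. 0 < k l"
      by (rule preference_bound_p[OF first_choice_control_all_vacant[OF that L p_pos]]) auto
    ultimately show ?case unfolding Let_def scaled_error utility_limit_def by blast
  qed simp
next
  case 2
  show ?case
  proof (intro allI)
    fix p :: nat and L :: "nat list pmf"
    show "\<exists>C>0. \<forall>n k G1 G2 \<beta> \<eta>1 \<eta>2. selection_model n p k G1 G2 \<beta> L \<eta>1 \<eta>2 \<longrightarrow>
        (let K = total_capacity p k; n1 = card G1; n2 = card G2 in
          preference_metric n G1 G2 \<beta> L (alg_st n k)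
            \<le> limit_ratio \<beta> (real K) (real n1) (real n2)
               + C * (real p * sqrt (ln (real n)) / (\<eta>1 * \<eta>2 * sqrt (real n))))"
    proof (cases "set_pmf L \<subseteq> rankings p \<and> 0 < p")
      case True
      then obtain q where q: "0 < q" "q \<le> 1" "\<And>k M. hit_rate k L M = 0 \<or> q \<le> hit_rate k L M"
        using ex_min_hit_rate by blast
      \<comment> \<open>The rate q was obtained from p and L alone, so the constant precedes the
        choice of n, the capacities and the groups.\<close>
      define \<kappa> where "\<kappa> = 25 / q\<^sup>2"
      have \<kappa>: "0 \<le> \<kappa>" by (simp add: \<kappa>_def)
      show ?thesis
      proof (intro exI[of _ "32 + 4 * \<kappa>"] conjI allI impI, goal_cases)
        case (2 n k G1 G2 \<beta> \<eta>1 \<eta>2)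
        then interpret selection n p k G1 G2 \<beta> L \<eta>1 \<eta>2 by (rule selection.intro)
        have "first_choice_control k L n \<kappa>"
          unfolding \<kappa>_def by (rule first_choice_control_min_rate[OF q])
        from preference_bound_p[OF this \<kappa> order_refl] show ?case unfolding Let_def scaled_error .
      qed (use \<kappa> in simp)
    next
      \<comment> \<open>No model exists for such p and L: K > 0 forces an institution, and the
        support of L consists of rankings. Any constant will do.\<close>
      case False
      have "\<not> selection_model n p k G1 G2 \<beta> L \<eta>1 \<eta>2" for n k G1 G2 \<beta> \<eta>1 \<eta>2
      proof
        assume "selection_model n p k G1 G2 \<beta> L \<eta>1 \<eta>2"
        then interpret selection n p k G1 G2 \<beta> L \<eta>1 \<eta>2 by (rule selection.intro)
        show False using False L p_pos by blast
      qed
      thus ?thesis by (intro exI[of _ 1]) simp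
    qed
  qed
qed

end
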